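(* Let $M$ be an $n$-dimensional smooth manifold and let $\{f:M\to\mathbb{R}^{n+1},\xi\}$ be an equiaffine immersion with second fundamental form $h$, induced connection $\nabla$ and conormal map $\nu$. Define: $E^+_p=f_*(T_pM)$, $E^-_p=(f_*(T_pM))^*$, $E=E^+\oplus E^-$; $\theta(\eta^+\oplus\eta^-,\zeta^+\oplus\zeta^-)=\frac12\{\langle\zeta^-,\eta^+\rangle+\langle\eta^-,\zeta^+\rangle\}$; $I(\eta^+\oplus\eta^-)=\eta^+\oplus(-\eta^-)$; the bundle map $\Phi:TM\to E$, $\Phi(X)=f_*X\oplus(-\nu_*X)$, where $\nu_*X\in(\mathbb{R}^{n+1})^*$ is regarded as an element of $(f_*(TM))^*$ by restriction; the connection $\nabla^+$ on $E^+$ by $\nabla^+_Xf_*Y=f_*(\nabla_XY)$; and the connection $\nabla^-$ on $E^-$ by $X\theta(\eta^+,\zeta^-)=\theta(\nabla^+_X\eta^+,\zeta^-)+\theta(\eta^+,\nabla^-_X\zeta^-)$ for $X\in\Gamma(TM)$, $\eta^+\in\Gamma(E^+)$, $\zeta^-\in\Gamma(E^-)$. Then $(h,(E,\theta,I),\Phi,\nabla^+,\nabla^-)$ is a quasi-Codazzi structure on $M$.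
   Context: All objects are $C^\infty$. Affine immersions. An affine immersion $\{f,\xi\}$ is an immersion $f:M\to\mathbb{R}^{n+1}$ with a vector field $\xi$ along $f$ such that $T_{f(p)}\mathbb{R}^{n+1}=f_*(T_pM)\oplus\operatorname{span}\{\xi_p\}$ for all $p$. With $D$ the standard flat connection, write $D_Xf_*Y=f_*(\nabla_XY)+h(X,Y)\xi$ and $D_X\xi=-f_*(S(X))+\tau(X)\xi$, with $\nabla$ the (torsion-free) induced connection, $h$ the (symmetric, possibly degenerate) second fundamental form, $S$ a $(1,1)$-tensor field, $\tau$ a 1-form. It is equiaffine if $\tau\equiv0$. The conormal map $\nu:M\to(\mathbb{R}^{n+1})^*$ is defined by $\langle\nu(p),f_*X_p\rangle=0$ for $X_p\in T_pM$, $\langle\nu(p),\xi_p\rangle=1$. Quasi-Codazzi structures. A para-Hermitian vector bundle $(E,\theta,I)$ on $M$ is a rank $2n$ vector bundle $E$, a symmetric nondegenerate $\theta\in\Gamma(E^*\otimes E^* )$ and a bundle isomorphism $I:E\to E$ with $I^2=\mathrm{id}$, $I\ne\mathrm{id}$, eigenvalues $\pm1$ whose eigen-subbundles $E^{\pm}$ have equal rank and satisfy $E=E^+\oplus E^-$, and $\theta(I\eta,\zeta)+\theta(\eta,I\zeta)=0$. Put $\omega(\eta,\zeta)=\theta(\eta,I\zeta)$, a symplectic form on $E$. Let $\Phi:TM\to E$ be a bundle map (fiberwise linear over $\mathrm{id}_M$) such that for every $p$, $\Phi_p$ has rank $n$ and its image is a Lagrangian subspace of $(E_p,\omega_p)$;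 write $\Phi=\Phi^+\oplus\Phi^-$ with $\Phi^\pm:TM\to E^\pm$ the components, and $h=\Phi^*\theta$, i.e. $h(X,Y)=\theta(\Phi(X),\Phi(Y))$. Let $\nabla^\pm$ be connections on $E^\pm$ that are mutually dual: $X\theta(\eta^+,\eta^-)=\theta(\nabla^+_X\eta^+,\eta^-)+\theta(\eta^+,\nabla^-_X\eta^-)$. The tuple $(h,(E,\theta,I),\Phi,\nabla^+,\nabla^-)$ is a quasi-Codazzi structure if $\nabla^+$ and $\nabla^-$ are relatively torsion-free with respect to $\Phi^+$ and $\Phi^-$, that is, $\nabla^{\pm}_X\Phi^\pm(Y)-\nabla^\pm_Y\Phi^\pm(X)-\Phi^\pm([X,Y])=0$ for all $X,Y\in\Gamma(TM)$. *)

theory Defs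
  imports "HOL-Analysis.Analysis" "HOL-Library.Function_Algebras"
begin

text \<open>Pointwise scalar multiplication. Fibres of bundles are subspaces of an ambient real vector
  space; for tangent spaces and dual spaces this is a space of functions.\<close>

instantiation "fun" :: (type, real_vector) real_vector
begin

definition scaleR_fun_def: "scaleR r f = (\<lambda>x. r *\<^sub>R f x)"

instance
  by standard (simp_all add: scaleR_fun_def fun_eq_iff scaleR_add_right scaleR_add_left)

end


section \<open>Smooth maps and smooth manifolds\<close>

text \<open>Used for open \<open>S\<close> only.\<close>

primrec Ck_on :: "nat \<Rightarrow> 'a::real_normed_vector set \<Rightarrow> ('a \<Rightarrow> 'b::real_normed_vector) \<Rightarrow> bool"
where
  "Ck_on 0 S f \<longleftrightarrow> continuous_on S f"
| "Ck_on (Suc k) S f \<longleftrightarrow>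
     (\<forall>x\<in>S. f differentiable (at x)) \<and> (\<forall>v. Ck_on k S (\<lambda>x. frechet_derivative f (at x) v))"

definition smooth_on :: "'a::real_normed_vector set \<Rightarrow> ('a \<Rightarrow> 'b::real_normed_vector) \<Rightarrow> bool"
where "smooth_on S f \<longleftrightarrow> (\<forall>k. Ck_on k S f)"

type_synonym ('m, 'n) chart = "'m set \<times> ('m \<Rightarrow> real ^ 'n)"

definition chart_inv :: "('m, 'n::finite) chart \<Rightarrow> real ^ 'n \<Rightarrow> 'm"
where "chart_inv c = inv_into (fst c) (snd c)"

definition smooth_atlas :: "('m::topological_space, 'n::finite) chart set \<Rightarrow> bool"
where "smooth_atlas A \<longleftrightarrow>
  (\<Union>c\<in>A. fst c) = UNIV \<and>
  (\<forall>c\<in>A. open (fst c) \<and> open (snd c ` fst c) \<and>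
     homeomorphism (fst c) (snd c ` fst c) (snd c) (chart_inv c)) \<and>
  (\<forall>c\<in>A. \<forall>d\<in>A. smooth_on (snd c ` (fst c \<inter> fst d)) (snd d \<circ> chart_inv c))"

definition smooth_map_on ::
  "('m::topological_space, 'n::finite) chart set \<Rightarrow> 'm set \<Rightarrow> ('m \<Rightarrow> 'b::real_normed_vector) \<Rightarrow> bool"
where "smooth_map_on A W g \<longleftrightarrow>
  (\<forall>c\<in>A. smooth_on (snd c ` (fst c \<inter> W)) (g \<circ> chart_inv c))"

text \<open>Directional derivative at \<open>p\<close> of \<open>g\<close>, read in the chart \<open>c\<close>, along the vector with
  coordinates \<open>v\<close>.\<close>

definition chart_deriv ::
  "('m, 'n::finite) chart \<Rightarrow> ('m \<Rightarrow> 'b::real_normed_vector) \<Rightarrow> 'm \<Rightarrow> real ^ 'n \<Rightarrow> 'b"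
where "chart_deriv c g p v = frechet_derivative (g \<circ> chart_inv c) (at (snd c p)) v"

text \<open>A tangent vector at \<open>p\<close> is the family of its coordinates in all charts around \<open>p\<close>, related by
  the Jacobians of the transition maps (and, so that equality is meaningful, zero elsewhere).\<close>

type_synonym ('m, 'n) tvec = "('m, 'n) chart \<Rightarrow> real ^ 'n"

definition tangent_space ::
  "('m, 'n::finite) chart set \<Rightarrow> 'm \<Rightarrow> ('m, 'n) tvec set"
where "tangent_space A p = {u.
  (\<forall>c\<in>A. \<forall>d\<in>A. p \<in> fst c \<inter> fst d \<longrightarrow> u d = chart_deriv c (snd d) p (u c)) \<and>
  (\<forall>c. \<not> (c \<in> A \<and> p \<in> fst c) \<longrightarrow> u c = 0)}"

definition coord_vec ::
  "('m, 'n::finite) chart set \<Rightarrow> ('m, 'n) chart \<Rightarrow> 'n \<Rightarrow> 'm \<Rightarrow> ('m, 'n) tvec"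
where "coord_vec A c i p =
  (\<lambda>d. if d \<in> A \<and> p \<in> fst d then chart_deriv c (snd d) p (axis i 1) else 0)"

text \<open>The differential of a map into a normed space \<open>V\<close>, with \<open>T\<^sub>g\<^sub>(\<^sub>p\<^sub>)V = V\<close>. It serves as the
  push-forward \<open>g\<^sub>*\<close>, as the derivative \<open>u(g)\<close> of a function, and as the flat derivative \<open>D\<^sub>u g\<close> of
  a vector field \<open>g\<close> along an immersion. By the chain rule the choice of chart is irrelevant for
  smooth \<open>g\<close>.\<close>

definition differential ::
  "('m, 'n::finite) chart set \<Rightarrow> ('m \<Rightarrow> 'b::real_normed_vector) \<Rightarrow> 'm \<Rightarrow> ('m, 'n) tvec \<Rightarrow> 'b"
where "differential A g p u =
  (let c = (SOME c. c \<in> A \<and> p \<in> fst c) in chart_deriv c g p (u c))"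


section \<open>Vector bundles\<close>

definition lin_on :: "'a::real_vector set \<Rightarrow> ('a \<Rightarrow> 'b::real_vector) \<Rightarrow> bool"
where "lin_on V g \<longleftrightarrow>
  (\<forall>x\<in>V. \<forall>y\<in>V. g (x + y) = g x + g y) \<and> (\<forall>r. \<forall>x\<in>V. g (r *\<^sub>R x) = r *\<^sub>R g x)"

definition basis_of :: "'a::real_vector set \<Rightarrow> 'i set \<Rightarrow> ('i \<Rightarrow> 'a) \<Rightarrow> bool"
where "basis_of V J b \<longleftrightarrow> inj_on b J \<and> independent (b ` J) \<and> span (b ` J) = V"

text \<open>A family of vector spaces over \<open>'m\<close>, with a set of local frames \<open>(U, s)\<close> in place of the
  equivalent local trivialisations \<open>U \<times> \<real>\<^sup>r \<cong> E|U\<close>, \<open>(p, c) \<mapsto> \<Sum>\<^sub>i c\<^sub>i s\<^sub>i(p)\<close>. The rank is the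
  cardinality of the index type \<open>'i\<close>.\<close>

record ('m, 'i, 'e) vbundle =
  fibre :: "'m \<Rightarrow> 'e set"
  frames :: "('m set \<times> ('i \<Rightarrow> 'm \<Rightarrow> 'e)) set"

definition section_on ::
  "('m::topological_space, 'n::finite) chart set \<Rightarrow> ('m, 'i::finite, 'e::real_vector) vbundle \<Rightarrow>
   'm set \<Rightarrow> ('m \<Rightarrow> 'e) \<Rightarrow> bool"
where "section_on A E W \<eta> \<longleftrightarrow>
  (\<forall>p\<in>W. \<eta> p \<in> fibre E p) \<and>
  (\<forall>(U, s)\<in>frames E. \<exists>c :: 'i \<Rightarrow> 'm \<Rightarrow> real.
     (\<forall>i. smooth_map_on A (U \<inter> W) (c i)) \<and>
     (\<forall>p\<in>U \<inter> W. \<eta> p = (\<Sum>i\<in>UNIV. c i p *\<^sub>R s i p)))"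

definition sections ::
  "('m::topological_space, 'n::finite) chart set \<Rightarrow> ('m, 'i::finite, 'e::real_vector) vbundle \<Rightarrow>
   ('m \<Rightarrow> 'e) set"
where "sections A E = {\<eta>. section_on A E UNIV \<eta>}"

definition vector_bundle ::
  "('m::topological_space, 'n::finite) chart set \<Rightarrow> ('m, 'i::finite, 'e::real_vector) vbundle \<Rightarrow> bool"
where "vector_bundle A E \<longleftrightarrow>
  (\<forall>p. subspace (fibre E p)) \<and>
  (\<Union>(U, s)\<in>frames E. U) = UNIV \<and>
  (\<forall>(U, s)\<in>frames E. open U \<and> (\<forall>p\<in>U. basis_of (fibre E p) UNIV (\<lambda>i. s i p))) \<and>
  (\<forall>(U, s)\<in>frames E. \<forall>i. section_on A E U (s i))"

text \<open>The last clause says that the transition matrices between any two frames are smooth.\<close>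

definition subbundle ::
  "('m::topological_space, 'n::finite) chart set \<Rightarrow> ('m, 'i::finite, 'e::real_vector) vbundle \<Rightarrow>
   ('m \<Rightarrow> 'e set) \<Rightarrow> nat \<Rightarrow> bool"
where "subbundle A E F r \<longleftrightarrow>
  (\<forall>p. F p \<subseteq> fibre E p) \<and>
  (\<forall>p. \<exists>U. \<exists>s :: nat \<Rightarrow> 'm \<Rightarrow> 'e. open U \<and> p \<in> U \<and> (\<forall>i<r. section_on A E U (s i)) \<and>
     (\<forall>q\<in>U. basis_of (F q) {..<r} (\<lambda>i. s i q)))"

definition subbundle_sections ::
  "('m::topological_space, 'n::finite) chart set \<Rightarrow> ('m, 'i::finite, 'e::real_vector) vbundle \<Rightarrow>
   ('m \<Rightarrow> 'e set) \<Rightarrow> ('m \<Rightarrow> 'e) set"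
where "subbundle_sections A E F = {\<eta> \<in> sections A E. \<forall>p. \<eta> p \<in> F p}"

definition bundle_map ::
  "('m::topological_space, 'n::finite) chart set \<Rightarrow> ('m, 'i::finite, 'e::real_vector) vbundle \<Rightarrow>
   ('m, 'j::finite, 'd::real_vector) vbundle \<Rightarrow> ('m \<Rightarrow> 'e \<Rightarrow> 'd) \<Rightarrow> bool"
where "bundle_map A E F \<Psi> \<longleftrightarrow>
  (\<forall>p. lin_on (fibre E p) (\<Psi> p) \<and> \<Psi> p ` fibre E p \<subseteq> fibre F p) \<and>
  (\<forall>(U, s)\<in>frames E. \<forall>i. section_on A F U (\<lambda>p. \<Psi> p (s i p)))"

definition tangent_bundle ::
  "('m::topological_space, 'n::finite) chart set \<Rightarrow> ('m, 'n, ('m, 'n) tvec) vbundle"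
where "tangent_bundle A =
  \<lparr> fibre = tangent_space A, frames = {(fst c, coord_vec A c) | c. c \<in> A} \<rparr>"

definition dual_space :: "'a::real_vector set \<Rightarrow> ('a \<Rightarrow> real) set"
where "dual_space V = {\<alpha>. lin_on V \<alpha> \<and> (\<forall>x. x \<notin> V \<longrightarrow> \<alpha> x = 0)}"

definition dual_bundle ::
  "('m, 'i::finite, 'e::real_vector) vbundle \<Rightarrow> ('m, 'i, 'e \<Rightarrow> real) vbundle"
where "dual_bundle E =
  \<lparr> fibre = (\<lambda>p. dual_space (fibre E p)),
    frames = {(U, t). \<exists>s. (U, s) \<in> frames E \<and>
      (\<forall>p\<in>U. \<forall>i. t i p \<in> dual_space (fibre E p) \<and>
         (\<forall>j. t i p (s j p) = (if i = j then 1 else 0)))} \<rparr>"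

definition sum_bundle ::
  "('m, 'i::finite, 'e::real_vector) vbundle \<Rightarrow> ('m, 'j::finite, 'd::real_vector) vbundle \<Rightarrow>
   ('m, 'i + 'j, 'e \<times> 'd) vbundle"
where "sum_bundle E F =
  \<lparr> fibre = (\<lambda>p. fibre E p \<times> fibre F p),
    frames = {(U \<inter> V, case_sum (\<lambda>i p. (s i p, 0)) (\<lambda>j p. (0, t j p))) | U s V t.
      (U, s) \<in> frames E \<and> (V, t) \<in> frames F} \<rparr>"

abbreviation vector_fields ::
  "('m::topological_space, 'n::finite) chart set \<Rightarrow> ('m \<Rightarrow> ('m, 'n) tvec) set"
where "vector_fields A \<equiv> sections A (tangent_bundle A)"

text \<open>In coordinates: \<open>[X, Y]\<^sup>i = X(Y\<^sup>i) - Y(X\<^sup>i)\<close>.\<close>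

definition lie_bracket ::
  "('m, 'n::finite) chart set \<Rightarrow> ('m \<Rightarrow> ('m, 'n) tvec) \<Rightarrow> ('m \<Rightarrow> ('m, 'n) tvec) \<Rightarrow>
   'm \<Rightarrow> ('m, 'n) tvec"
where "lie_bracket A X Y p = (\<lambda>c. if c \<in> A \<and> p \<in> fst c
  then chart_deriv c (\<lambda>q. Y q c) p (X p c) - chart_deriv c (\<lambda>q. X q c) p (Y p c) else 0)"

text \<open>A connection on the bundle whose module of smooth sections is \<open>G\<close>.\<close>

definition connection ::
  "('m::topological_space, 'n::finite) chart set \<Rightarrow> ('m \<Rightarrow> 'e::real_vector) set \<Rightarrow>
   (('m \<Rightarrow> ('m, 'n) tvec) \<Rightarrow> ('m \<Rightarrow> 'e) \<Rightarrow> 'm \<Rightarrow> 'e) \<Rightarrow> bool"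
where "connection A G N \<longleftrightarrow>
  (\<forall>X\<in>vector_fields A. \<forall>\<eta>\<in>G. N X \<eta> \<in> G) \<and>
  (\<forall>X\<in>vector_fields A. \<forall>Y\<in>vector_fields A. \<forall>\<eta>\<in>G. \<forall>p.
     N (\<lambda>q. X q + Y q) \<eta> p = N X \<eta> p + N Y \<eta> p) \<and>
  (\<forall>g. smooth_map_on A UNIV g \<longrightarrow> (\<forall>X\<in>vector_fields A. \<forall>\<eta>\<in>G. \<forall>p.
     N (\<lambda>q. g q *\<^sub>R X q) \<eta> p = g p *\<^sub>R N X \<eta> p)) \<and>
  (\<forall>X\<in>vector_fields A. \<forall>\<eta>\<in>G. \<forall>\<zeta>\<in>G. \<forall>p.
     N X (\<lambda>q. \<eta> q + \<zeta> q) p = N X \<eta> p + N X \<zeta> p) \<and>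
  (\<forall>g. smooth_map_on A UNIV g \<longrightarrow> (\<forall>X\<in>vector_fields A. \<forall>\<eta>\<in>G. \<forall>p.
     N X (\<lambda>q. g q *\<^sub>R \<eta> q) p = differential A g p (X p) *\<^sub>R \<eta> p + g p *\<^sub>R N X \<eta> p))"


section \<open>Quasi-Codazzi structures\<close>

definition eigen_plus :: "('m, 'i, 'e::real_vector) vbundle \<Rightarrow> ('m \<Rightarrow> 'e \<Rightarrow> 'e) \<Rightarrow> 'm \<Rightarrow> 'e set"
where "eigen_plus E I p = {\<eta> \<in> fibre E p. I p \<eta> = \<eta>}"

definition eigen_minus :: "('m, 'i, 'e::real_vector) vbundle \<Rightarrow> ('m \<Rightarrow> 'e \<Rightarrow> 'e) \<Rightarrow> 'm \<Rightarrow> 'e set"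
where "eigen_minus E I p = {\<eta> \<in> fibre E p. I p \<eta> = - \<eta>}"

definition component_plus ::
  "('m, 'i, 'e::real_vector) vbundle \<Rightarrow> ('m \<Rightarrow> 'e \<Rightarrow> 'e) \<Rightarrow> 'm \<Rightarrow> 'e \<Rightarrow> 'e"
where "component_plus E I p \<eta> =
  (THE a. a \<in> eigen_plus E I p \<and> (\<exists>b\<in>eigen_minus E I p. \<eta> = a + b))"

definition component_minus ::
  "('m, 'i, 'e::real_vector) vbundle \<Rightarrow> ('m \<Rightarrow> 'e \<Rightarrow> 'e) \<Rightarrow> 'm \<Rightarrow> 'e \<Rightarrow> 'e"
where "component_minus E I p \<eta> =
  (THE b. b \<in> eigen_minus E I p \<and> (\<exists>a\<in>eigen_plus E I p. \<eta> = a + b))"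

definition para_hermitian ::
  "('m::topological_space, 'n::finite) chart set \<Rightarrow> ('m, 'i::finite, 'e::real_vector) vbundle \<Rightarrow>
   ('m \<Rightarrow> 'e \<Rightarrow> 'e \<Rightarrow> real) \<Rightarrow> ('m \<Rightarrow> 'e \<Rightarrow> 'e) \<Rightarrow> bool"
where "para_hermitian A E \<theta> I \<longleftrightarrow>
  vector_bundle A E \<and> CARD('i) = 2 * CARD('n) \<and>
  \<comment> \<open>\<open>\<theta>\<close> is a smooth symmetric nondegenerate section of \<open>E\<^sup>* \<otimes> E\<^sup>*\<close>\<close>
  (\<forall>p. \<forall>\<eta>\<in>fibre E p. lin_on (fibre E p) (\<theta> p \<eta>) \<and> lin_on (fibre E p) (\<lambda>\<zeta>. \<theta> p \<zeta> \<eta>)) \<and>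
  (\<forall>(U, s)\<in>frames E. \<forall>i j. smooth_map_on A U (\<lambda>p. \<theta> p (s i p) (s j p))) \<and>
  (\<forall>p. \<forall>\<eta>\<in>fibre E p. \<forall>\<zeta>\<in>fibre E p. \<theta> p \<eta> \<zeta> = \<theta> p \<zeta> \<eta>) \<and>
  (\<forall>p. \<forall>\<eta>\<in>fibre E p. (\<forall>\<zeta>\<in>fibre E p. \<theta> p \<eta> \<zeta> = 0) \<longrightarrow> \<eta> = 0) \<and>
  \<comment> \<open>\<open>I\<close> is a bundle isomorphism with \<open>I\<^sup>2 = id\<close>, \<open>I \<noteq> id\<close>\<close>
  bundle_map A E E I \<and> (\<forall>p. bij_betw (I p) (fibre E p) (fibre E p)) \<and>
  (\<forall>p. \<forall>\<eta>\<in>fibre E p. I p (I p \<eta>) = \<eta>) \<and>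
  (\<forall>p. \<exists>\<eta>\<in>fibre E p. I p \<eta> \<noteq> \<eta>) \<and>
  \<comment> \<open>eigen-subbundles of equal rank, \<open>E = E\<^sup>+ \<oplus> E\<^sup>-\<close>\<close>
  (\<exists>r. subbundle A E (eigen_plus E I) r \<and> subbundle A E (eigen_minus E I) r) \<and>
  (\<forall>p. eigen_plus E I p \<inter> eigen_minus E I p = {0} \<and>
     (\<forall>\<eta>\<in>fibre E p. \<exists>a\<in>eigen_plus E I p. \<exists>b\<in>eigen_minus E I p. \<eta> = a + b)) \<and>
  (\<forall>p. \<forall>\<eta>\<in>fibre E p. \<forall>\<zeta>\<in>fibre E p. \<theta> p (I p \<eta>) \<zeta> + \<theta> p \<eta> (I p \<zeta>) = 0)"

definition lagrangian :: "'e::real_vector set \<Rightarrow> ('e \<Rightarrow> 'e \<Rightarrow> real) \<Rightarrow> 'e set \<Rightarrow> bool"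
where "lagrangian V \<omega> L \<longleftrightarrow>
  subspace L \<and> L \<subseteq> V \<and> 2 * dim L = dim V \<and> (\<forall>x\<in>L. \<forall>y\<in>L. \<omega> x y = 0)"

definition quasi_codazzi ::
  "('m::topological_space, 'n::finite) chart set \<Rightarrow>
   ('m \<Rightarrow> ('m, 'n) tvec \<Rightarrow> ('m, 'n) tvec \<Rightarrow> real) \<Rightarrow>
   ('m, 'i::finite, 'e::real_vector) vbundle \<Rightarrow>
   ('m \<Rightarrow> 'e \<Rightarrow> 'e \<Rightarrow> real) \<Rightarrow> ('m \<Rightarrow> 'e \<Rightarrow> 'e) \<Rightarrow>
   ('m \<Rightarrow> ('m, 'n) tvec \<Rightarrow> 'e) \<Rightarrow>
   (('m \<Rightarrow> ('m, 'n) tvec) \<Rightarrow> ('m \<Rightarrow> 'e) \<Rightarrow> 'm \<Rightarrow> 'e) \<Rightarrow>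
   (('m \<Rightarrow> ('m, 'n) tvec) \<Rightarrow> ('m \<Rightarrow> 'e) \<Rightarrow> 'm \<Rightarrow> 'e) \<Rightarrow> bool"
where "quasi_codazzi A h E \<theta> I \<Phi> Np Nm \<longleftrightarrow>
  (let \<omega> = (\<lambda>p \<eta> \<zeta>. \<theta> p \<eta> (I p \<zeta>));
       Gp = subbundle_sections A E (eigen_plus E I);
       Gm = subbundle_sections A E (eigen_minus E I);
       \<Phi>p = (\<lambda>p u. component_plus E I p (\<Phi> p u));
       \<Phi>m = (\<lambda>p u. component_minus E I p (\<Phi> p u))
   in
   para_hermitian A E \<theta> I \<and>
   bundle_map A (tangent_bundle A) E \<Phi> \<and>
   (\<forall>p. dim (\<Phi> p ` tangent_space A p) = CARD('n) \<and>
      lagrangian (fibre E p) (\<omega> p) (\<Phi> p ` tangent_space A p)) \<and>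
   (\<forall>p. \<forall>u\<in>tangent_space A p. \<forall>v\<in>tangent_space A p. h p u v = \<theta> p (\<Phi> p u) (\<Phi> p v)) \<and>
   connection A Gp Np \<and> connection A Gm Nm \<and>
   (\<forall>X\<in>vector_fields A. \<forall>\<eta>\<in>Gp. \<forall>\<zeta>\<in>Gm. \<forall>p.
      differential A (\<lambda>q. \<theta> q (\<eta> q) (\<zeta> q)) p (X p)
        = \<theta> p (Np X \<eta> p) (\<zeta> p) + \<theta> p (\<eta> p) (Nm X \<zeta> p)) \<and>
   (\<forall>X\<in>vector_fields A. \<forall>Y\<in>vector_fields A. \<forall>p.
      Np X (\<lambda>q. \<Phi>p q (Y q)) p - Np Y (\<lambda>q. \<Phi>p q (X q)) p - \<Phi>p p (lie_bracket A X Y p) = 0 \<and>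
      Nm X (\<lambda>q. \<Phi>m q (Y q)) p - Nm Y (\<lambda>q. \<Phi>m q (X q)) p - \<Phi>m p (lie_bracket A X Y p) = 0))"


section \<open>Affine immersions\<close>

text \<open>For an affine immersion the sum \<open>f\<^sub>*(T\<^sub>pM) \<oplus> span {\<xi>\<^sub>p}\<close> is direct, so the objects selected
  by \<open>THE\<close> below are the unique ones determined by the defining equations.\<close>

definition affine_immersion ::
  "('m::topological_space, 'n::finite) chart set \<Rightarrow> ('m \<Rightarrow> real ^ 'k::finite) \<Rightarrow>
   ('m \<Rightarrow> real ^ 'k) \<Rightarrow> bool"
where "affine_immersion A f \<xi> \<longleftrightarrow>
  smooth_map_on A UNIV f \<and> smooth_map_on A UNIV \<xi> \<and>
  (\<forall>p. inj_on (differential A f p) (tangent_space A p)) \<and>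
  (\<forall>p. differential A f p ` tangent_space A p \<inter> span {\<xi> p} = {0} \<and>
     (\<forall>x. \<exists>u\<in>tangent_space A p. \<exists>y\<in>span {\<xi> p}. x = differential A f p u + y))"

definition induced_connection ::
  "('m::topological_space, 'n::finite) chart set \<Rightarrow> ('m \<Rightarrow> real ^ 'k::finite) \<Rightarrow>
   ('m \<Rightarrow> real ^ 'k) \<Rightarrow> ('m \<Rightarrow> ('m, 'n) tvec) \<Rightarrow> ('m \<Rightarrow> ('m, 'n) tvec) \<Rightarrow> 'm \<Rightarrow> ('m, 'n) tvec"
where "induced_connection A f \<xi> X Y p =
  (THE w. w \<in> tangent_space A p \<and>
     (\<exists>c. differential A (\<lambda>q. differential A f q (Y q)) p (X p)
            = differential A f p w + c *\<^sub>R \<xi> p))"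

definition second_fundamental_form ::
  "('m::topological_space, 'n::finite) chart set \<Rightarrow> ('m \<Rightarrow> real ^ 'k::finite) \<Rightarrow>
   ('m \<Rightarrow> real ^ 'k) \<Rightarrow> 'm \<Rightarrow> ('m, 'n) tvec \<Rightarrow> ('m, 'n) tvec \<Rightarrow> real"
where "second_fundamental_form A f \<xi> p u v =
  (THE c. \<forall>X\<in>vector_fields A. \<forall>Y\<in>vector_fields A. X p = u \<and> Y p = v \<longrightarrow>
     (\<exists>w\<in>tangent_space A p.
        differential A (\<lambda>q. differential A f q (Y q)) p (X p)
          = differential A f p w + c *\<^sub>R \<xi> p))"

text \<open>The transversal connection form \<open>\<tau>\<close>, from \<open>D\<^sub>X \<xi> = - f\<^sub>*(S(X)) + \<tau>(X) \<xi>\<close>.\<close>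

definition transversal_form ::
  "('m::topological_space, 'n::finite) chart set \<Rightarrow> ('m \<Rightarrow> real ^ 'k::finite) \<Rightarrow>
   ('m \<Rightarrow> real ^ 'k) \<Rightarrow> 'm \<Rightarrow> ('m, 'n) tvec \<Rightarrow> real"
where "transversal_form A f \<xi> p u =
  (THE t. \<exists>w\<in>tangent_space A p.
     differential A \<xi> p u = - differential A f p w + t *\<^sub>R \<xi> p)"

definition equiaffine_immersion ::
  "('m::topological_space, 'n::finite) chart set \<Rightarrow> ('m \<Rightarrow> real ^ 'k::finite) \<Rightarrow>
   ('m \<Rightarrow> real ^ 'k) \<Rightarrow> bool"
where "equiaffine_immersion A f \<xi> \<longleftrightarrow>
  affine_immersion A f \<xi> \<and> (\<forall>p. \<forall>u\<in>tangent_space A p. transversal_form A f \<xi> p u = 0)"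

definition conormal ::
  "('m::topological_space, 'n::finite) chart set \<Rightarrow> ('m \<Rightarrow> real ^ 'k::finite) \<Rightarrow>
   ('m \<Rightarrow> real ^ 'k) \<Rightarrow> 'm \<Rightarrow> ((real ^ 'k) \<Rightarrow>\<^sub>L real)"
where "conormal A f \<xi> p =
  (THE \<nu>. (\<forall>u\<in>tangent_space A p. blinfun_apply \<nu> (differential A f p u) = 0) \<and>
     blinfun_apply \<nu> (\<xi> p) = 1)"


section \<open>The structure induced by an equiaffine immersion\<close>

definition image_bundle ::
  "('m::topological_space, 'n::finite) chart set \<Rightarrow> ('m \<Rightarrow> real ^ 'k::finite) \<Rightarrow>
   ('m, 'n, real ^ 'k) vbundle"
where "image_bundle A f =
  \<lparr> fibre = (\<lambda>p. differential A f p ` tangent_space A p),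
    frames = {(U, \<lambda>i p. differential A f p (s i p)) | U s. (U, s) \<in> frames (tangent_bundle A)} \<rparr>"

definition ind_bundle ::
  "('m::topological_space, 'n::finite) chart set \<Rightarrow> ('m \<Rightarrow> real ^ 'k::finite) \<Rightarrow>
   ('m, 'n + 'n, (real ^ 'k) \<times> (real ^ 'k \<Rightarrow> real)) vbundle"
where "ind_bundle A f = sum_bundle (image_bundle A f) (dual_bundle (image_bundle A f))"

definition ind_theta :: "'m \<Rightarrow> 'v \<times> ('v \<Rightarrow> real) \<Rightarrow> 'v \<times> ('v \<Rightarrow> real) \<Rightarrow> real"
where "ind_theta p \<eta> \<zeta> = (1 / 2) * (snd \<zeta> (fst \<eta>) + snd \<eta> (fst \<zeta>))"

definition ind_I :: "'m \<Rightarrow> 'v \<times> ('v \<Rightarrow> real) \<Rightarrow> 'v \<times> ('v \<Rightarrow> real)"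
where "ind_I p \<eta> = (fst \<eta>, - snd \<eta>)"

definition restrict_functional :: "'v set \<Rightarrow> ('v::real_normed_vector \<Rightarrow>\<^sub>L real) \<Rightarrow> 'v \<Rightarrow> real"
where "restrict_functional V \<alpha> = (\<lambda>x. if x \<in> V then blinfun_apply \<alpha> x else 0)"

definition ind_Phi ::
  "('m::topological_space, 'n::finite) chart set \<Rightarrow> ('m \<Rightarrow> real ^ 'k::finite) \<Rightarrow>
   ('m \<Rightarrow> real ^ 'k) \<Rightarrow> 'm \<Rightarrow> ('m, 'n) tvec \<Rightarrow> (real ^ 'k) \<times> (real ^ 'k \<Rightarrow> real)"
where "ind_Phi A f \<xi> p u =
  (differential A f p u,
   - restrict_functional (fibre (image_bundle A f) p) (differential A (conormal A f \<xi>) p u))"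

text \<open>\<open>\<nabla>\<^sup>+\<^sub>X f\<^sub>*Y = f\<^sub>*(\<nabla>\<^sub>X Y)\<close>, where \<open>Y\<close> is recovered from \<open>\<eta> = f\<^sub>*Y\<close>.\<close>

definition conn_plus ::
  "('m::topological_space, 'n::finite) chart set \<Rightarrow> ('m \<Rightarrow> real ^ 'k::finite) \<Rightarrow>
   ('m \<Rightarrow> real ^ 'k) \<Rightarrow> ('m \<Rightarrow> ('m, 'n) tvec) \<Rightarrow> ('m \<Rightarrow> real ^ 'k) \<Rightarrow> 'm \<Rightarrow> real ^ 'k"
where "conn_plus A f \<xi> X \<eta> p =
  (let Y = (\<lambda>q. THE v. v \<in> tangent_space A q \<and> differential A f q v = \<eta> q)
   in differential A f p (induced_connection A f \<xi> X Y p))"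

definition conn_minus ::
  "('m::topological_space, 'n::finite) chart set \<Rightarrow> ('m \<Rightarrow> real ^ 'k::finite) \<Rightarrow>
   ('m \<Rightarrow> real ^ 'k) \<Rightarrow> ('m \<Rightarrow> ('m, 'n) tvec) \<Rightarrow> ('m \<Rightarrow> real ^ 'k \<Rightarrow> real) \<Rightarrow> 'm \<Rightarrow> real ^ 'k \<Rightarrow> real"
where "conn_minus A f \<xi> X \<zeta> p =
  (THE \<alpha>. \<alpha> \<in> fibre (dual_bundle (image_bundle A f)) p \<and>
     (\<forall>\<eta>\<in>sections A (image_bundle A f).
        differential A (\<lambda>q. ind_theta q (\<eta> q, 0) (0, \<zeta> q)) p (X p)
          = ind_theta p (conn_plus A f \<xi> X \<eta> p, 0) (0, \<zeta> p) + ind_theta p (\<eta> p, 0) (0, \<alpha>)))"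

text \<open>The same connections on the eigen-subbundles \<open>E\<^sup>+ \<oplus> 0\<close> and \<open>0 \<oplus> E\<^sup>-\<close> of \<open>E\<close>.\<close>

definition ind_nabla_plus ::
  "('m::topological_space, 'n::finite) chart set \<Rightarrow> ('m \<Rightarrow> real ^ 'k::finite) \<Rightarrow>
   ('m \<Rightarrow> real ^ 'k) \<Rightarrow> ('m \<Rightarrow> ('m, 'n) tvec) \<Rightarrow>
   ('m \<Rightarrow> (real ^ 'k) \<times> (real ^ 'k \<Rightarrow> real)) \<Rightarrow> 'm \<Rightarrow> (real ^ 'k) \<times> (real ^ 'k \<Rightarrow> real)"
where "ind_nabla_plus A f \<xi> X \<eta> p = (conn_plus A f \<xi> X (\<lambda>q. fst (\<eta> q)) p, 0)"

definition ind_nabla_minus ::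
  "('m::topological_space, 'n::finite) chart set \<Rightarrow> ('m \<Rightarrow> real ^ 'k::finite) \<Rightarrow>
   ('m \<Rightarrow> real ^ 'k) \<Rightarrow> ('m \<Rightarrow> ('m, 'n) tvec) \<Rightarrow>
   ('m \<Rightarrow> (real ^ 'k) \<times> (real ^ 'k \<Rightarrow> real)) \<Rightarrow> 'm \<Rightarrow> (real ^ 'k) \<times> (real ^ 'k \<Rightarrow> real)"
where "ind_nabla_minus A f \<xi> X \<zeta> p = (0, conn_minus A f \<xi> X (\<lambda>q. snd (\<zeta> q)) p)"

end

theory Submission
  imports Defs
begin

text \<open>
  Both connections are flat derivatives in disguise.  Let \<open>P x = x - \<langle>\<nu>, x\<rangle> \<xi>\<close> be the projection of
  \<open>\<real>\<^sup>n\<^sup>+\<^sup>1\<close> onto the tangent space along \<open>\<xi>\<close>.  Then \<open>\<nabla>\<^sup>+\<^sub>X \<eta> = P (D\<^sub>X \<eta>)\<close>.  A section \<open>\<zeta>\<close> of the dual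
  bundle extends, by zero on \<open>\<xi>\<close>, to a smooth map \<open>\<zeta> \<circ> P\<close> into the fixed space of covectors, and the
  product rule shows that \<open>\<nabla>\<^sup>-\<^sub>X \<zeta>\<close> is the restriction of \<open>D\<^sub>X (\<zeta> \<circ> P)\<close> to tangent vectors
  (\<open>conn_plus_eq\<close>, \<open>conn_minus_eq\<close>).  In this form the connection axioms are product rules, checked
  once in \<open>connection_by_retraction\<close>.

  Equiaffinity enters through \<open>\<langle>\<nu>, \<xi>\<rangle> = 1\<close>: differentiating gives \<open>\<langle>\<nu>\<^sub>* X, \<xi>\<rangle> = - \<tau>(X) = 0\<close>, so the
  extension of the restriction of \<open>\<nu>\<^sub>* X\<close> is \<open>\<nu>\<^sub>* X\<close> itself (\<open>extend_Phi_minus\<close>).  Hence both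
  torsions are images, under a pointwise linear map, of
  \<open>D\<^sub>X (g\<^sub>* Y) - D\<^sub>Y (g\<^sub>* X) - g\<^sub>* [X, Y]\<close> with \<open>g = f\<close> and with \<open>g = - \<nu>\<close>, and this vanishes for every
  smooth \<open>g\<close> by the symmetry of second derivatives (\<open>differential_commutator\<close>).

  Differentiating \<open>\<langle>\<nu>, f\<^sub>* Y\<rangle> = 0\<close> gives \<open>h(u, v) = - \<langle>\<nu>\<^sub>* u, f\<^sub>* v\<rangle>\<close>, which is symmetric by the same
  commutator identity.  The symmetric and the skew part of this pairing are the metric identity
  \<open>h = \<Phi>\<^sup>*\<theta>\<close> and the Lagrangian condition.

  The analytic input consists of three facts.  The conormal map and the dual frames are smooth,
  by Cramer's rule for a Gram matrix (\<open>smooth_dual_frame\<close>).  A map with values in the image bundle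
  or its dual is a smooth section exactly if it is smooth as a vector-valued map
  (\<open>section_on_imE_iff\<close>, \<open>section_on_duE_iff\<close>).  Every tangent vector extends to a global vector
  field, by a bump function (\<open>vector_field_through\<close>); this makes the descriptions of \<open>h\<close> and
  \<open>\<nabla>\<^sup>-\<close> by their values on global sections determine them.
\<close>

section \<open>Calculus of smooth maps between normed spaces\<close>

lemma Ck_on_subset: "Ck_on k S f \<Longrightarrow> T \<subseteq> S \<Longrightarrow> Ck_on k T f"
  by (induction k arbitrary: f) (auto intro: continuous_on_subset)

lemma Ck_on_local:
  assumes "\<And>x. x \<in> S \<Longrightarrow> \<exists>T. open T \<and> x \<in> T \<and> Ck_on k T f"
  shows "Ck_on k S f"
  using assms
proof (induction k arbitrary: f)
  case 0
  then have "isCont f x" if "x \<in> S" for x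
    using that by (metis Ck_on.simps(1) continuous_on_eq_continuous_at)
  then show ?case
    by (simp add: continuous_at_imp_continuous_on)
next
  case (Suc k)
  have "f differentiable at x" if "x \<in> S" for x
    using Suc.prems[OF that] by auto
  moreover have "Ck_on k S (\<lambda>x. frechet_derivative f (at x) v)" for v
    by (rule Suc.IH) (use Suc.prems in force)
  ultimately show ?case by simp
qed

lemma Ck_on_cong:
  assumes "open S" and "\<And>x. x \<in> S \<Longrightarrow> f x = g x" and "Ck_on k S f"
  shows "Ck_on k S g"
  using assms(2,3)
proof (induction k arbitrary: f g)
  case 0
  then show ?case by (simp cong: continuous_on_cong)
next
  case (Suc k)
  have eq: "frechet_derivative f (at x) = frechet_derivative g (at x)" if "x \<in> S" for x
    by (rule frechet_derivative_transform_within_open[OF _ assms(1) that])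
      (use Suc.prems that in auto)
  moreover have "g differentiable at x" if x: "x \<in> S" for x
  proof -
    obtain D where "(f has_derivative D) (at x)"
      using Suc.prems(2) x by (auto simp: differentiable_def)
    then have "(g has_derivative D) (at x)"
      by (rule has_derivative_transform_within_open[OF _ assms(1) x]) (rule Suc.prems(1))
    then show ?thesis by (auto simp: differentiable_def)
  qed
  moreover have "Ck_on k S (\<lambda>x. frechet_derivative g (at x) v)" for v
    by (rule Suc.IH[of "\<lambda>x. frechet_derivative f (at x) v"]) (use eq Suc.prems(2) in auto)
  ultimately show ?case by simp
qed

lemma Ck_on_SucI:
  assumes "open S" and "\<And>x. x \<in> S \<Longrightarrow> (f has_derivative D x) (at x)"
    and "\<And>v. Ck_on k S (\<lambda>x. D x v)"
  shows "Ck_on (Suc k) S f"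
proof -
  have D: "frechet_derivative f (at x) = D x" if "x \<in> S" for x
    using frechet_derivative_at[OF assms(2)[OF that]] by simp
  have "Ck_on k S (\<lambda>x. frechet_derivative f (at x) v)" for v
    by (rule Ck_on_cong[OF assms(1) _ assms(3)[of v]]) (simp add: D)
  then show ?thesis
    using assms(2) by (auto simp: differentiable_def)
qed

lemma Ck_on_Suc_derivative:
  assumes "Ck_on (Suc k) S f" "x \<in> S"
  shows "(f has_derivative frechet_derivative f (at x)) (at x)"
  using assms by (simp add: frechet_derivative_works)

lemma Ck_on_SucD: "Ck_on (Suc k) S f \<Longrightarrow> Ck_on k S f"
proof (induction k arbitrary: f)
  case 0
  then show ?case
    by (simp add: continuous_at_imp_continuous_on differentiable_imp_continuous_within)
qed auto

lemma Ck_on_const: "Ck_on k S (\<lambda>x. c)"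
  by (induction k arbitrary: c) auto

lemma Ck_on_add:
  assumes "open S" "Ck_on k S f" "Ck_on k S g"
  shows "Ck_on k S (\<lambda>x. f x + g x)"
  using assms(2,3)
proof (induction k arbitrary: f g)
  case 0
  then show ?case by (simp add: continuous_on_add)
next
  case (Suc k)
  show ?case
    by (rule Ck_on_SucI[OF assms(1) has_derivative_add[OF Ck_on_Suc_derivative Ck_on_Suc_derivative]])
      (use Suc in auto)
qed

lemma Ck_on_sum:
  assumes "open S" "\<And>i. i \<in> J \<Longrightarrow> Ck_on k S (f i)"
  shows "Ck_on k S (\<lambda>x. \<Sum>i\<in>J. f i x)"
  using assms(2)
  by (induction J rule: infinite_finite_induct) (auto intro: Ck_on_const Ck_on_add assms(1))

lemma Ck_on_linear:
  assumes "open S" "bounded_linear L" "Ck_on k S f"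
  shows "Ck_on k S (\<lambda>x. L (f x))"
  using assms(3)
proof (induction k arbitrary: f)
  case 0
  then show ?case by (simp add: assms(2) bounded_linear.continuous_on)
next
  case (Suc k)
  show ?case
    by (rule Ck_on_SucI[OF assms(1) bounded_linear.has_derivative[OF assms(2) Ck_on_Suc_derivative]])
      (use Suc in auto)
qed

lemma Ck_on_bilinear:
  assumes "open S" "bounded_bilinear B" "Ck_on k S f" "Ck_on k S g"
  shows "Ck_on k S (\<lambda>x. B (f x) (g x))"
  using assms(3,4)
proof (induction k arbitrary: f g)
  case 0
  then show ?case by (simp add: assms(2) bounded_bilinear.continuous_on)
next
  case (Suc k)
  have "Ck_on k S f" "Ck_on k S g"
    using Suc.prems by (auto dest: Ck_on_SucD simp del: Ck_on.simps)
  then have "Ck_on k S (\<lambda>x. B (f x) (frechet_derivative g (at x) v)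
      + B (frechet_derivative f (at x) v) (g x))" for v
    using Suc.prems by (intro Ck_on_add assms(1) Suc.IH) auto
  then show ?case
    by (intro Ck_on_SucI[OF assms(1) bounded_bilinear.FDERIV[OF assms(2) Ck_on_Suc_derivative
            Ck_on_Suc_derivative]]) (use Suc.prems in auto)
qed

text \<open>Expanding the inner derivative in a basis turns the chain rule into a finite sum of products,
  whose regularity is governed by the bilinear case.\<close>

lemma Ck_on_compose:
  fixes f :: "'a::real_normed_vector \<Rightarrow> 'b::euclidean_space"
    and g :: "'b \<Rightarrow> 'c::real_normed_vector"
  assumes "open S" "open T" "f ` S \<subseteq> T" "Ck_on k S f" "Ck_on k T g"
  shows "Ck_on k S (\<lambda>x. g (f x))"
  using assms(4,5)
proof (induction k arbitrary: g)
  case 0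
  then show ?case using assms(3) by (auto intro: continuous_on_compose2)
next
  case (Suc k)
  let ?f' = "\<lambda>x. frechet_derivative f (at x)"
  let ?g' = "\<lambda>y. frechet_derivative g (at y)"
  have lin: "linear (?g' (f x))" if "x \<in> S" for x
    using Suc.prems(2) assms(3) that by (auto intro: linear_frechet_derivative)
  show ?case
  proof (rule Ck_on_SucI[OF assms(1)])
    fix x assume "x \<in> S"
    then show "((\<lambda>x. g (f x)) has_derivative (\<lambda>v. ?g' (f x) (?f' x v))) (at x)"
      using Suc.prems assms(3)
      by (intro has_derivative_compose[of f "?f' x" x UNIV g "?g' (f x)", simplified])
        (auto simp: frechet_derivative_works)
  next
    fix v
    have "Ck_on k S f" using Suc.prems(1) by (rule Ck_on_SucD)
    then have "Ck_on k S (\<lambda>x. \<Sum>b\<in>Basis. (?f' x v \<bullet> b) *\<^sub>R ?g' (f x) b)"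
      using Suc.prems
      by (intro Ck_on_sum Ck_on_bilinear[OF _ bounded_bilinear_scaleR]
          Ck_on_linear[OF _ bounded_linear_inner_left] Suc.IH assms(1)) auto
    then show "Ck_on k S (\<lambda>x. ?g' (f x) (?f' x v))"
    proof (rule Ck_on_cong[OF assms(1), rotated])
      fix x assume "x \<in> S"
      have "?g' (f x) (?f' x v) = ?g' (f x) (\<Sum>b\<in>Basis. (?f' x v \<bullet> b) *\<^sub>R b)"
        by (simp add: euclidean_representation)
      also have "\<dots> = (\<Sum>b\<in>Basis. (?f' x v \<bullet> b) *\<^sub>R ?g' (f x) b)"
        using lin[OF \<open>x \<in> S\<close>] by (simp add: linear_sum linear_scale)
      finally show "(\<Sum>b\<in>Basis. (?f' x v \<bullet> b) *\<^sub>R ?g' (f x) b) = ?g' (f x) (?f' x v)" ..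
    qed
  qed
qed

lemma smooth_on_subset: "smooth_on S f \<Longrightarrow> T \<subseteq> S \<Longrightarrow> smooth_on T f"
  by (auto simp: smooth_on_def intro: Ck_on_subset)

lemma smooth_on_local:
  assumes "\<And>x. x \<in> S \<Longrightarrow> \<exists>T. open T \<and> x \<in> T \<and> smooth_on T f"
  shows "smooth_on S f"
  unfolding smooth_on_def using assms by (meson Ck_on_local smooth_on_def)

lemma smooth_on_cong:
  "open S \<Longrightarrow> (\<And>x. x \<in> S \<Longrightarrow> f x = g x) \<Longrightarrow> smooth_on S f \<Longrightarrow> smooth_on S g"
  unfolding smooth_on_def using Ck_on_cong by blast

lemma smooth_on_differentiable: "smooth_on S f \<Longrightarrow> x \<in> S \<Longrightarrow> f differentiable at x"
  unfolding smooth_on_def by (metis Ck_on.simps(2))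

lemma smooth_on_has_derivative:
  "smooth_on S f \<Longrightarrow> x \<in> S \<Longrightarrow> (f has_derivative frechet_derivative f (at x)) (at x)"
  using smooth_on_differentiable frechet_derivative_works by blast

lemma smooth_on_frechet_derivative:
  "smooth_on S f \<Longrightarrow> smooth_on S (\<lambda>x. frechet_derivative f (at x) v)"
  unfolding smooth_on_def by (metis Ck_on.simps(2))

lemma smooth_on_imp_continuous_on: "smooth_on S f \<Longrightarrow> continuous_on S f"
  unfolding smooth_on_def by (metis Ck_on.simps(1))

lemma smooth_on_const: "smooth_on S (\<lambda>x. c)"
  by (simp add: smooth_on_def Ck_on_const)

lemma smooth_on_id: "smooth_on S (\<lambda>x. x)"
  unfolding smooth_on_def
proof
  fix k show "Ck_on k S (\<lambda>x. x)"
    by (cases k) (auto simp: Ck_on_const)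
qed

lemma smooth_on_add:
  "open S \<Longrightarrow> smooth_on S f \<Longrightarrow> smooth_on S g \<Longrightarrow> smooth_on S (\<lambda>x. f x + g x)"
  by (simp add: smooth_on_def Ck_on_add)

lemma smooth_on_linear:
  "open S \<Longrightarrow> bounded_linear L \<Longrightarrow> smooth_on S f \<Longrightarrow> smooth_on S (\<lambda>x. L (f x))"
  by (simp add: smooth_on_def Ck_on_linear)

lemma smooth_on_bilinear:
  "open S \<Longrightarrow> bounded_bilinear B \<Longrightarrow> smooth_on S f \<Longrightarrow> smooth_on S g \<Longrightarrow>
    smooth_on S (\<lambda>x. B (f x) (g x))"
  by (simp add: smooth_on_def Ck_on_bilinear)

lemma smooth_on_compose:
  fixes f :: "'a::real_normed_vector \<Rightarrow> 'b::euclidean_space"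
    and g :: "'b \<Rightarrow> 'c::real_normed_vector"
  shows "open S \<Longrightarrow> open T \<Longrightarrow> f ` S \<subseteq> T \<Longrightarrow> smooth_on S f \<Longrightarrow> smooth_on T g \<Longrightarrow>
    smooth_on S (\<lambda>x. g (f x))"
  using Ck_on_compose[of S T f _ g] by (simp add: smooth_on_def)

lemma smooth_on_inverse: "smooth_on (- {0::real}) inverse"
  unfolding smooth_on_def
proof
  fix k show "Ck_on k (- {0::real}) inverse"
  proof (induction k)
    case 0
    then show ?case by (auto intro: continuous_intros)
  next
    case (Suc k)
    have "open (- {0::real})" by auto
    then show ?case
      using Suc
      by (intro Ck_on_SucI[where D = "\<lambda>x v. - (inverse x * v * inverse x)"])
        (auto intro!: has_derivative_inverse' Ck_on_linear[OF _ bounded_linear_minus[OF bounded_linear_ident]]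
          Ck_on_bilinear[OF _ bounded_bilinear_mult] Ck_on_const)
  qed
qed

text \<open>The mean value inequality for \<open>\<phi>(s) - s c\<close>, whose derivative is bounded by \<open>e\<close>.\<close>

lemma mean_value_segment:
  fixes \<phi> :: "real \<Rightarrow> 'b::real_normed_vector"
  assumes "0 \<le> h" "\<And>s. s \<in> {0..h} \<Longrightarrow> (\<phi> has_vector_derivative \<phi>' s) (at s)"
    and "\<And>s. s \<in> {0..h} \<Longrightarrow> norm (\<phi>' s - c) \<le> e"
  shows "norm (\<phi> h - \<phi> 0 - h *\<^sub>R c) \<le> e * h"
proof -
  have "norm ((\<phi> h - h *\<^sub>R c) - (\<phi> 0 - 0 *\<^sub>R c)) \<le> e * norm (h - 0)"
  proof (rule differentiable_bound[where S = "{0..h}" and f = "\<lambda>s. \<phi> s - s *\<^sub>R c"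
        and f' = "\<lambda>s r. r *\<^sub>R (\<phi>' s - c)"])
    fix s assume s: "s \<in> {0..h}"
    have "((\<lambda>s. \<phi> s - s *\<^sub>R c) has_vector_derivative (\<phi>' s - c)) (at s)"
      by (auto intro!: derivative_eq_intros assms(2)[OF s])
    then show "((\<lambda>s. \<phi> s - s *\<^sub>R c) has_derivative (\<lambda>r. r *\<^sub>R (\<phi>' s - c))) (at s within {0..h})"
      by (simp add: has_vector_derivative_def has_derivative_at_withinI)
    show "onorm (\<lambda>r. r *\<^sub>R (\<phi>' s - c)) \<le> e"
      by (rule onorm_le) (use assms(3)[OF s] in \<open>simp add: mult.commute[of e] mult_left_mono\<close>)
  qed (use assms(1) in auto)
  then show ?thesis using assms(1) by (simp add: algebra_simps)
qed

text \<open>The mixed second difference over a small parallelogram approximates the second derivative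
  taken in either order; this gives one of the two orders.\<close>

lemma second_difference_approx:
  fixes F :: "'a::real_normed_vector \<Rightarrow> 'b::real_normed_vector"
  assumes F: "smooth_on (ball x r) F" and h: "0 \<le> h" "h * (norm u + norm v) < r"
    and e: "\<And>y. y \<in> ball x r \<Longrightarrow>
      norm (frechet_derivative (\<lambda>z. frechet_derivative F (at z) u) (at y) v - c) \<le> e"
  shows "norm (F (x + h *\<^sub>R u + h *\<^sub>R v) - F (x + h *\<^sub>R u) - (F (x + h *\<^sub>R v) - F x) - (h * h) *\<^sub>R c)
    \<le> e * h * h"
proof -
  let ?Fu = "\<lambda>z. frechet_derivative F (at z) u"
  have in_ball: "x + s *\<^sub>R u + t *\<^sub>R v \<in> ball x r" if "s \<in> {0..h}" "t \<in> {0..h}" for s t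
  proof -
    have "norm (s *\<^sub>R u + t *\<^sub>R v) \<le> s * norm u + t * norm v"
      using that norm_triangle_ineq[of "s *\<^sub>R u" "t *\<^sub>R v"] by simp
    also have "\<dots> \<le> h * norm u + h * norm v"
      using that by (intro add_mono mult_right_mono) auto
    also have "\<dots> < r" using h by (simp add: algebra_simps)
    finally show ?thesis unfolding mem_ball dist_commute[of x] by (simp add: dist_norm add.assoc)
  qed
  have D: "((\<lambda>s. F (a + s *\<^sub>R w)) has_vector_derivative frechet_derivative F (at (a + s *\<^sub>R w)) w) (at s)"
    if "smooth_on (ball x r) F" "a + s *\<^sub>R w \<in> ball x r" for a w s and F :: "'a \<Rightarrow> 'b"
  proof -
    have "((\<lambda>s. a + s *\<^sub>R w) has_vector_derivative w) (at s)"
      by (auto intro!: derivative_eq_intros)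
    from vector_derivative_diff_chain_within
        [OF this has_derivative_at_withinI[OF smooth_on_has_derivative[OF that]]]
    show ?thesis by (simp add: o_def)
  qed
  have inner: "norm (?Fu (x + s *\<^sub>R u + h *\<^sub>R v) - ?Fu (x + s *\<^sub>R u) - h *\<^sub>R c) \<le> e * h"
    if s: "s \<in> {0..h}" for s
    using mean_value_segment[of h "\<lambda>t. ?Fu (x + s *\<^sub>R u + t *\<^sub>R v)"
        "\<lambda>t. frechet_derivative ?Fu (at (x + s *\<^sub>R u + t *\<^sub>R v)) v" c e]
      D[OF smooth_on_frechet_derivative[OF F]] in_ball[OF s] e h(1)
    by simp
  have "norm ((F (x + h *\<^sub>R u + h *\<^sub>R v) - F (x + h *\<^sub>R u))
      - (F (x + 0 *\<^sub>R u + h *\<^sub>R v) - F (x + 0 *\<^sub>R u)) - h *\<^sub>R (h *\<^sub>R c)) \<le> (e * h) * h"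
  proof (rule mean_value_segment[of h "\<lambda>s. F (x + s *\<^sub>R u + h *\<^sub>R v) - F (x + s *\<^sub>R u)"
        "\<lambda>s. ?Fu (x + s *\<^sub>R u + h *\<^sub>R v) - ?Fu (x + s *\<^sub>R u)"])
    fix s assume s: "s \<in> {0..h}"
    have "((\<lambda>s. F ((x + h *\<^sub>R v) + s *\<^sub>R u)) has_vector_derivative
        ?Fu ((x + h *\<^sub>R v) + s *\<^sub>R u)) (at s)"
      by (rule D[OF F]) (use in_ball[OF s, of h] h(1) in \<open>simp add: ac_simps\<close>)
    moreover have "((\<lambda>s. F (x + s *\<^sub>R u)) has_vector_derivative ?Fu (x + s *\<^sub>R u)) (at s)"
      by (rule D[OF F]) (use in_ball[OF s, of 0] h(1) in simp)
    ultimately show "((\<lambda>s. F (x + s *\<^sub>R u + h *\<^sub>R v) - F (x + s *\<^sub>R u)) has_vector_derivative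
        ?Fu (x + s *\<^sub>R u + h *\<^sub>R v) - ?Fu (x + s *\<^sub>R u)) (at s)"
      by (auto simp: ac_simps intro: has_vector_derivative_diff)
    show "norm (?Fu (x + s *\<^sub>R u + h *\<^sub>R v) - ?Fu (x + s *\<^sub>R u) - h *\<^sub>R c) \<le> e * h"
      by (rule inner[OF s])
  qed (rule h)
  then show ?thesis by simp
qed

text \<open>Approximating the same second difference in both orders, with error \<open>e h\<^sup>2\<close> each time, and
  dividing by \<open>h\<^sup>2\<close> bounds the difference of the two mixed derivatives by \<open>2 e\<close>.\<close>

lemma symmetric_second_derivative:
  fixes F :: "'a::real_normed_vector \<Rightarrow> 'b::real_normed_vector"
  assumes "open S" "x \<in> S" "smooth_on S F"
  shows "frechet_derivative (\<lambda>z. frechet_derivative F (at z) u) (at x) v =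
    frechet_derivative (\<lambda>z. frechet_derivative F (at z) v) (at x) u"
    (is "?D u v x = ?D v u x")
proof -
  have cont: "isCont (?D a b) x" for a b
    using smooth_on_imp_continuous_on[OF smooth_on_frechet_derivative[OF
          smooth_on_frechet_derivative[OF assms(3)]]] assms(1,2)
    by (simp add: continuous_on_eq_continuous_at)
  have close: "norm (?D u v x - ?D v u x) \<le> 2 * e" if "e > 0" for e
  proof -
    obtain r1 where r1: "r1 > 0" "\<And>y. y \<in> ball x r1 \<Longrightarrow> norm (?D u v y - ?D u v x) \<le> e"
      using cont[of u v] \<open>e > 0\<close>
      by (force simp: continuous_at_eps_delta dist_norm norm_minus_commute)
    obtain r2 where r2: "r2 > 0" "\<And>y. y \<in> ball x r2 \<Longrightarrow> norm (?D v u y - ?D v u x) \<le> e"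
      using cont[of v u] \<open>e > 0\<close>
      by (force simp: continuous_at_eps_delta dist_norm norm_minus_commute)
    obtain r0 where r0: "r0 > 0" "ball x r0 \<subseteq> S"
      using assms(1,2) open_contains_ball by blast
    define r where "r = min r0 (min r1 r2)"
    have r: "r > 0" "r \<le> r0" "r \<le> r1" "r \<le> r2" using r0 r1 r2 by (auto simp: r_def)
    have F: "smooth_on (ball x r) F"
      using smooth_on_subset[OF assms(3)] r0 r by (meson order_trans subset_ball)
    \<comment> \<open>Small enough for the parallelogram spanned by \<open>h u\<close> and \<open>h v\<close> to stay inside the ball.\<close>
    define h where "h = r / (norm u + norm v + 1)"
    have pos: "norm u + norm v + 1 > 0" by (smt (verit) norm_ge_zero)
    have h: "h > 0" using r pos by (simp add: h_def)
    have "h * (norm u + norm v) < h * (norm u + norm v + 1)" using h by simp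
    also have "\<dots> = r" using pos by (simp add: h_def)
    finally have hr: "h * (norm u + norm v) < r" .
    let ?\<Delta> = "F (x + h *\<^sub>R u + h *\<^sub>R v) - F (x + h *\<^sub>R u) - (F (x + h *\<^sub>R v) - F x)"
    have 1: "norm (?\<Delta> - (h * h) *\<^sub>R ?D u v x) \<le> e * h * h"
      by (rule second_difference_approx[OF F _ hr]) (use h r r1 in auto)
    have "norm (F (x + h *\<^sub>R v + h *\<^sub>R u) - F (x + h *\<^sub>R v) - (F (x + h *\<^sub>R u) - F x)
        - (h * h) *\<^sub>R ?D v u x) \<le> e * h * h"
      by (rule second_difference_approx[OF F]) (use h hr r r2 in \<open>auto simp: add.commute\<close>)
    then have 2: "norm (?\<Delta> - (h * h) *\<^sub>R ?D v u x) \<le> e * h * h"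
      by (simp add: algebra_simps)
    have "norm ((h * h) *\<^sub>R (?D u v x - ?D v u x))
        = norm ((?\<Delta> - (h * h) *\<^sub>R ?D v u x) - (?\<Delta> - (h * h) *\<^sub>R ?D u v x))"
      by (simp add: scaleR_diff_right)
    also have "\<dots> \<le> e * h * h + e * h * h"
      using norm_triangle_ineq4 1 2 by (meson add_mono order_trans)
    finally have "(h * h) * norm (?D u v x - ?D v u x) \<le> (h * h) * (2 * e)"
      using h by (simp add: mult_ac)
    moreover have "h * h > 0" using h by simp
    ultimately show ?thesis by (rule mult_left_le_imp_le)
  qed
  have "norm (?D u v x - ?D v u x) \<le> 0"
  proof (rule field_le_epsilon)
    fix e :: real assume "e > 0"
    then show "norm (?D u v x - ?D v u x) \<le> 0 + e" using close[of "e/2"] by simp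
  qed
  then show ?thesis by simp
qed

text \<open>The Lie bracket formula in coordinates: the second-order terms cancel by symmetry, and only
  the derivatives of the coefficient fields survive.\<close>

lemma frechet_derivative_commutator:
  fixes F :: "'a::euclidean_space \<Rightarrow> 'b::real_normed_vector"
  assumes S: "open S" "x \<in> S" and F: "smooth_on S F" and X: "smooth_on S X" and Y: "smooth_on S Y"
  shows "frechet_derivative (\<lambda>z. frechet_derivative F (at z) (Y z)) (at x) (X x)
      - frechet_derivative (\<lambda>z. frechet_derivative F (at z) (X z)) (at x) (Y x)
    = frechet_derivative F (at x)
        (frechet_derivative Y (at x) (X x) - frechet_derivative X (at x) (Y x))"
proof -
  let ?F' = "\<lambda>z. frechet_derivative F (at z)"
  let ?F2 = "\<lambda>a b. frechet_derivative (\<lambda>z. ?F' z a) (at x) b"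
  have lin: "linear (?F' z)" if "z \<in> S" for z
    using F that by (simp add: linear_frechet_derivative smooth_on_differentiable)
  have lin2: "linear (frechet_derivative (\<lambda>z. ?F' z a) (at x))" for a
    using smooth_on_differentiable[OF smooth_on_frechet_derivative[OF F] S(2)]
    by (rule linear_frechet_derivative)
  have rep: "?F' z w = (\<Sum>b\<in>Basis. (w \<bullet> b) *\<^sub>R ?F' z b)" if "z \<in> S" for z w
  proof -
    have "?F' z w = ?F' z (\<Sum>b\<in>Basis. (w \<bullet> b) *\<^sub>R b)" by (simp add: euclidean_representation)
    also have "\<dots> = (\<Sum>b\<in>Basis. (w \<bullet> b) *\<^sub>R ?F' z b)"
      using lin[OF that] by (simp add: linear_sum linear_scale)
    finally show ?thesis .
  qed
  have D: "frechet_derivative (\<lambda>z. ?F' z (Z z)) (at x) w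
      = ?F' x (frechet_derivative Z (at x) w) + ?F2 w (Z x)"
    if Z: "smooth_on S Z" for Z w
  proof -
    have "((\<lambda>z. \<Sum>b\<in>Basis. (Z z \<bullet> b) *\<^sub>R ?F' z b) has_derivative
        (\<lambda>w. \<Sum>b\<in>Basis. (Z x \<bullet> b) *\<^sub>R ?F2 b w + (frechet_derivative Z (at x) w \<bullet> b) *\<^sub>R ?F' x b)) (at x)"
      by (intro has_derivative_sum has_derivative_scaleR has_derivative_inner_left
          smooth_on_has_derivative[OF Z S(2)]
          smooth_on_has_derivative[OF smooth_on_frechet_derivative[OF F] S(2)])
    then have "((\<lambda>z. ?F' z (Z z)) has_derivative
        (\<lambda>w. \<Sum>b\<in>Basis. (Z x \<bullet> b) *\<^sub>R ?F2 b w + (frechet_derivative Z (at x) w \<bullet> b) *\<^sub>R ?F' x b)) (at x)"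
      by (rule has_derivative_transform_within_open[OF _ S]) (rule rep[symmetric])
    then have "frechet_derivative (\<lambda>z. ?F' z (Z z)) (at x) w
        = (\<Sum>b\<in>Basis. (Z x \<bullet> b) *\<^sub>R ?F2 b w + (frechet_derivative Z (at x) w \<bullet> b) *\<^sub>R ?F' x b)"
      by (simp add: frechet_derivative_at[symmetric])
    also have "\<dots> = (\<Sum>b\<in>Basis. (Z x \<bullet> b) *\<^sub>R ?F2 w b) + ?F' x (frechet_derivative Z (at x) w)"
      using symmetric_second_derivative[OF S F, of _ w]
      by (simp add: sum.distrib rep[OF S(2), of "frechet_derivative Z (at x) w"])
    also have "(\<Sum>b\<in>Basis. (Z x \<bullet> b) *\<^sub>R ?F2 w b) = ?F2 w (\<Sum>b\<in>Basis. (Z x \<bullet> b) *\<^sub>R b)"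
      using lin2 by (simp add: linear_sum linear_scale)
    finally show ?thesis by (simp add: euclidean_representation add.commute)
  qed
  show ?thesis
    using symmetric_second_derivative[OF S F, of "X x" "Y x"] lin[OF S(2)]
    by (simp add: D X Y linear_diff)
qed

text \<open>The functions \<open>t \<mapsto> t\<^sup>-\<^sup>n exp (- 1 / t)\<close>, extended by zero to \<open>t \<le> 0\<close>, form a family closed
  under differentiation up to linear combinations, so every member is smooth.\<close>

definition flat_fun :: "nat \<Rightarrow> real \<Rightarrow> real" where
  "flat_fun n t = (if t > 0 then inverse t ^ n * exp (- inverse t) else 0)"

lemma flat_fun_tendsto_0: "(flat_fun n \<longlongrightarrow> 0) (at 0)"
proof -
  have "((\<lambda>y::real. y ^ n / exp y) \<longlongrightarrow> 0) at_top"
    by (rule tendsto_power_div_exp_0)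
  from filterlim_compose[OF this filterlim_inverse_at_top_right]
  have "((\<lambda>t::real. inverse t ^ n / exp (inverse t)) \<longlongrightarrow> 0) (at_right 0)" .
  then have "(flat_fun n \<longlongrightarrow> 0) (at_right 0)"
    by (rule Lim_transform_eventually)
      (auto simp: flat_fun_def eventually_at_filter exp_minus divide_inverse)
  moreover have "(flat_fun n \<longlongrightarrow> 0) (at_left 0)"
    by (rule Lim_transform_eventually[OF tendsto_const])
      (auto simp: flat_fun_def eventually_at_filter)
  ultimately show ?thesis by (simp add: filterlim_split_at)
qed

lemma flat_fun_has_field_derivative:
  "(flat_fun n has_field_derivative (flat_fun (n + 2) t - real n * flat_fun (n + 1) t)) (at t)"
proof -
  consider "t > 0" | "t < 0" | "t = 0" by linarith
  then show ?thesis
  proof cases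
    case 1
    have "((\<lambda>t. inverse t ^ n * exp (- inverse t)) has_field_derivative
        (flat_fun (n + 2) t - real n * flat_fun (n + 1) t)) (at t)"
      using 1
      by (cases n) (auto intro!: derivative_eq_intros simp: flat_fun_def algebra_simps,
          metis One_nat_def power_eq_if)
    then show ?thesis
      by (rule DERIV_cong_ev[THEN iffD1, rotated -1])
        (use 1 in \<open>auto simp: flat_fun_def intro: eventually_mono[OF eventually_gt_at_top]
           eventually_nhds_in_open[of "{0<..}", THEN eventually_mono]\<close>)
  next
    case 2
    have "((\<lambda>t::real. 0::real) has_field_derivative 0) (at t)" by simp
    then have "(flat_fun n has_field_derivative 0) (at t)"
      by (rule has_field_derivative_transform_within_open[of _ _ _ "{..<0}"])
        (use 2 in \<open>auto simp: flat_fun_def\<close>)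
    then show ?thesis using 2 by (simp add: flat_fun_def)
  next
    case 3
    have "((\<lambda>h. (flat_fun n (0 + h) - flat_fun n 0) / h) \<longlongrightarrow> 0) (at 0)"
      by (rule Lim_transform_eventually[OF flat_fun_tendsto_0[of "n + 1"]])
        (auto simp: flat_fun_def eventually_at_filter divide_inverse)
    then show ?thesis using 3 by (simp add: DERIV_def flat_fun_def)
  qed
qed

lemma smooth_on_flat_fun: "smooth_on UNIV (flat_fun n)"
  unfolding smooth_on_def
proof
  fix k show "Ck_on k UNIV (flat_fun n)"
  proof (induction k arbitrary: n)
    case 0
    have "isCont (flat_fun n) t" for t
      using flat_fun_has_field_derivative DERIV_isCont by blast
    then show ?case by (simp add: continuous_at_imp_continuous_on)
  next
    case (Suc k)
    have "Ck_on k UNIV (\<lambda>x. flat_fun (n + 2) x * v + flat_fun (n + 1) x * (- real n * v))" for v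
      by (intro Ck_on_add Ck_on_bilinear[OF _ bounded_bilinear_mult] Suc Ck_on_const) auto
    then have "Ck_on k UNIV (\<lambda>x. (flat_fun (n + 2) x - real n * flat_fun (n + 1) x) * v)" for v
      by (simp add: algebra_simps)
    then show ?case
      using flat_fun_has_field_derivative
      by (intro Ck_on_SucI[where D = "\<lambda>t v. (flat_fun (n + 2) t - real n * flat_fun (n + 1) t) * v"])
        (auto simp: has_field_derivative_def)
  qed
qed

text \<open>A flat function of \<open>r\<^sup>2 - \<bar>x - a\<bar>\<^sup>2\<close>, normalised at the centre, is smooth across the sphere of
  radius \<open>r\<close>.\<close>

lemma smooth_bump:
  fixes a :: "'a::euclidean_space"
  assumes "r > 0"
  obtains \<phi> :: "'a \<Rightarrow> real" where "smooth_on UNIV \<phi>" "\<phi> a = 1" "\<And>x. x \<notin> cball a r \<Longrightarrow> \<phi> x = 0"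
proof
  let ?q = "\<lambda>x. r * r + - ((x + - a) \<bullet> (x + - a))"
  let ?\<phi> = "\<lambda>x. flat_fun 0 (?q x) * inverse (flat_fun 0 (r * r))"
  have q: "smooth_on UNIV ?q"
    by (intro smooth_on_add smooth_on_const smooth_on_id smooth_on_bilinear[OF _ bounded_bilinear_inner]
        smooth_on_linear[OF _ bounded_linear_minus[OF bounded_linear_ident]]) auto
  show "smooth_on UNIV ?\<phi>"
    by (intro smooth_on_bilinear[OF _ bounded_bilinear_mult] smooth_on_const
        smooth_on_compose[OF _ _ _ q smooth_on_flat_fun]) auto
  show "?\<phi> a = 1" using assms by (simp add: flat_fun_def)
  show "?\<phi> x = 0" if "x \<notin> cball a r" for x
  proof -
    have "r * r < norm (x - a) * norm (x - a)"
      using that assms by (intro mult_strict_mono) (auto simp: dist_norm norm_minus_commute)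
    then show ?thesis
      by (simp add: flat_fun_def dot_square_norm power2_eq_square)
  qed
qed

section \<open>Smooth maps and vector fields on a manifold\<close>

lemma sum_fun_eval: "(\<Sum>i\<in>J. f i) x = (\<Sum>i\<in>J. f i x)"
  for f :: "'i \<Rightarrow> 'a \<Rightarrow> 'b::comm_monoid_add"
  by (induction J rule: infinite_finite_induct) auto

lemma sum_axis: "(\<Sum>i\<in>UNIV. x i *\<^sub>R axis i (1::real)) = (\<chi> i. x i)"
  by (simp add: vec_eq_iff axis_def if_distrib cong: if_cong)

lemma frechet_derivative_cong_open:
  assumes "open S" "x \<in> S" "\<And>y. y \<in> S \<Longrightarrow> f y = g y"
  shows "frechet_derivative f (at x) = frechet_derivative g (at x)"
proof -
  have "(f has_derivative D) (at x) \<longleftrightarrow> (g has_derivative D) (at x)" for D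
    using assms has_derivative_transform_within_open[OF _ assms(1,2)] by metis
  then show ?thesis by (simp add: frechet_derivative_def)
qed

locale smooth_manifold =
  fixes A :: "('m::t2_space, 'n::finite) chart set"
  assumes atlas: "smooth_atlas A"
begin

lemma chart_at: obtains c where "c \<in> A" "p \<in> fst c"
proof -
  have "p \<in> (\<Union>c\<in>A. fst c)" using atlas by (simp add: smooth_atlas_def)
  then show ?thesis using that by blast
qed

lemma
  assumes "c \<in> A"
  shows open_chart: "open (fst c)" and open_chart_image: "open (snd c ` fst c)"
    and chart_homeomorphism: "homeomorphism (fst c) (snd c ` fst c) (snd c) (chart_inv c)"
  using atlas assms by (auto simp: smooth_atlas_def)

lemma chart_inv_chart [simp]: "c \<in> A \<Longrightarrow> p \<in> fst c \<Longrightarrow> chart_inv c (snd c p) = p"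
  using chart_homeomorphism by (auto simp: homeomorphism_def)

lemma open_chart_image_Int:
  assumes "c \<in> A" "open W"
  shows "open (snd c ` (fst c \<inter> W))"
proof -
  have "openin (top_of_set (snd c ` fst c)) (snd c ` (fst c \<inter> W))"
    by (rule homeomorphism_imp_open_map[OF chart_homeomorphism[OF assms(1)]])
      (use assms(2) in auto)
  then show ?thesis using open_chart_image[OF assms(1)] openin_open_eq by blast
qed

lemma open_chart_Int: "c \<in> A \<Longrightarrow> open W \<Longrightarrow> open (fst c \<inter> W)"
  using open_chart by (simp add: open_Int)

lemma smooth_transition:
  "c \<in> A \<Longrightarrow> d \<in> A \<Longrightarrow> smooth_on (snd c ` (fst c \<inter> fst d)) (snd d \<circ> chart_inv c)"
  using atlas by (auto simp: smooth_atlas_def)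

lemma smooth_map_on_subset: "smooth_map_on A W g \<Longrightarrow> U \<subseteq> W \<Longrightarrow> smooth_map_on A U g"
  unfolding smooth_map_on_def by (blast intro: smooth_on_subset)

lemma smooth_map_on_local:
  assumes "\<And>p. p \<in> W \<Longrightarrow> \<exists>U. open U \<and> p \<in> U \<and> smooth_map_on A U g"
  shows "smooth_map_on A W g"
  unfolding smooth_map_on_def
proof (intro ballI smooth_on_local)
  fix c x assume c: "c \<in> A" and "x \<in> snd c ` (fst c \<inter> W)"
  then obtain p where p: "x = snd c p" "p \<in> fst c" "p \<in> W" by auto
  from assms[OF p(3)] obtain U where "open U" "p \<in> U" "smooth_map_on A U g" by blast
  then show "\<exists>T. open T \<and> x \<in> T \<and> smooth_on T (g \<circ> chart_inv c)"
    using c p open_chart_image_Int by (auto simp: smooth_map_on_def intro!: exI[of _ "snd c ` (fst c \<inter> U)"])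
qed

lemma smooth_map_on_cong:
  assumes "open W" "\<And>p. p \<in> W \<Longrightarrow> f p = g p" "smooth_map_on A W f"
  shows "smooth_map_on A W g"
  unfolding smooth_map_on_def
proof
  fix c assume c: "c \<in> A"
  show "smooth_on (snd c ` (fst c \<inter> W)) (g \<circ> chart_inv c)"
    by (rule smooth_on_cong[of _ "f \<circ> chart_inv c"])
      (use c assms open_chart_image_Int in \<open>auto simp: smooth_map_on_def\<close>)
qed

text \<open>Composing with the transition maps carries smoothness from one chart to all others.\<close>

lemma smooth_map_on_chartI:
  assumes "c \<in> A" "open W" "W \<subseteq> fst c" "smooth_on (snd c ` W) (g \<circ> chart_inv c)"
  shows "smooth_map_on A W g"
  unfolding smooth_map_on_def
proof
  fix d assume d: "d \<in> A"
  have W: "open (snd c ` W)"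
    using open_chart_image_Int[OF assms(1,2)] assms(3) by (simp add: Int_absorb1)
  have "smooth_on (snd d ` (fst d \<inter> W)) (snd c \<circ> chart_inv d)"
    by (rule smooth_on_subset[OF smooth_transition[OF d assms(1)]]) (use assms(3) in auto)
  then have "smooth_on (snd d ` (fst d \<inter> W)) (\<lambda>x. (g \<circ> chart_inv c) ((snd c \<circ> chart_inv d) x))"
    by (intro smooth_on_compose[OF open_chart_image_Int[OF d assms(2)] W _ _ assms(4)])
      (use d in \<open>auto simp: o_def\<close>)
  then show "smooth_on (snd d ` (fst d \<inter> W)) (g \<circ> chart_inv d)"
    by (rule smooth_on_cong[rotated 2])
      (use d assms in \<open>auto intro: open_chart_image_Int\<close>)
qed

lemma smooth_map_on_const: "smooth_map_on A W (\<lambda>p. k)"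
  by (simp add: smooth_map_on_def o_def smooth_on_const)

lemma smooth_map_on_add:
  "open W \<Longrightarrow> smooth_map_on A W f \<Longrightarrow> smooth_map_on A W g \<Longrightarrow> smooth_map_on A W (\<lambda>p. f p + g p)"
  unfolding smooth_map_on_def o_def
proof (rule ballI, goal_cases)
  case (1 c)
  show ?case
    by (rule smooth_on_add[where f = "\<lambda>x. f (chart_inv c x)" and g = "\<lambda>x. g (chart_inv c x)"])
      (use 1 in \<open>auto intro: open_chart_image_Int\<close>)
qed

lemma smooth_map_on_sum:
  "open W \<Longrightarrow> (\<And>i. i \<in> J \<Longrightarrow> smooth_map_on A W (f i)) \<Longrightarrow> smooth_map_on A W (\<lambda>p. \<Sum>i\<in>J. f i p)"
  by (induction J rule: infinite_finite_induct) (auto intro: smooth_map_on_const smooth_map_on_add)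

lemma smooth_map_on_linear:
  "bounded_linear L \<Longrightarrow> open W \<Longrightarrow> smooth_map_on A W f \<Longrightarrow> smooth_map_on A W (\<lambda>p. L (f p))"
  unfolding smooth_map_on_def o_def
proof (rule ballI, goal_cases)
  case (1 c)
  show ?case
    by (rule smooth_on_linear[where f = "\<lambda>x. f (chart_inv c x)"])
      (use 1 in \<open>auto intro: open_chart_image_Int\<close>)
qed

lemma smooth_map_on_bilinear:
  "bounded_bilinear B \<Longrightarrow> open W \<Longrightarrow> smooth_map_on A W f \<Longrightarrow> smooth_map_on A W g \<Longrightarrow>
    smooth_map_on A W (\<lambda>p. B (f p) (g p))"
  unfolding smooth_map_on_def o_def
proof (rule ballI, goal_cases)
  case (1 c)
  show ?case
    by (rule smooth_on_bilinear[where f = "\<lambda>x. f (chart_inv c x)" and g = "\<lambda>x. g (chart_inv c x)"])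
      (use 1 in \<open>auto intro: open_chart_image_Int\<close>)
qed

lemma smooth_map_on_minus:
  "open W \<Longrightarrow> smooth_map_on A W f \<Longrightarrow> smooth_map_on A W (\<lambda>p. - f p)"
  by (rule smooth_map_on_linear[OF bounded_linear_minus[OF bounded_linear_ident]])

lemma smooth_map_on_diff:
  "open W \<Longrightarrow> smooth_map_on A W f \<Longrightarrow> smooth_map_on A W g \<Longrightarrow> smooth_map_on A W (\<lambda>p. f p - g p)"
  using smooth_map_on_add[OF _ _ smooth_map_on_minus, of W f g] by simp

lemma smooth_map_on_prod:
  fixes f :: "'i \<Rightarrow> 'm \<Rightarrow> real"
  shows "open W \<Longrightarrow> (\<And>i. i \<in> J \<Longrightarrow> smooth_map_on A W (f i)) \<Longrightarrow> smooth_map_on A W (\<lambda>p. \<Prod>i\<in>J. f i p)"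
  by (induction J rule: infinite_finite_induct)
    (auto intro: smooth_map_on_const smooth_map_on_bilinear[OF bounded_bilinear_mult])

lemma smooth_map_on_compose:
  fixes f :: "'m \<Rightarrow> 'b::euclidean_space"
  assumes "open W" "open T" "f ` W \<subseteq> T" "smooth_map_on A W f" "smooth_on T g"
  shows "smooth_map_on A W (\<lambda>p. g (f p))"
  unfolding smooth_map_on_def o_def
proof
  fix c assume c: "c \<in> A"
  show "smooth_on (snd c ` (fst c \<inter> W)) (\<lambda>x. g (f (chart_inv c x)))"
    by (rule smooth_on_compose[where f = "\<lambda>x. f (chart_inv c x)", OF _ assms(2) _ _ assms(5)])
      (use c assms in \<open>auto intro: open_chart_image_Int simp: smooth_map_on_def o_def\<close>)
qed

lemma smooth_map_on_inverse:
  assumes "open W" "smooth_map_on A W f" "\<And>p. p \<in> W \<Longrightarrow> f p \<noteq> (0::real)"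
  shows "smooth_map_on A W (\<lambda>p. inverse (f p))"
  by (rule smooth_map_on_compose[OF assms(1) _ _ assms(2) smooth_on_inverse]) (use assms(3) in auto)

lemma smooth_map_on_chart: "d \<in> A \<Longrightarrow> smooth_map_on A (fst d) (snd d)"
  by (simp add: smooth_map_on_def smooth_transition)

section \<open>Derivatives in charts\<close>

lemma chart_deriv_has_derivative:
  assumes "smooth_map_on A W g" "p \<in> W" "c \<in> A" "p \<in> fst c"
  shows "((g \<circ> chart_inv c) has_derivative chart_deriv c g p) (at (snd c p))"
proof -
  have "chart_deriv c g p = frechet_derivative (g \<circ> chart_inv c) (at (snd c p))"
    by (auto simp: chart_deriv_def)
  then show ?thesis
    using assms smooth_on_has_derivative[of "snd c ` (fst c \<inter> W)" "g \<circ> chart_inv c" "snd c p"]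
    by (auto simp: smooth_map_on_def)
qed

lemma chart_deriv_eqI:
  "((g \<circ> chart_inv c) has_derivative D) (at (snd c p)) \<Longrightarrow> chart_deriv c g p = D"
  by (auto simp: chart_deriv_def frechet_derivative_at[symmetric])

lemma chart_deriv_cong:
  assumes "open W" "p \<in> W" "\<And>q. q \<in> W \<Longrightarrow> f q = g q" "c \<in> A" "p \<in> fst c"
  shows "chart_deriv c f p = chart_deriv c g p"
proof
  fix v show "chart_deriv c f p v = chart_deriv c g p v"
    unfolding chart_deriv_def
    by (subst frechet_derivative_cong_open[of "snd c ` (fst c \<inter> W)" _ _ "g \<circ> chart_inv c"])
      (use assms open_chart_image_Int in auto)
qed

lemma chart_deriv_change:
  assumes "smooth_map_on A W g" "open W" "p \<in> W" "c \<in> A" "d \<in> A" "p \<in> fst c" "p \<in> fst d"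
  shows "chart_deriv c g p v = chart_deriv d g p (chart_deriv c (snd d) p v)"
proof -
  have 1: "((snd d \<circ> chart_inv c) has_derivative chart_deriv c (snd d) p) (at (snd c p))"
    by (rule chart_deriv_has_derivative[OF smooth_map_on_chart]) (use assms in auto)
  have 2: "((g \<circ> chart_inv d) has_derivative chart_deriv d g p) (at ((snd d \<circ> chart_inv c) (snd c p)))"
    using chart_deriv_has_derivative[OF assms(1,3,5,7)] assms by simp
  have "(((g \<circ> chart_inv d) \<circ> (snd d \<circ> chart_inv c)) has_derivative
      chart_deriv d g p \<circ> chart_deriv c (snd d) p) (at (snd c p))"
    by (rule diff_chain_at[OF 1 2])
  then have "((g \<circ> chart_inv c) has_derivative chart_deriv d g p \<circ> chart_deriv c (snd d) p) (at (snd c p))"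
    by (rule has_derivative_transform_within_open[where s = "snd c ` (fst c \<inter> fst d)"])
      (use assms open_chart_image_Int open_chart in auto)
  from chart_deriv_eqI[OF this] show ?thesis by simp
qed

lemma chart_deriv_self:
  assumes "c \<in> A" "p \<in> fst c"
  shows "chart_deriv c (snd c) p = (\<lambda>v. v)"
proof (rule chart_deriv_eqI)
  show "((snd c \<circ> chart_inv c) has_derivative (\<lambda>v. v)) (at (snd c p))"
    by (rule has_derivative_transform_within_open[OF has_derivative_ident open_chart_image[OF assms(1)]])
      (use assms in auto)
qed

lemma smooth_map_on_chart_deriv:
  assumes "smooth_map_on A W g" "open W" "c \<in> A" and v: "smooth_map_on A (fst c \<inter> W) v"
  shows "smooth_map_on A (fst c \<inter> W) (\<lambda>q. chart_deriv c g q (v q))"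
proof -
  have op: "open (fst c \<inter> W)" by (intro open_chart_Int open_chart) (use assms in auto)
  have "smooth_map_on A (fst c \<inter> W) (\<lambda>q. chart_deriv c g q (axis i 1))" for i
  proof (rule smooth_map_on_chartI[OF assms(3) op])
    have "smooth_on (snd c ` (fst c \<inter> W)) (g \<circ> chart_inv c)"
      using assms by (simp add: smooth_map_on_def)
    from smooth_on_frechet_derivative[OF this]
    have "smooth_on (snd c ` (fst c \<inter> W)) (\<lambda>x. frechet_derivative (g \<circ> chart_inv c) (at x) (axis i 1))" .
    then show "smooth_on (snd c ` (fst c \<inter> W)) ((\<lambda>q. chart_deriv c g q (axis i 1)) \<circ> chart_inv c)"
      by (rule smooth_on_cong[rotated 2])
        (use assms open_chart_image_Int in \<open>auto simp: chart_deriv_def\<close>)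
  qed auto
  then have "smooth_map_on A (fst c \<inter> W) (\<lambda>q. \<Sum>i\<in>UNIV. (v q $ i) *\<^sub>R chart_deriv c g q (axis i 1))"
    by (intro smooth_map_on_sum op smooth_map_on_bilinear[OF bounded_bilinear_scaleR]
        smooth_map_on_linear[OF bounded_linear_vec_nth] v)
  then show ?thesis
  proof (rule smooth_map_on_cong[OF op, rotated])
    fix q assume q: "q \<in> fst c \<inter> W"
    then have "linear (chart_deriv c g q)"
      by (intro has_derivative_linear[OF chart_deriv_has_derivative[OF assms(1)]]) (use assms(3) in auto)
    then have "(\<Sum>i\<in>UNIV. (v q $ i) *\<^sub>R chart_deriv c g q (axis i 1))
        = chart_deriv c g q (\<Sum>i\<in>UNIV. (v q $ i) *\<^sub>R axis i 1)"
      by (simp add: linear_sum linear_scale)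
    then show "(\<Sum>i\<in>UNIV. (v q $ i) *\<^sub>R chart_deriv c g q (axis i 1)) = chart_deriv c g q (v q)"
      by (simp add: sum_axis)
  qed
qed

section \<open>Tangent vectors\<close>

text \<open>The inverse of \<open>u \<mapsto> u c\<close> on the tangent space at \<open>p\<close>.\<close>

definition tangent_lift :: "('m, 'n) chart \<Rightarrow> 'm \<Rightarrow> real ^ 'n \<Rightarrow> ('m, 'n) tvec" where
  "tangent_lift c p v = (\<lambda>d. if d \<in> A \<and> p \<in> fst d then chart_deriv c (snd d) p v else 0)"

lemma tangent_spaceD:
  "u \<in> tangent_space A p \<Longrightarrow> c \<in> A \<Longrightarrow> d \<in> A \<Longrightarrow> p \<in> fst c \<Longrightarrow> p \<in> fst d \<Longrightarrow>
    u d = chart_deriv c (snd d) p (u c)"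
  unfolding tangent_space_def by blast

lemma tangent_space_outside: "u \<in> tangent_space A p \<Longrightarrow> \<not> (c \<in> A \<and> p \<in> fst c) \<Longrightarrow> u c = 0"
  unfolding tangent_space_def by blast

lemma tangent_spaceI:
  "(\<And>c d. c \<in> A \<Longrightarrow> d \<in> A \<Longrightarrow> p \<in> fst c \<Longrightarrow> p \<in> fst d \<Longrightarrow> u d = chart_deriv c (snd d) p (u c)) \<Longrightarrow>
    (\<And>c. \<not> (c \<in> A \<and> p \<in> fst c) \<Longrightarrow> u c = 0) \<Longrightarrow> u \<in> tangent_space A p"
  unfolding tangent_space_def by blast

lemma linear_chart_deriv:
  "smooth_map_on A W g \<Longrightarrow> p \<in> W \<Longrightarrow> c \<in> A \<Longrightarrow> p \<in> fst c \<Longrightarrow> linear (chart_deriv c g p)"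
  by (rule has_derivative_linear[OF chart_deriv_has_derivative])

lemma subspace_tangent_space: "subspace (tangent_space A p)"
proof -
  have lin: "linear (chart_deriv c (snd d) p)"
    if "c \<in> A" "d \<in> A" "p \<in> fst c" "p \<in> fst d" for c d
    by (rule linear_chart_deriv[OF smooth_map_on_chart]) (use that in auto)
  show ?thesis
    unfolding subspace_def
  proof (intro conjI ballI allI)
    show "0 \<in> tangent_space A p"
      using lin by (intro tangent_spaceI) (auto simp: linear_0)
    fix u v assume u: "u \<in> tangent_space A p" and v: "v \<in> tangent_space A p"
    show "u + v \<in> tangent_space A p"
    proof (rule tangent_spaceI)
      fix c d assume c: "c \<in> A" "d \<in> A" "p \<in> fst c" "p \<in> fst d"
      show "(u + v) d = chart_deriv c (snd d) p ((u + v) c)"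
        using tangent_spaceD[OF u c] tangent_spaceD[OF v c] lin[OF c] by (simp add: linear_add)
    qed (simp add: tangent_space_outside[OF u] tangent_space_outside[OF v])
    fix r show "r *\<^sub>R u \<in> tangent_space A p"
    proof (rule tangent_spaceI)
      fix c d assume c: "c \<in> A" "d \<in> A" "p \<in> fst c" "p \<in> fst d"
      show "(r *\<^sub>R u) d = chart_deriv c (snd d) p ((r *\<^sub>R u) c)"
        using tangent_spaceD[OF u c] lin[OF c] by (simp add: scaleR_fun_def linear_scale)
    qed (simp add: scaleR_fun_def tangent_space_outside[OF u])
  qed
qed

lemma tangent_lift_mem:
  assumes "c \<in> A" "p \<in> fst c"
  shows "tangent_lift c p v \<in> tangent_space A p"
proof (rule tangent_spaceI)
  fix d e assume d: "d \<in> A" "e \<in> A" "p \<in> fst d" "p \<in> fst e"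
  have "chart_deriv c (snd e) p v = chart_deriv d (snd e) p (chart_deriv c (snd d) p v)"
    by (rule chart_deriv_change[OF smooth_map_on_chart open_chart]) (use assms d in auto)
  then show "tangent_lift c p v e = chart_deriv d (snd e) p (tangent_lift c p v d)"
    using d by (simp add: tangent_lift_def)
qed (auto simp: tangent_lift_def)

lemma tangent_lift_self: "c \<in> A \<Longrightarrow> p \<in> fst c \<Longrightarrow> tangent_lift c p v c = v"
  by (simp add: tangent_lift_def chart_deriv_self)

lemma tangent_lift_coord:
  "c \<in> A \<Longrightarrow> p \<in> fst c \<Longrightarrow> u \<in> tangent_space A p \<Longrightarrow> tangent_lift c p (u c) = u"
  by (rule ext) (auto simp: tangent_lift_def tangent_space_outside intro: tangent_spaceD[symmetric])

lemma linear_tangent_lift: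
  assumes "c \<in> A" "p \<in> fst c"
  shows "linear (tangent_lift c p)"
proof -
  have "linear (chart_deriv c (snd d) p)" if "d \<in> A" "p \<in> fst d" for d
    by (rule linear_chart_deriv[OF smooth_map_on_chart]) (use that assms in auto)
  then show ?thesis
    by (intro linearI) (auto simp: tangent_lift_def fun_eq_iff scaleR_fun_def linear_add linear_scale)
qed

lemma coord_vec_eq: "coord_vec A c i p = tangent_lift c p (axis i 1)"
  by (simp add: coord_vec_def tangent_lift_def)

lemma sum_coord_vec:
  assumes "c \<in> A" "p \<in> fst c"
  shows "(\<Sum>i\<in>UNIV. x i *\<^sub>R coord_vec A c i p) = tangent_lift c p (\<chi> i. x i)"
proof -
  have "(\<Sum>i\<in>UNIV. x i *\<^sub>R coord_vec A c i p) = tangent_lift c p (\<Sum>i\<in>UNIV. x i *\<^sub>R axis i 1)"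
    using linear_tangent_lift[OF assms] by (simp add: coord_vec_eq linear_sum linear_scale)
  then show ?thesis by (simp add: sum_axis)
qed

lemma tangent_coord_rep:
  assumes "c \<in> A" "p \<in> fst c" "u \<in> tangent_space A p"
  shows "u = (\<Sum>i\<in>UNIV. (u c $ i) *\<^sub>R coord_vec A c i p)"
  using assms by (simp add: sum_coord_vec tangent_lift_coord)

lemma section_on_subset:
  assumes "section_on A E W \<eta>" "U \<subseteq> W"
  shows "section_on A E U \<eta>"
  unfolding section_on_def
proof (intro conjI ballI, goal_cases)
  case (1 p)
  then show ?case using assms by (auto simp: section_on_def)
next
  case (2 x)
  obtain V s where x: "x = (V, s)" by fastforce
  with 2 assms obtain k where k: "\<And>i. smooth_map_on A (V \<inter> W) (k i)"
    "\<And>p. p \<in> V \<inter> W \<Longrightarrow> \<eta> p = (\<Sum>i\<in>UNIV. k i p *\<^sub>R s i p)"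
    unfolding section_on_def by fast
  have "smooth_map_on A (V \<inter> U) (k i)" for i
    by (rule smooth_map_on_subset[OF k(1)]) (use assms in auto)
  then show ?case using k(2) assms(2) unfolding x by blast
qed

lemma section_on_frame:
  assumes "section_on A E W \<eta>" "(U, s) \<in> frames E"
  shows "\<exists>k. (\<forall>i. smooth_map_on A (U \<inter> W) (k i)) \<and> (\<forall>p\<in>U \<inter> W. \<eta> p = (\<Sum>i\<in>UNIV. k i p *\<^sub>R s i p))"
  using assms unfolding section_on_def by fast

lemma frames_tangent: "c \<in> A \<Longrightarrow> (fst c, coord_vec A c) \<in> frames (tangent_bundle A)"
  unfolding tangent_bundle_def vbundle.simps by blast

lemma section_on_tangent_iff:
  assumes "open W"
  shows "section_on A (tangent_bundle A) W X \<longleftrightarrow>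
    (\<forall>p\<in>W. X p \<in> tangent_space A p) \<and> (\<forall>c\<in>A. smooth_map_on A (fst c \<inter> W) (\<lambda>q. X q c))"
    (is "?L \<longleftrightarrow> ?R")
proof
  assume L: ?L
  show ?R
  proof (intro conjI ballI)
    show "X p \<in> tangent_space A p" if "p \<in> W" for p
      using L that by (simp add: section_on_def tangent_bundle_def)
  next
    fix c assume c: "c \<in> A"
    have "\<exists>k. (\<forall>i. smooth_map_on A (fst c \<inter> W) (k i)) \<and>
        (\<forall>p\<in>fst c \<inter> W. X p = (\<Sum>i\<in>UNIV. k i p *\<^sub>R coord_vec A c i p))"
      by (rule section_on_frame[OF L frames_tangent[OF c]])
    then obtain k where k: "\<And>i. smooth_map_on A (fst c \<inter> W) (k i)"
      "\<And>p. p \<in> fst c \<inter> W \<Longrightarrow> X p = (\<Sum>i\<in>UNIV. k i p *\<^sub>R coord_vec A c i p)" by blast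
    have "open (fst c \<inter> W)" by (rule open_chart_Int[OF c assms])
    then have "smooth_map_on A (fst c \<inter> W) (\<lambda>q. \<Sum>i\<in>UNIV. k i q *\<^sub>R axis i 1)"
      by (intro smooth_map_on_sum smooth_map_on_bilinear[OF bounded_bilinear_scaleR] k
          smooth_map_on_const)
    then show "smooth_map_on A (fst c \<inter> W) (\<lambda>q. X q c)"
      by (rule smooth_map_on_cong[rotated 2])
        (use \<open>open (fst c \<inter> W)\<close> c in \<open>auto simp: k sum_coord_vec tangent_lift_self sum_axis\<close>)
  qed
next
  assume R: ?R
  have "\<exists>k. (\<forall>i. smooth_map_on A (fst c \<inter> W) (k i)) \<and>
      (\<forall>p\<in>fst c \<inter> W. X p = (\<Sum>i\<in>UNIV. k i p *\<^sub>R coord_vec A c i p))" if c: "c \<in> A" for c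
  proof (intro exI[of _ "\<lambda>i q. X q c $ i"] conjI allI ballI)
    show "smooth_map_on A (fst c \<inter> W) (\<lambda>q. X q c $ i)" for i
      by (rule smooth_map_on_linear[OF bounded_linear_vec_nth])
        (use R c open_chart_Int[OF c assms] in auto)
    show "X p = (\<Sum>i\<in>UNIV. (X p c $ i) *\<^sub>R coord_vec A c i p)" if "p \<in> fst c \<inter> W" for p
      using R c that by (intro tangent_coord_rep) auto
  qed
  then show ?L using R by (auto simp: section_on_def tangent_bundle_def)
qed

lemma section_on_coord_vec:
  assumes "c \<in> A"
  shows "section_on A (tangent_bundle A) (fst c) (coord_vec A c i)"
  unfolding section_on_tangent_iff[OF open_chart[OF assms]]
proof (intro conjI ballI)
  show "coord_vec A c i p \<in> tangent_space A p" if "p \<in> fst c" for p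
    using assms that by (simp add: coord_vec_eq tangent_lift_mem)
  fix d assume d: "d \<in> A"
  have op: "open (fst d \<inter> fst c)" by (intro open_chart_Int open_chart) (use assms d in auto)
  have "smooth_map_on A (fst c \<inter> fst d) (\<lambda>q. chart_deriv c (snd d) q (axis i 1))"
    by (rule smooth_map_on_chart_deriv)
      (use assms d open_chart in \<open>auto intro: smooth_map_on_chart smooth_map_on_const\<close>)
  then have "smooth_map_on A (fst d \<inter> fst c) (\<lambda>q. chart_deriv c (snd d) q (axis i 1))"
    by (simp add: Int_commute)
  then show "smooth_map_on A (fst d \<inter> fst c) (\<lambda>q. coord_vec A c i q d)"
    by (rule smooth_map_on_cong[OF op, rotated]) (use d in \<open>auto simp: coord_vec_def\<close>)
qed

text \<open>A cut-off function supported in a chart spreads a tangent vector to a global field; the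
  support is closed because the manifold is Hausdorff.\<close>

lemma vector_field_through:
  assumes u: "u \<in> tangent_space A p"
  obtains X where "X \<in> vector_fields A" "X p = u"
proof -
  obtain c where c: "c \<in> A" "p \<in> fst c" by (rule chart_at)
  obtain r where r: "r > 0" "cball (snd c p) r \<subseteq> snd c ` fst c"
    using open_chart_image[OF c(1)] c(2) open_contains_cball by blast
  obtain \<phi> :: "real ^ 'n \<Rightarrow> real" where \<phi>: "smooth_on UNIV \<phi>" "\<phi> (snd c p) = 1"
    "\<And>x. x \<notin> cball (snd c p) r \<Longrightarrow> \<phi> x = 0"
    using smooth_bump[OF r(1)] by metis
  define X where "X q = (if q \<in> fst c then tangent_lift c q (\<phi> (snd c q) *\<^sub>R u c) else 0)" for q
  \<comment> \<open>The compact set outside which the field vanishes.\<close>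
  define K where "K = chart_inv c ` cball (snd c p) r"
  have "continuous_on (cball (snd c p) r) (chart_inv c)"
    using chart_homeomorphism[OF c(1)] r(2) by (meson continuous_on_subset homeomorphism_cont2)
  then have K: "closed K"
    unfolding K_def by (intro compact_imp_closed compact_continuous_image compact_cball)
  have Kc: "K \<subseteq> fst c" using r(2) c(1) by (auto simp: K_def)
  have zero: "X q = 0" if "q \<notin> K" for q
  proof (cases "q \<in> fst c")
    case True
    then have "snd c q \<notin> cball (snd c p) r" using that c(1) unfolding K_def by force
    then show ?thesis
      using True \<phi>(3) linear_0[OF linear_tangent_lift[OF c(1) True]] by (simp add: X_def)
  qed (simp add: X_def)
  have "X \<in> vector_fields A"
    unfolding sections_def mem_Collect_eq section_on_tangent_iff[OF open_UNIV] Int_UNIV_right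
  proof (intro conjI ballI)
    show "X q \<in> tangent_space A q" for q
      using c tangent_lift_mem subspace_0[OF subspace_tangent_space] by (auto simp: X_def)
    fix d assume d: "d \<in> A"
    show "smooth_map_on A (fst d) (\<lambda>q. X q d)"
    proof (rule smooth_map_on_local)
      fix q assume q: "q \<in> fst d"
      show "\<exists>U. open U \<and> q \<in> U \<and> smooth_map_on A U (\<lambda>q. X q d)"
      proof (cases "q \<in> K")
        case True
        have op: "open (fst c \<inter> fst d)" by (intro open_chart_Int open_chart) (use c d in auto)
        have "smooth_map_on A (fst c) (\<lambda>q. \<phi> (snd c q))"
          by (rule smooth_map_on_compose[OF open_chart[OF c(1)] open_UNIV _ smooth_map_on_chart \<phi>(1)])
            (use c in auto)
        then have "smooth_map_on A (fst c \<inter> fst d) (\<lambda>q. chart_deriv c (snd d) q (\<phi> (snd c q) *\<^sub>R u c))"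
          using c d open_chart op
          by (intro smooth_map_on_chart_deriv smooth_map_on_bilinear[OF bounded_bilinear_scaleR]
              smooth_map_on_const smooth_map_on_chart)
            (auto intro: smooth_map_on_subset)
        then have "smooth_map_on A (fst c \<inter> fst d) (\<lambda>q. X q d)"
          by (rule smooth_map_on_cong[OF op, rotated]) (use d in \<open>auto simp: X_def tangent_lift_def\<close>)
        then show ?thesis using op True Kc q by blast
      next
        case False
        have "smooth_map_on A (- K) (\<lambda>q. X q d)"
          by (rule smooth_map_on_cong[OF _ _ smooth_map_on_const[of _ 0]])
            (use K zero in \<open>auto simp: zero_fun_def\<close>)
        then show ?thesis using False K by blast
      qed
    qed
  qed
  moreover have "X p = u"
    using c u \<phi>(2) by (simp add: X_def tangent_lift_coord)
  ultimately show ?thesis by (rule that)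
qed

section \<open>The differential\<close>

text \<open>The chart that the definition of the differential selects.\<close>

definition base_chart :: "'m \<Rightarrow> ('m, 'n) chart" where
  "base_chart p = (SOME c. c \<in> A \<and> p \<in> fst c)"

lemma base_chart: "base_chart p \<in> A" "p \<in> fst (base_chart p)"
proof -
  obtain c where "c \<in> A \<and> p \<in> fst c" by (rule chart_at) auto
  from someI[of "\<lambda>c. c \<in> A \<and> p \<in> fst c", OF this]
  show "base_chart p \<in> A" "p \<in> fst (base_chart p)" by (auto simp: base_chart_def)
qed

text \<open>Because one fixed chart computes the differential, every differentiation rule can be read
  off from that chart.\<close>

lemma differential_base: "differential A g p u = chart_deriv (base_chart p) g p (u (base_chart p))"
  by (simp add: differential_def base_chart_def Let_def)

lemma differential_eqI:
  "((g \<circ> chart_inv (base_chart p)) has_derivative D) (at (snd (base_chart p) p)) \<Longrightarrow>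
    differential A g p u = D (u (base_chart p))"
  by (simp add: differential_base chart_deriv_eqI)

lemma base_chart_has_derivative:
  "smooth_map_on A W g \<Longrightarrow> p \<in> W \<Longrightarrow>
    ((\<lambda>x. g (chart_inv (base_chart p) x)) has_derivative chart_deriv (base_chart p) g p)
      (at (snd (base_chart p) p))"
  using chart_deriv_has_derivative[OF _ _ base_chart] by (simp add: o_def)

lemma differential_eq_chart_deriv:
  assumes g: "smooth_map_on A W g" "open W" "p \<in> W" and u: "u \<in> tangent_space A p"
    and c: "c \<in> A" "p \<in> fst c"
  shows "differential A g p u = chart_deriv c g p (u c)"
proof -
  have "chart_deriv c g p (u c) =
      chart_deriv (base_chart p) g p (chart_deriv c (snd (base_chart p)) p (u c))"
    by (rule chart_deriv_change[OF g c(1) base_chart(1) c(2) base_chart(2)])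
  also have "chart_deriv c (snd (base_chart p)) p (u c) = u (base_chart p)"
    by (rule tangent_spaceD[OF u c(1) base_chart(1) c(2) base_chart(2), symmetric])
  finally show ?thesis by (simp add: differential_base)
qed

lemma linear_differential:
  assumes "smooth_map_on A W g" "p \<in> W"
  shows "linear (differential A g p)"
  using linear_chart_deriv[OF assms base_chart]
  by (intro linearI) (simp_all add: differential_base scaleR_fun_def linear_add linear_scale)

lemma differential_const: "differential A (\<lambda>q. k) p u = 0"
  by (simp add: differential_base chart_deriv_def o_def)

lemma differential_linear:
  assumes "bounded_linear L" "smooth_map_on A W g" "p \<in> W"
  shows "differential A (\<lambda>q. L (g q)) p u = L (differential A g p u)"
  using bounded_linear.has_derivative[OF assms(1) base_chart_has_derivative[OF assms(2,3)]]
  by (subst differential_eqI) (auto simp: o_def differential_base)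

lemma differential_bilinear:
  assumes "bounded_bilinear B" "smooth_map_on A W f" "smooth_map_on A W g" "p \<in> W"
  shows "differential A (\<lambda>q. B (f q) (g q)) p u
    = B (f p) (differential A g p u) + B (differential A f p u) (g p)"
  using bounded_bilinear.FDERIV[OF assms(1) base_chart_has_derivative[OF assms(2,4)]
      base_chart_has_derivative[OF assms(3,4)]]
  by (subst differential_eqI) (auto simp: o_def differential_base base_chart)

lemma differential_add:
  assumes "smooth_map_on A W f" "smooth_map_on A W g" "p \<in> W"
  shows "differential A (\<lambda>q. f q + g q) p u = differential A f p u + differential A g p u"
  using has_derivative_add[OF base_chart_has_derivative[OF assms(1,3)]
      base_chart_has_derivative[OF assms(2,3)]]
  by (subst differential_eqI) (auto simp: o_def differential_base)

lemma smooth_map_on_differential: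
  assumes X: "section_on A (tangent_bundle A) W X" and W: "open W" and g: "smooth_map_on A W g"
  shows "smooth_map_on A W (\<lambda>q. differential A g q (X q))"
proof (rule smooth_map_on_local)
  fix p assume p: "p \<in> W"
  obtain c where c: "c \<in> A" "p \<in> fst c" by (rule chart_at)
  have op: "open (fst c \<inter> W)" by (rule open_chart_Int[OF c(1) W])
  have X': "X q \<in> tangent_space A q" if "q \<in> W" for q
    using X that by (simp add: section_on_tangent_iff[OF W])
  have "smooth_map_on A (fst c \<inter> W) (\<lambda>q. chart_deriv c g q (X q c))"
    by (rule smooth_map_on_chart_deriv[OF g W c(1)]) (use X c in \<open>simp add: section_on_tangent_iff[OF W]\<close>)
  then have "smooth_map_on A (fst c \<inter> W) (\<lambda>q. differential A g q (X q))"
    by (rule smooth_map_on_cong[OF op, rotated])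
      (use differential_eq_chart_deriv[OF g W _ X' c(1)] in auto)
  then show "\<exists>U. open U \<and> p \<in> U \<and> smooth_map_on A U (\<lambda>q. differential A g q (X q))"
    using op c p by blast
qed

lemma vector_fieldD:
  assumes "X \<in> vector_fields A"
  shows "X p \<in> tangent_space A p" "c \<in> A \<Longrightarrow> smooth_map_on A (fst c) (\<lambda>q. X q c)"
    "section_on A (tangent_bundle A) W X"
proof -
  have *: "section_on A (tangent_bundle A) UNIV X" using assms by (simp add: sections_def)
  then show "X p \<in> tangent_space A p" "c \<in> A \<Longrightarrow> smooth_map_on A (fst c) (\<lambda>q. X q c)"
    by (auto simp: section_on_tangent_iff)
  show "section_on A (tangent_bundle A) W X"
    by (rule section_on_subset[OF *]) simp
qed

lemma chart_deriv_commutator: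
  assumes g: "smooth_map_on A W g" "open W" "p \<in> W" and c: "c \<in> A" "p \<in> fst c"
    and X: "X \<in> vector_fields A" and Y: "Y \<in> vector_fields A"
  shows "chart_deriv c (\<lambda>q. chart_deriv c g q (Y q c)) p (X p c)
      - chart_deriv c (\<lambda>q. chart_deriv c g q (X q c)) p (Y p c)
    = chart_deriv c g p (lie_bracket A X Y p c)"
proof -
  let ?S = "snd c ` (fst c \<inter> W)" and ?G = "g \<circ> chart_inv c"
  let ?c = "\<lambda>(Z :: 'm \<Rightarrow> ('m, 'n) tvec) x. Z (chart_inv c x) c"
  have S: "open ?S" "snd c p \<in> ?S" using c g open_chart_image_Int by auto
  have Z: "smooth_on ?S (?c Z)" if "Z \<in> vector_fields A" for Z
    using smooth_map_on_subset[OF vector_fieldD(2)[OF that c(1)], of "fst c \<inter> W"] c(1)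
    by (auto simp: smooth_map_on_def o_def Int_absorb1)
  have *: "chart_deriv c (\<lambda>q. chart_deriv c g q (Z q c)) p w =
      frechet_derivative (\<lambda>x. frechet_derivative ?G (at x) (?c Z x)) (at (snd c p)) w" for Z w
    unfolding chart_deriv_def
    by (subst frechet_derivative_cong_open[OF S,
          of _ "\<lambda>x. frechet_derivative ?G (at x) (?c Z x)"]) (use c(1) in auto)
  have G: "smooth_on ?S ?G" using g(1) c(1) by (simp add: smooth_map_on_def)
  have "frechet_derivative (\<lambda>x. frechet_derivative ?G (at x) (?c Y x)) (at (snd c p)) (?c X (snd c p))
      - frechet_derivative (\<lambda>x. frechet_derivative ?G (at x) (?c X x)) (at (snd c p)) (?c Y (snd c p))
    = frechet_derivative ?G (at (snd c p))
        (frechet_derivative (?c Y) (at (snd c p)) (?c X (snd c p))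
          - frechet_derivative (?c X) (at (snd c p)) (?c Y (snd c p)))"
    by (rule frechet_derivative_commutator[OF S G Z[OF X] Z[OF Y]])
  then show ?thesis
    unfolding * using c by (simp add: lie_bracket_def chart_deriv_def o_def)
qed

text \<open>The coordinates of a field in a second chart are its derivatives of that chart map, so the
  commutator identity for the chart map is the transformation law of the bracket.\<close>

lemma lie_bracket_mem:
  assumes X: "X \<in> vector_fields A" and Y: "Y \<in> vector_fields A"
  shows "lie_bracket A X Y p \<in> tangent_space A p"
proof -
  have "lie_bracket A X Y p d = chart_deriv c (snd d) p (lie_bracket A X Y p c)"
    if c: "c \<in> A" "p \<in> fst c" and d: "d \<in> A" "p \<in> fst d" for c d
  proof -
    have *: "chart_deriv d (\<lambda>q. Z q d) p (V p d)
        = chart_deriv c (\<lambda>q. chart_deriv c (snd d) q (Z q c)) p (V p c)"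
      if Z: "Z \<in> vector_fields A" and V: "V \<in> vector_fields A" for Z V
    proof -
      have "chart_deriv d (\<lambda>q. Z q d) p (V p d) = chart_deriv c (\<lambda>q. Z q d) p (V p c)"
        using c d tangent_spaceD[OF vector_fieldD(1)[OF V], where c = c and d = d]
          chart_deriv_change[OF vector_fieldD(2)[OF Z d(1)] open_chart[OF d(1)] d(2) c(1) d(1) c(2) d(2)]
        by simp
      also have "\<dots> = chart_deriv c (\<lambda>q. chart_deriv c (snd d) q (Z q c)) p (V p c)"
        by (subst chart_deriv_cong[of "fst c \<inter> fst d" p _ "\<lambda>q. chart_deriv c (snd d) q (Z q c)"])
          (use c d open_chart_Int[OF c(1) open_chart[OF d(1)]] tangent_spaceD[OF vector_fieldD(1)[OF Z], where c = c and d = d] in auto)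
      finally show ?thesis .
    qed
    have "lie_bracket A X Y p d = chart_deriv d (\<lambda>q. Y q d) p (X p d) - chart_deriv d (\<lambda>q. X q d) p (Y p d)"
      using d by (simp add: lie_bracket_def)
    also have "\<dots> = chart_deriv c (snd d) p (lie_bracket A X Y p c)"
      unfolding *[OF X Y] *[OF Y X]
      by (rule chart_deriv_commutator[OF smooth_map_on_chart[OF d(1)] open_chart[OF d(1)] d(2) c X Y])
    finally show ?thesis .
  qed
  then show ?thesis by (rule tangent_spaceI) (auto simp: lie_bracket_def)
qed

text \<open>This single identity, applied to the immersion and to its conormal map, is the source of
  both torsion-freeness statements.\<close>

lemma differential_commutator:
  assumes g: "smooth_map_on A UNIV g"
    and X: "X \<in> vector_fields A" and Y: "Y \<in> vector_fields A"
  shows "differential A (\<lambda>q. differential A g q (Y q)) p (X p)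
      - differential A (\<lambda>q. differential A g q (X q)) p (Y p)
    = differential A g p (lie_bracket A X Y p)"
proof -
  obtain c where c: "c \<in> A" "p \<in> fst c" by (rule chart_at)
  have *: "differential A (\<lambda>q. differential A g q (Z q)) p (V p)
      = chart_deriv c (\<lambda>q. chart_deriv c g q (Z q c)) p (V p c)"
    if Z: "Z \<in> vector_fields A" and V: "V \<in> vector_fields A" for Z V
  proof -
    have "differential A (\<lambda>q. differential A g q (Z q)) p (V p)
        = chart_deriv c (\<lambda>q. differential A g q (Z q)) p (V p c)"
      by (rule differential_eq_chart_deriv[OF _ open_UNIV UNIV_I _ c])
        (auto intro: smooth_map_on_differential vector_fieldD Z V g)
    also have "\<dots> = chart_deriv c (\<lambda>q. chart_deriv c g q (Z q c)) p (V p c)"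
      by (subst chart_deriv_cong[OF open_chart[OF c(1)] c(2) _ c,
            of _ "\<lambda>q. chart_deriv c g q (Z q c)"])
        (auto intro: differential_eq_chart_deriv[OF g open_UNIV UNIV_I] vector_fieldD(1)[OF Z] c(1))
    finally show ?thesis .
  qed
  show ?thesis
    unfolding *[OF X Y] *[OF Y X] chart_deriv_commutator[OF g open_UNIV UNIV_I c X Y]
    by (rule differential_eq_chart_deriv[OF g open_UNIV UNIV_I lie_bracket_mem[OF X Y] c, symmetric])
qed

end

section \<open>Linear algebra\<close>

lemma basis_ofI:
  fixes b :: "'i::finite \<Rightarrow> 'a::real_vector"
  assumes ind: "\<And>x i. (\<Sum>i\<in>UNIV. x i *\<^sub>R b i) = 0 \<Longrightarrow> x i = 0"
    and V: "subspace V" "\<And>i. b i \<in> V" and rep: "\<And>v. v \<in> V \<Longrightarrow> \<exists>x. v = (\<Sum>i\<in>UNIV. x i *\<^sub>R b i)"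
  shows "basis_of V UNIV b"
  unfolding basis_of_def
proof (intro conjI)
  show inj: "inj b"
  proof (rule injI, rule ccontr)
    fix i j assume ij: "b i = b j" "i \<noteq> j"
    let ?x = "\<lambda>l. (if l = i then 1 else if l = j then -1 else 0) :: real"
    have "(\<Sum>l\<in>UNIV. ?x l *\<^sub>R b l) = (\<Sum>l\<in>{i, j}. ?x l *\<^sub>R b l)"
      by (rule sum.mono_neutral_right) auto
    also have "\<dots> = 0" using ij by simp
    finally have "?x i = 0" by (rule ind)
    then show False by simp
  qed
  show "independent (b ` UNIV)"
  proof (rule independent_if_scalars_zero)
    fix g x assume g: "(\<Sum>v\<in>range b. g v *\<^sub>R v) = 0" "x \<in> range b"
    then have "(\<Sum>i\<in>UNIV. g (b i) *\<^sub>R b i) = 0"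
      by (simp add: sum.reindex[OF inj] o_def)
    then have "g (b i) = 0" for i by (rule ind)
    then show "g x = 0" using g(2) by auto
  qed auto
  show "span (b ` UNIV) = V"
  proof
    show "span (b ` UNIV) \<subseteq> V" by (rule span_minimal) (use V in auto)
    show "V \<subseteq> span (b ` UNIV)"
    proof
      fix v assume "v \<in> V"
      from rep[OF this] obtain x where "v = (\<Sum>i\<in>UNIV. x i *\<^sub>R b i)" ..
      then show "v \<in> span (b ` UNIV)" by (simp only:) (intro span_sum span_scale span_base rangeI)
    qed
  qed
qed

lemma basis_of_reindex:
  assumes "basis_of V UNIV b" "bij_betw e J UNIV"
  shows "basis_of V J (\<lambda>j. b (e j))"
proof -
  have "(\<lambda>j. b (e j)) ` J = b ` UNIV"
    using assms(2) by (auto simp: bij_betw_def image_comp[symmetric] simp flip: image_image)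
  moreover have "inj_on (\<lambda>j. b (e j)) J"
    using assms by (auto simp: basis_of_def bij_betw_def inj_on_def)
  ultimately show ?thesis using assms(1) by (simp add: basis_of_def)
qed

lemma dim_basis_of:
  assumes "basis_of V J b" shows "dim V = card J"
proof -
  have "dim V = card (b ` J)"
    using assms by (metis basis_of_def dim_span_eq_card_independent)
  then show ?thesis using assms by (simp add: basis_of_def card_image)
qed

lemma linear_imp_lin_on: "linear g \<Longrightarrow> lin_on V g"
  by (simp add: lin_on_def linear_add linear_scale)

lemma lin_on_sum:
  assumes "lin_on V g" "subspace V" "\<And>i. i \<in> J \<Longrightarrow> b i \<in> V"
  shows "g (\<Sum>i\<in>J. x i *\<^sub>R b i) = (\<Sum>i\<in>J. x i *\<^sub>R g (b i))"
proof -
  have "g 0 = g (0 *\<^sub>R 0)" by simp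
  also have "\<dots> = 0 *\<^sub>R g 0" using assms by (metis lin_on_def subspace_0)
  finally have g0: "g 0 = 0" by simp
  show ?thesis using assms(3)
  proof (induction J rule: infinite_finite_induct)
    case (insert i J)
    then have "(\<Sum>i\<in>J. x i *\<^sub>R b i) \<in> V" "x i *\<^sub>R b i \<in> V"
      using assms(2) by (auto intro: subspace_sum subspace_scale)
    then have "g (x i *\<^sub>R b i + (\<Sum>i\<in>J. x i *\<^sub>R b i)) = x i *\<^sub>R g (b i) + g (\<Sum>i\<in>J. x i *\<^sub>R b i)"
      using assms(1) insert.prems by (simp add: lin_on_def)
    then show ?case using insert by simp
  qed (auto simp: g0)
qed

lemma subspace_dual_space: "subspace (dual_space V)"
  by (auto simp: subspace_def dual_space_def lin_on_def scaleR_fun_def algebra_simps)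

lemma restrict_functional_mem: "subspace V \<Longrightarrow> restrict_functional V \<alpha> \<in> dual_space V"
  by (auto simp: dual_space_def lin_on_def restrict_functional_def subspace_add subspace_scale
      blinfun.add_right blinfun.scaleR_right)

lemma dual_space_eqI:
  assumes "\<alpha> \<in> dual_space V" "\<beta> \<in> dual_space V" and eq: "\<And>x. x \<in> V \<Longrightarrow> \<alpha> x = \<beta> x"
  shows "\<alpha> = \<beta>"
proof
  fix x show "\<alpha> x = \<beta> x"
    using assms(1,2) by (cases "x \<in> V") (auto simp: dual_space_def eq)
qed

lemma restrict_functional_add:
  "restrict_functional V (\<alpha> + \<beta>) = restrict_functional V \<alpha> + restrict_functional V \<beta>"
  by (auto simp: restrict_functional_def blinfun.add_left)

lemma restrict_functional_scaleR:
  "restrict_functional V (r *\<^sub>R \<alpha>) = r *\<^sub>R restrict_functional V \<alpha>"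
  by (auto simp: restrict_functional_def blinfun.scaleR_left scaleR_fun_def)

lemma restrict_functional_minus:
  "restrict_functional V (- \<alpha>) = - restrict_functional V \<alpha>"
  by (auto simp: restrict_functional_def blinfun.minus_left)

section \<open>Bases of direct sums\<close>

lemma basis_of_independent:
  fixes b :: "'i::finite \<Rightarrow> 'a::real_vector"
  assumes "basis_of V UNIV b" "(\<Sum>i\<in>UNIV. x i *\<^sub>R b i) = 0"
  shows "x i = 0"
proof -
  have inj: "inj b" and ind: "independent (range b)" using assms(1) by (auto simp: basis_of_def)
  have "(\<Sum>v\<in>range b. x (inv b v) *\<^sub>R v) = 0"
    using assms(2) by (simp add: sum.reindex[OF inj] inj)
  from independentD[OF ind _ subset_refl this, of "b i"] have "x (inv b (b i)) = 0"
    by simp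
  then show ?thesis by (simp add: inj)
qed

lemma basis_of_rep:
  fixes b :: "'i::finite \<Rightarrow> 'a::real_vector"
  assumes "basis_of V UNIV b" "v \<in> V"
  shows "\<exists>x. v = (\<Sum>i\<in>UNIV. x i *\<^sub>R b i)"
proof -
  have inj: "inj b" and "v \<in> span (range b)" using assms by (auto simp: basis_of_def)
  then obtain u where "v = (\<Sum>w\<in>range b. u w *\<^sub>R w)" by (auto simp: span_finite)
  then have "v = (\<Sum>i\<in>UNIV. u (b i) *\<^sub>R b i)" by (simp add: sum.reindex[OF inj])
  then show ?thesis by (rule exI[of _ "\<lambda>i. u (b i)"])
qed

lemma basis_of_subspace:
  assumes "basis_of V J b" shows "subspace V"
proof -
  have V: "V = span (b ` J)" using assms by (simp add: basis_of_def)
  show ?thesis unfolding V by (rule subspace_span)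
qed

lemma basis_of_mem:
  assumes "basis_of V UNIV b" shows "b i \<in> V"
proof -
  have V: "V = span (range b)" using assms by (simp add: basis_of_def)
  show ?thesis unfolding V by (intro span_base rangeI)
qed

lemma sum_case_sum:
  fixes g :: "'i::finite + 'j::finite \<Rightarrow> 'a::comm_monoid_add"
  shows "(\<Sum>l\<in>UNIV. g l) = (\<Sum>i\<in>UNIV. g (Inl i)) + (\<Sum>j\<in>UNIV. g (Inr j))"
  using sum.Plus[of "UNIV :: 'i set" "UNIV :: 'j set" g] by (simp add: o_def)

lemma sum_direct_sum:
  fixes b :: "'i::finite \<Rightarrow> 'a::real_vector" and b' :: "'j::finite \<Rightarrow> 'b::real_vector"
  shows "(\<Sum>l\<in>UNIV. x l *\<^sub>R case_sum (\<lambda>i. (b i, 0)) (\<lambda>j. (0, b' j)) l)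
    = (\<Sum>i\<in>UNIV. x (Inl i) *\<^sub>R b i, \<Sum>j\<in>UNIV. x (Inr j) *\<^sub>R b' j)"
  by (simp add: sum_case_sum prod_eq_iff fst_sum snd_sum)

lemma basis_of_Times:
  fixes b :: "'i::finite \<Rightarrow> 'a::real_vector" and b' :: "'j::finite \<Rightarrow> 'b::real_vector"
  assumes b: "basis_of V UNIV b" and b': "basis_of W UNIV b'"
  shows "basis_of (V \<times> W) UNIV (case_sum (\<lambda>i. (b i, 0)) (\<lambda>j. (0, b' j)))"
proof (rule basis_ofI)
  fix x l
  assume "(\<Sum>l\<in>UNIV. x l *\<^sub>R case_sum (\<lambda>i. (b i, 0)) (\<lambda>j. (0, b' j)) l) = 0"
  then have "(\<Sum>i\<in>UNIV. x (Inl i) *\<^sub>R b i) = 0" "(\<Sum>j\<in>UNIV. x (Inr j) *\<^sub>R b' j) = 0"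
    unfolding sum_direct_sum by (simp_all add: zero_prod_def)
  then show "x l = 0"
    using basis_of_independent[OF b, of "\<lambda>i. x (Inl i)"] basis_of_independent[OF b', of "\<lambda>j. x (Inr j)"]
    by (cases l) auto
next
  show "subspace (V \<times> W)"
    by (rule subspace_Times[OF basis_of_subspace[OF b] basis_of_subspace[OF b']])
  show "case_sum (\<lambda>i. (b i, 0)) (\<lambda>j. (0, b' j)) l \<in> V \<times> W" for l
    using basis_of_mem[OF b] basis_of_mem[OF b'] subspace_0[OF basis_of_subspace[OF b]]
      subspace_0[OF basis_of_subspace[OF b']]
    by (cases l) auto
  fix v assume "v \<in> V \<times> W"
  then obtain x y where xy: "fst v = (\<Sum>i\<in>UNIV. x i *\<^sub>R b i)" "snd v = (\<Sum>i\<in>UNIV. y i *\<^sub>R b' i)"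
    using basis_of_rep[OF b, of "fst v"] basis_of_rep[OF b', of "snd v"] by (auto simp: mem_Times_iff)
  show "\<exists>z. v = (\<Sum>l\<in>UNIV. z l *\<^sub>R case_sum (\<lambda>i. (b i, 0)) (\<lambda>j. (0, b' j)) l)"
    by (rule exI[of _ "case_sum x y"]) (simp add: sum_direct_sum prod_eq_iff xy)
qed

lemma basis_of_linear_image:
  fixes b :: "'i::finite \<Rightarrow> 'a::real_vector"
  assumes b: "basis_of V UNIV b" and L: "linear L" "inj_on L V"
  shows "basis_of (L ` V) UNIV (\<lambda>i. L (b i))"
proof (rule basis_ofI)
  have V: "subspace V" by (rule basis_of_subspace[OF b])
  have sum: "(\<Sum>i\<in>UNIV. x i *\<^sub>R L (b i)) = L (\<Sum>i\<in>UNIV. x i *\<^sub>R b i)" for x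
    by (simp add: linear_sum[OF L(1)] linear_scale[OF L(1)])
  fix x i assume "(\<Sum>i\<in>UNIV. x i *\<^sub>R L (b i)) = 0"
  then have "L (\<Sum>i\<in>UNIV. x i *\<^sub>R b i) = L 0" by (simp add: sum linear_0[OF L(1)])
  moreover have "(\<Sum>i\<in>UNIV. x i *\<^sub>R b i) \<in> V"
    by (intro subspace_sum subspace_scale V basis_of_mem[OF b])
  ultimately have "(\<Sum>i\<in>UNIV. x i *\<^sub>R b i) = 0"
    using inj_onD[OF L(2)] subspace_0[OF V] by blast
  then show "x i = 0" by (rule basis_of_independent[OF b])
next
  show "subspace (L ` V)" by (rule linear_subspace_image[OF L(1) basis_of_subspace[OF b]])
  show "L (b i) \<in> L ` V" for i using basis_of_mem[OF b] by blast
  fix v assume "v \<in> L ` V"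
  then obtain w where w: "w \<in> V" "v = L w" by blast
  from basis_of_rep[OF b w(1)] obtain x where "w = (\<Sum>i\<in>UNIV. x i *\<^sub>R b i)" ..
  then have "v = (\<Sum>i\<in>UNIV. x i *\<^sub>R L (b i))"
    by (simp add: w(2) linear_sum[OF L(1)] linear_scale[OF L(1)])
  then show "\<exists>x. v = (\<Sum>i\<in>UNIV. x i *\<^sub>R L (b i))" by (rule exI[of _ x])
qed

lemma linear_restrict_functional: "linear (restrict_functional V)"
  by (intro linearI restrict_functional_add restrict_functional_scaleR)

section \<open>Smooth dual frames\<close>

context smooth_manifold
begin

lemma smooth_map_on_det:
  fixes M :: "'m \<Rightarrow> real ^ 'j ^ 'j::finite"
  assumes "open W" "\<And>i j. smooth_map_on A W (\<lambda>p. M p $ i $ j)"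
  shows "smooth_map_on A W (\<lambda>p. det (M p))"
  unfolding det_def
  by (intro smooth_map_on_sum smooth_map_on_bilinear[OF bounded_bilinear_mult] smooth_map_on_prod
      smooth_map_on_const assms)

text \<open>Inverting the Gram matrix by Cramer's rule yields dual covectors that depend smoothly on the
  point.\<close>

lemma smooth_dual_frame:
  fixes v :: "'j::finite \<Rightarrow> 'm \<Rightarrow> 'b::euclidean_space"
  assumes W: "open W" and v: "\<And>j. smooth_map_on A W (v j)"
    and ind: "\<And>p x j. p \<in> W \<Longrightarrow> (\<Sum>j\<in>UNIV. x j *\<^sub>R v j p) = 0 \<Longrightarrow> x j = 0"
  obtains T :: "'j \<Rightarrow> 'm \<Rightarrow> 'b \<Rightarrow>\<^sub>L real" where "\<And>i. smooth_map_on A W (T i)"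
    "\<And>i j p. p \<in> W \<Longrightarrow> blinfun_apply (T i p) (v j p) = (if i = j then 1 else 0)"
proof -
  define G where "G p = (\<chi> i j. v i p \<bullet> v j p)" for p
  \<comment> \<open>Cramer's rule: column \<open>j\<close> of \<open>H p\<close> solves \<open>G p x = e\<^sub>j\<close>.\<close>
  define H where "H p = (\<chi> i j. det (\<chi> k l. if l = i then axis j 1 $ k else G p $ k $ l) * inverse (det (G p)))" for p
  define T where "T i p = (\<Sum>j\<in>UNIV. (H p $ i $ j) *\<^sub>R blinfun_inner_left (v j p))" for i p
  have det: "det (G p) \<noteq> 0" if p: "p \<in> W" for p
  proof
    assume "det (G p) = 0"
    then obtain x where x: "x \<noteq> 0" "G p *v x = 0"
      using invertible_det_nz[of "G p"] matrix_left_invertible_ker[of "G p"]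
        invertible_left_inverse by blast
    let ?s = "\<Sum>j\<in>UNIV. (x $ j) *\<^sub>R v j p"
    have "v i p \<bullet> ?s = (G p *v x) $ i" for i
      by (simp add: G_def matrix_vector_mult_def inner_sum_right mult.commute)
    then have "v i p \<bullet> ?s = 0" for i using x(2) by simp
    then have "?s \<bullet> ?s = 0" by (simp add: inner_sum_left)
    then have "?s = 0" by simp
    from ind[OF p this] have "x $ j = 0" for j .
    then have "x = 0" by (simp add: vec_eq_iff)
    then show False using x(1) by simp
  qed
  have HG: "H p ** G p = mat 1" if p: "p \<in> W" for p
  proof -
    have "G p *v (\<chi> i. H p $ i $ j) = axis j 1" for j
      using cramer[OF det[OF p], of "\<chi> i. H p $ i $ j" "axis j 1"]
      by (simp add: H_def divide_inverse)
    then have "(G p *v (\<chi> i. H p $ i $ j)) $ k = axis j 1 $ k" for j k by simp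
    then have "G p ** H p = mat 1"
      by (simp add: vec_eq_iff matrix_matrix_mult_def matrix_vector_mult_def mat_def axis_def)
    then show ?thesis by (simp add: matrix_left_right_inverse)
  qed
  have Gsm: "smooth_map_on A W (\<lambda>p. G p $ i $ j)" for i j
    unfolding G_def by (simp, intro smooth_map_on_bilinear[OF bounded_bilinear_inner] W v)
  have "smooth_map_on A W (\<lambda>p. H p $ i $ j)" for i j
    unfolding H_def vec_lambda_beta
  proof (intro smooth_map_on_bilinear[OF bounded_bilinear_mult] smooth_map_on_inverse W det
      smooth_map_on_det Gsm)
    show "smooth_map_on A W (\<lambda>p. (\<chi> k l. if l = i then axis j 1 $ k else G p $ k $ l) $ r $ s)" for r s
      using Gsm[of r s] by (cases "s = i") (auto intro: smooth_map_on_const)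
  qed
  then have "smooth_map_on A W (T i)" for i
    unfolding T_def
    by (intro smooth_map_on_sum smooth_map_on_bilinear[OF bounded_bilinear_scaleR]
        smooth_map_on_linear[OF bounded_linear_blinfun_inner_left] W v)
  moreover have "blinfun_apply (T i p) (v j p) = (if i = j then 1 else 0)" if p: "p \<in> W" for i j p
  proof -
    have "blinfun_apply (T i p) (v j p) = (H p ** G p) $ i $ j"
      by (simp add: T_def blinfun.sum_left blinfun.scaleR_left G_def matrix_matrix_mult_def inner_commute)
    then show ?thesis by (simp add: HG[OF p] mat_def)
  qed
  ultimately show ?thesis by (rule that)
qed

end

section \<open>Affine immersions: conormal map and projection\<close>

locale affine_immersed = smooth_manifold A
  for A :: "('m::t2_space, 'n::finite) chart set" +
  fixes f \<xi> :: "'m \<Rightarrow> real ^ 'k::finite"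
  assumes codim: "CARD('k) = CARD('n) + 1"
    and immersion: "affine_immersion A f \<xi>"
begin

abbreviation df :: "'m \<Rightarrow> ('m, 'n) tvec \<Rightarrow> real ^ 'k" where "df \<equiv> differential A f"
abbreviation \<nu> :: "'m \<Rightarrow> (real ^ 'k) \<Rightarrow>\<^sub>L real" where "\<nu> \<equiv> conormal A f \<xi>"
abbreviation T :: "'m \<Rightarrow> ('m, 'n) tvec set" where "T \<equiv> tangent_space A"
definition imT :: "'m \<Rightarrow> (real ^ 'k) set" where "imT p = df p ` T p"
abbreviation frame :: "('m, 'n) chart \<Rightarrow> 'n \<Rightarrow> 'm \<Rightarrow> real ^ 'k" where
  "frame c i p \<equiv> df p (coord_vec A c i p)"

lemma smooth_f: "smooth_map_on A UNIV f" and smooth_xi: "smooth_map_on A UNIV \<xi>"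
  and inj_df: "inj_on (df p) (T p)" and transversal: "imT p \<inter> span {\<xi> p} = {0}"
  using immersion by (auto simp: affine_immersion_def imT_def)

lemma imT_I: "u \<in> T p \<Longrightarrow> df p u \<in> imT p"
  by (simp add: imT_def)

lemma linear_df: "linear (df p)"
  using linear_differential[OF smooth_f] by simp

lemma subspace_imT: "subspace (imT p)"
  unfolding imT_def by (rule linear_subspace_image[OF linear_df subspace_tangent_space])

lemma decompose: obtains u r where "u \<in> T p" "x = df p u + r *\<^sub>R \<xi> p"
proof -
  have "\<exists>u\<in>T p. \<exists>y\<in>span {\<xi> p}. x = df p u + y"
    using immersion by (auto simp: affine_immersion_def)
  then show ?thesis using that by (auto simp: span_singleton)
qed

text \<open>A vanishing \<open>\<xi> p\<close> would let the \<open>n\<close>-dimensional tangent space surject onto the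
  \<open>n + 1\<close>-dimensional ambient space.\<close>

lemma xi_notin: "\<xi> p \<notin> imT p"
proof
  assume "\<xi> p \<in> imT p"
  then have "\<xi> p \<in> imT p \<inter> span {\<xi> p}" by (simp add: span_base)
  then have xi0: "\<xi> p = 0" using transversal by blast
  obtain c where c: "c \<in> A" "p \<in> fst c" by (rule chart_at)
  have "x \<in> range (df p \<circ> tangent_lift c p)" for x
  proof -
    obtain u r where "u \<in> T p" "x = df p u + r *\<^sub>R \<xi> p" by (rule decompose)
    then have "x = (df p \<circ> tangent_lift c p) (u c)" using xi0 c by (simp add: tangent_lift_coord)
    then show ?thesis by blast
  qed
  then have "dim (UNIV :: (real ^ 'k) set) = dim (range (df p \<circ> tangent_lift c p))"
    by (metis UNIV_eq_I)
  also have "\<dots> \<le> dim (UNIV :: (real ^ 'n) set)"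
    by (rule dim_image_le[OF linear_compose[OF linear_tangent_lift[OF c] linear_df]])
  finally show False using codim by simp
qed

lemma frame_coord:
  assumes "c \<in> A" "p \<in> fst c"
  shows "(\<Sum>i\<in>UNIV. x i *\<^sub>R frame c i p) = df p (tangent_lift c p (\<chi> i. x i))"
proof -
  have "(\<Sum>i\<in>UNIV. x i *\<^sub>R frame c i p) = df p (\<Sum>i\<in>UNIV. x i *\<^sub>R coord_vec A c i p)"
    using linear_df by (simp add: linear_sum linear_scale)
  then show ?thesis using assms by (simp add: sum_coord_vec)
qed

lemma frame_mem: "c \<in> A \<Longrightarrow> p \<in> fst c \<Longrightarrow> frame c i p \<in> imT p"
  by (simp add: coord_vec_eq tangent_lift_mem imT_I)

lemma frame_independent:
  assumes "c \<in> A" "p \<in> fst c" "(\<Sum>i\<in>UNIV. x i *\<^sub>R frame c i p) = 0"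
  shows "x i = 0"
proof -
  have "df p (tangent_lift c p (\<chi> i. x i)) = df p 0"
    using assms linear_df by (simp add: frame_coord linear_0)
  then have "tangent_lift c p (\<chi> i. x i) = 0"
    using assms inj_onD[OF inj_df] tangent_lift_mem subspace_0[OF subspace_tangent_space] by blast
  then have "(\<chi> i. x i) = 0" using tangent_lift_self[OF assms(1,2)] by (metis zero_fun_apply)
  then show ?thesis by (simp add: vec_eq_iff)
qed

lemma frame_rep:
  assumes "c \<in> A" "p \<in> fst c" "x \<in> imT p"
  obtains k where "x = (\<Sum>i\<in>UNIV. k i *\<^sub>R frame c i p)"
proof -
  obtain u where u: "u \<in> T p" "x = df p u" using assms by (auto simp: imT_def)
  then have "x = (\<Sum>i\<in>UNIV. (u c $ i) *\<^sub>R frame c i p)"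
    using assms by (simp add: frame_coord tangent_lift_coord)
  then show ?thesis by (rule that)
qed

lemma basis_imT: "c \<in> A \<Longrightarrow> p \<in> fst c \<Longrightarrow> basis_of (imT p) UNIV (\<lambda>i. frame c i p)"
  by (rule basis_ofI) (auto intro: frame_independent subspace_imT frame_mem elim: frame_rep)

lemma smooth_frame: "c \<in> A \<Longrightarrow> smooth_map_on A (fst c) (frame c i)"
  by (rule smooth_map_on_differential[OF section_on_coord_vec])
    (auto intro: open_chart smooth_map_on_subset[OF smooth_f])

text \<open>Completing a tangent frame by \<open>\<xi>\<close>, one member of the dual frame is the conormal, and the
  others restrict to a frame of the dual of the tangent space.\<close>

lemma adapted_dual_frame:
  assumes c: "c \<in> A"
  obtains \<tau> :: "'n \<Rightarrow> 'm \<Rightarrow> (real ^ 'k) \<Rightarrow>\<^sub>L real"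
    and n :: "'m \<Rightarrow> (real ^ 'k) \<Rightarrow>\<^sub>L real" where
    "\<And>i. smooth_map_on A (fst c) (\<tau> i)" "smooth_map_on A (fst c) n"
    "\<And>i j p. p \<in> fst c \<Longrightarrow> blinfun_apply (\<tau> i p) (frame c j p) = (if i = j then 1 else 0)"
    "\<And>i p. p \<in> fst c \<Longrightarrow> blinfun_apply (\<tau> i p) (\<xi> p) = 0"
    "\<And>j p. p \<in> fst c \<Longrightarrow> blinfun_apply (n p) (frame c j p) = 0"
    "\<And>p. p \<in> fst c \<Longrightarrow> blinfun_apply (n p) (\<xi> p) = 1"
proof -
  let ?v = "\<lambda>j p. case j of None \<Rightarrow> \<xi> p | Some i \<Rightarrow> frame c i p"
  have sumv: "(\<Sum>j\<in>UNIV. x j *\<^sub>R ?v j p) = x None *\<^sub>R \<xi> p + (\<Sum>i\<in>UNIV. x (Some i) *\<^sub>R frame c i p)" for x p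
    by (simp add: UNIV_option_conv sum.reindex)
  have sm: "smooth_map_on A (fst c) (?v j)" for j
    by (cases j) (auto intro: smooth_frame[OF c] smooth_map_on_subset[OF smooth_xi])
  have ind: "x j = 0" if p: "p \<in> fst c" and 0: "(\<Sum>j\<in>UNIV. x j *\<^sub>R ?v j p) = 0" for p x j
  proof -
    let ?y = "\<Sum>i\<in>UNIV. x (Some i) *\<^sub>R frame c i p"
    have y: "?y \<in> imT p"
      by (intro subspace_sum subspace_scale subspace_imT frame_mem c p)
    have eq: "x None *\<^sub>R \<xi> p = - ?y" using 0 sumv[of x p] by (simp add: eq_neg_iff_add_eq_0)
    have None: "x None = 0"
    proof (rule ccontr)
      assume "x None \<noteq> 0"
      then have "\<xi> p = inverse (x None) *\<^sub>R (- ?y)" by (simp flip: eq)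
      moreover have "inverse (x None) *\<^sub>R (- ?y) \<in> imT p"
        by (intro subspace_scale subspace_neg subspace_imT y)
      ultimately show False using xi_notin[of p] by metis
    qed
    with eq have "?y = 0" by simp
    then have "x (Some i) = 0" for i by (rule frame_independent[OF c p])
    then show ?thesis using None by (cases j) auto
  qed
  obtain D :: "'n option \<Rightarrow> 'm \<Rightarrow> (real ^ 'k) \<Rightarrow>\<^sub>L real" where
    D: "\<And>i. smooth_map_on A (fst c) (D i)"
    "\<And>i j p. p \<in> fst c \<Longrightarrow> blinfun_apply (D i p) (?v j p) = (if i = j then 1 else 0)"
    by (rule smooth_dual_frame[where v = "?v" and W = "fst c", OF open_chart[OF c] sm])
      (erule (1) ind, rule that)
  show ?thesis
  proof (rule that[of "\<lambda>i. D (Some i)" "D None"])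
    fix i j p assume p: "p \<in> fst c"
    show "blinfun_apply (D (Some i) p) (frame c j p) = (if i = j then 1 else 0)"
      using D(2)[OF p, of "Some i" "Some j"] by simp
    show "blinfun_apply (D (Some i) p) (\<xi> p) = 0"
      using D(2)[OF p, of "Some i" None] by simp
    show "blinfun_apply (D None p) (frame c j p) = 0"
      using D(2)[OF p, of None "Some j"] by simp
    show "blinfun_apply (D None p) (\<xi> p) = 1"
      using D(2)[OF p, of None None] by simp
  qed (rule D(1))+
qed

lemma conormal_eqI:
  assumes c: "c \<in> A" "p \<in> fst c" and n: "\<And>j. blinfun_apply n (frame c j p) = 0" "blinfun_apply n (\<xi> p) = 1"
  shows "\<nu> p = n" and "x \<in> imT p \<Longrightarrow> blinfun_apply n x = 0"
proof -
  show im: "blinfun_apply n x = 0" if "x \<in> imT p" for x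
    using frame_rep[OF c that] n(1) by (metis (no_types, lifting) blinfun.sum_right
        blinfun.scaleR_right scale_eq_0_iff sum.not_neutral_contains_not_neutral)
  show "\<nu> p = n"
    unfolding conormal_def
  proof (rule the_equality)
    show "(\<forall>u\<in>T p. blinfun_apply n (df p u) = 0) \<and> blinfun_apply n (\<xi> p) = 1"
      using im n by (simp add: imT_I)
    fix m :: "(real ^ 'k) \<Rightarrow>\<^sub>L real" assume m: "(\<forall>u\<in>T p. blinfun_apply m (df p u) = 0) \<and> blinfun_apply m (\<xi> p) = 1"
    show "m = n"
    proof (rule blinfun_eqI)
      fix x
      obtain u r where "u \<in> T p" "x = df p u + r *\<^sub>R \<xi> p" by (rule decompose)
      then show "blinfun_apply m x = blinfun_apply n x"
        using m im n(2) by (simp add: blinfun.add_right blinfun.scaleR_right imT_I)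
    qed
  qed
qed

lemma conormal_tangent: "x \<in> imT p \<Longrightarrow> blinfun_apply (\<nu> p) x = 0"
  and conormal_xi: "blinfun_apply (\<nu> p) (\<xi> p) = 1"
proof -
  obtain c where c: "c \<in> A" "p \<in> fst c" by (rule chart_at)
  obtain n :: "'m \<Rightarrow> (real ^ 'k) \<Rightarrow>\<^sub>L real" where n: "\<And>j. blinfun_apply (n p) (frame c j p) = 0" "blinfun_apply (n p) (\<xi> p) = 1"
    using adapted_dual_frame[OF c(1)] c(2) by metis
  from conormal_eqI[OF c n] n
  show "x \<in> imT p \<Longrightarrow> blinfun_apply (\<nu> p) x = 0" "blinfun_apply (\<nu> p) (\<xi> p) = 1" by auto
qed

lemma smooth_conormal: "smooth_map_on A UNIV \<nu>"
proof (rule smooth_map_on_local)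
  fix p
  obtain c where c: "c \<in> A" "p \<in> fst c" by (rule chart_at)
  obtain n :: "'m \<Rightarrow> (real ^ 'k) \<Rightarrow>\<^sub>L real" where n: "smooth_map_on A (fst c) n"
    "\<And>j p. p \<in> fst c \<Longrightarrow> blinfun_apply (n p) (frame c j p) = 0"
    "\<And>p. p \<in> fst c \<Longrightarrow> blinfun_apply (n p) (\<xi> p) = 1"
    using adapted_dual_frame[OF c(1)] by metis
  have "smooth_map_on A (fst c) \<nu>"
    by (rule smooth_map_on_cong[OF open_chart[OF c(1)] _ n(1)])
      (use conormal_eqI(1)[OF c(1) _ n(2,3)] in auto)
  then show "\<exists>U. open U \<and> p \<in> U \<and> smooth_map_on A U \<nu>"
    using c open_chart by blast
qed

definition proj :: "'m \<Rightarrow> real ^ 'k \<Rightarrow> real ^ 'k" where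
  "proj p x = x - blinfun_apply (\<nu> p) x *\<^sub>R \<xi> p"

lemma proj_mem: "proj p x \<in> imT p"
proof -
  obtain u r where "u \<in> T p" "x = df p u + r *\<^sub>R \<xi> p" by (rule decompose)
  then have "proj p x = df p u"
    by (simp add: proj_def blinfun.add_right blinfun.scaleR_right conormal_tangent conormal_xi imT_I)
  then show ?thesis using \<open>u \<in> T p\<close> by (simp add: imT_I)
qed

lemma proj_tangent: "x \<in> imT p \<Longrightarrow> proj p x = x"
  by (simp add: proj_def conormal_tangent)

lemma linear_proj: "linear (proj p)"
  by (intro linearI) (simp_all add: proj_def blinfun.add_right blinfun.scaleR_right algebra_simps)

section \<open>Sections of the image bundle and of its dual\<close>

abbreviation imE where "imE \<equiv> image_bundle A f"
abbreviation duE where "duE \<equiv> dual_bundle imE"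

lemma fibre_imE: "fibre imE p = imT p"
  by (simp add: image_bundle_def imT_def)

lemma fibre_duE: "fibre duE p = dual_space (imT p)"
  by (simp add: dual_bundle_def fibre_imE)

lemma frames_imE: "(U, s) \<in> frames imE \<longleftrightarrow> (\<exists>c\<in>A. U = fst c \<and> s = frame c)"
  unfolding image_bundle_def tangent_bundle_def vbundle.simps by blast

text \<open>Conversely to the expansion in a frame, the smooth dual covectors of the frame recover the
  coefficients of a section as smooth functions.\<close>

lemma section_on_imE_iff:
  assumes W: "open W"
  shows "section_on A imE W \<eta> \<longleftrightarrow> (\<forall>p\<in>W. \<eta> p \<in> imT p) \<and> smooth_map_on A W \<eta>"
proof (intro iffI conjI ballI)
  assume L: "section_on A imE W \<eta>"
  show "\<eta> p \<in> imT p" if "p \<in> W" for p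
    using L that by (simp add: section_on_def fibre_imE)
  show "smooth_map_on A W \<eta>"
  proof (rule smooth_map_on_local)
    fix p assume p: "p \<in> W"
    obtain c where c: "c \<in> A" "p \<in> fst c" by (rule chart_at)
    obtain k where k: "\<And>i. smooth_map_on A (fst c \<inter> W) (k i)"
      "\<And>p. p \<in> fst c \<inter> W \<Longrightarrow> \<eta> p = (\<Sum>i\<in>UNIV. k i p *\<^sub>R frame c i p)"
      using section_on_frame[OF L, of "fst c" "frame c"] c frames_imE by blast
    have op: "open (fst c \<inter> W)" by (rule open_chart_Int[OF c(1) W])
    have "smooth_map_on A (fst c \<inter> W) (\<lambda>p. \<Sum>i\<in>UNIV. k i p *\<^sub>R frame c i p)"
      by (intro smooth_map_on_sum smooth_map_on_bilinear[OF bounded_bilinear_scaleR] op k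
          smooth_map_on_subset[OF smooth_frame[OF c(1)]]) auto
    then have "smooth_map_on A (fst c \<inter> W) \<eta>"
      by (rule smooth_map_on_cong[OF op, rotated]) (simp add: k(2))
    then show "\<exists>U. open U \<and> p \<in> U \<and> smooth_map_on A U \<eta>" using op c p by blast
  qed
next
  assume R: "(\<forall>p\<in>W. \<eta> p \<in> imT p) \<and> smooth_map_on A W \<eta>"
  have "\<exists>k. (\<forall>i. smooth_map_on A (fst c \<inter> W) (k i)) \<and>
      (\<forall>p\<in>fst c \<inter> W. \<eta> p = (\<Sum>i\<in>UNIV. k i p *\<^sub>R frame c i p))" if c: "c \<in> A" for c
  proof -
    obtain \<tau> :: "'n \<Rightarrow> 'm \<Rightarrow> (real ^ 'k) \<Rightarrow>\<^sub>L real" where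
      \<tau>: "\<And>i. smooth_map_on A (fst c) (\<tau> i)"
      "\<And>i j p. p \<in> fst c \<Longrightarrow> blinfun_apply (\<tau> i p) (frame c j p) = (if i = j then 1 else 0)"
      using adapted_dual_frame[OF c] by metis
    have "\<eta> p = (\<Sum>i\<in>UNIV. blinfun_apply (\<tau> i p) (\<eta> p) *\<^sub>R frame c i p)" if p: "p \<in> fst c \<inter> W" for p
    proof -
      obtain k where k: "\<eta> p = (\<Sum>i\<in>UNIV. k i *\<^sub>R frame c i p)"
        using frame_rep[of c p "\<eta> p"] R c p by blast
      have "blinfun_apply (\<tau> i p) (\<eta> p) = k i" for i
        using p by (simp add: k blinfun.sum_right blinfun.scaleR_right \<tau>(2) if_distrib cong: if_cong)
      then show ?thesis by (simp add: k)
    qed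
    moreover have "smooth_map_on A (fst c \<inter> W) (\<lambda>p. blinfun_apply (\<tau> i p) (\<eta> p))" for i
      by (rule smooth_map_on_bilinear[OF bounded_bilinear_blinfun_apply open_chart_Int[OF c W]])
        (use R in \<open>auto intro: smooth_map_on_subset \<tau>(1)\<close>)
    ultimately show ?thesis by (intro exI[of _ "\<lambda>i p. blinfun_apply (\<tau> i p) (\<eta> p)"]) auto
  qed
  then show "section_on A imE W \<eta>"
    using R unfolding section_on_def by (auto simp: frames_imE fibre_imE)
qed

text \<open>The covector extended by zero on \<open>\<xi>\<close>.\<close>

definition extend :: "'m \<Rightarrow> (real ^ 'k \<Rightarrow> real) \<Rightarrow> (real ^ 'k) \<Rightarrow>\<^sub>L real" where
  "extend p \<alpha> = Blinfun (\<lambda>x. \<alpha> (proj p x))"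

lemma extend_apply:
  assumes "\<alpha> \<in> dual_space (imT p)"
  shows "blinfun_apply (extend p \<alpha>) x = \<alpha> (proj p x)"
proof -
  have "\<alpha> (proj p x + proj p y) = \<alpha> (proj p x) + \<alpha> (proj p y)"
    "\<alpha> (r *\<^sub>R proj p x) = r *\<^sub>R \<alpha> (proj p x)" for r x y
    using assms proj_mem[of p] unfolding dual_space_def lin_on_def by blast+
  then have "linear (\<lambda>x. \<alpha> (proj p x))"
    by (intro linearI) (simp_all add: linear_add[OF linear_proj] linear_scale[OF linear_proj])
  then show ?thesis
    unfolding extend_def by (simp add: bounded_linear_Blinfun_apply linear_conv_bounded_linear)
qed

lemma extend_tangent:
  "\<alpha> \<in> dual_space (imT p) \<Longrightarrow> x \<in> imT p \<Longrightarrow> blinfun_apply (extend p \<alpha>) x = \<alpha> x"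
  by (simp add: extend_apply proj_tangent)

abbreviation restr :: "'m \<Rightarrow> (real ^ 'k) \<Rightarrow>\<^sub>L real \<Rightarrow> real ^ 'k \<Rightarrow> real" where
  "restr p \<equiv> restrict_functional (imT p)"

lemma restr_mem: "restr p \<alpha> \<in> dual_space (imT p)"
  by (rule restrict_functional_mem[OF subspace_imT])

lemma restr_extend:
  assumes "\<alpha> \<in> dual_space (imT p)" shows "restr p (extend p \<alpha>) = \<alpha>"
  using assms by (intro dual_space_eqI[OF restr_mem assms])
    (simp add: restrict_functional_def extend_tangent)

lemma extend_restr: "extend p (restr p \<alpha>) = \<alpha> - blinfun_apply \<alpha> (\<xi> p) *\<^sub>R \<nu> p"
proof (rule blinfun_eqI)
  fix x
  have "blinfun_apply (extend p (restr p \<alpha>)) x = blinfun_apply \<alpha> (proj p x)"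
    unfolding extend_apply[OF restr_mem] by (simp add: restrict_functional_def proj_mem)
  then show "blinfun_apply (extend p (restr p \<alpha>)) x
      = blinfun_apply (\<alpha> - blinfun_apply \<alpha> (\<xi> p) *\<^sub>R \<nu> p) x"
    by (simp add: proj_def blinfun.diff_right blinfun.diff_left blinfun.scaleR_left blinfun.scaleR_right)
qed

lemma extend_add:
  assumes "\<alpha> \<in> dual_space (imT p)" "\<beta> \<in> dual_space (imT p)"
  shows "extend p (\<alpha> + \<beta>) = extend p \<alpha> + extend p \<beta>"
  by (rule blinfun_eqI)
    (simp add: extend_apply assms subspace_add[OF subspace_dual_space] blinfun.add_left)

lemma extend_scaleR:
  assumes "\<alpha> \<in> dual_space (imT p)"
  shows "extend p (r *\<^sub>R \<alpha>) = r *\<^sub>R extend p \<alpha>"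
proof (rule blinfun_eqI)
  fix x
  have "blinfun_apply (extend p (r *\<^sub>R \<alpha>)) x = (r *\<^sub>R \<alpha>) (proj p x)"
    by (rule extend_apply[OF subspace_scale[OF subspace_dual_space assms]])
  then show "blinfun_apply (extend p (r *\<^sub>R \<alpha>)) x = blinfun_apply (r *\<^sub>R extend p \<alpha>) x"
    by (simp add: extend_apply[OF assms] blinfun.scaleR_left scaleR_fun_def)
qed

lemma extend_sum:
  assumes "\<And>i. i \<in> J \<Longrightarrow> \<alpha> i \<in> dual_space (imT p)"
  shows "extend p (\<Sum>i\<in>J. k i *\<^sub>R \<alpha> i) = (\<Sum>i\<in>J. k i *\<^sub>R extend p (\<alpha> i))"
proof -
  have "(\<Sum>i\<in>J. k i *\<^sub>R \<alpha> i) \<in> dual_space (imT p)"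
    by (intro subspace_sum subspace_scale subspace_dual_space assms)
  then show ?thesis
    by (intro blinfun_eqI)
      (simp add: extend_apply assms blinfun.sum_left blinfun.scaleR_left sum_fun_eval scaleR_fun_def)
qed

lemma frames_duE:
  "(U, t) \<in> frames duE \<longleftrightarrow> (\<exists>c\<in>A. U = fst c \<and> (\<forall>p\<in>fst c. \<forall>i. t i p \<in> dual_space (imT p) \<and>
     (\<forall>j. t i p (frame c j p) = (if i = j then 1 else 0))))"
  by (auto simp: dual_bundle_def frames_imE fibre_imE)

lemma dual_frame_rep:
  assumes c: "c \<in> A" "p \<in> fst c" and t: "\<And>i. t i \<in> dual_space (imT p)"
    "\<And>i j. t i (frame c j p) = (if i = j then 1 else 0)" and a: "\<alpha> \<in> dual_space (imT p)"
  shows "\<alpha> = (\<Sum>i\<in>UNIV. \<alpha> (frame c i p) *\<^sub>R t i)"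
proof (rule dual_space_eqI[OF a])
  show mem: "(\<Sum>i\<in>UNIV. \<alpha> (frame c i p) *\<^sub>R t i) \<in> dual_space (imT p)"
    by (intro subspace_sum subspace_scale subspace_dual_space t)
  fix x assume "x \<in> imT p"
  then obtain k where k: "x = (\<Sum>i\<in>UNIV. k i *\<^sub>R frame c i p)"
    by (rule frame_rep[OF c])
  have lin: "\<beta> x = (\<Sum>i\<in>UNIV. k i *\<^sub>R \<beta> (frame c i p))" if "\<beta> \<in> dual_space (imT p)" for \<beta> :: "real ^ 'k \<Rightarrow> real"
    unfolding k by (rule lin_on_sum[OF _ subspace_imT]) (use that c in \<open>auto simp: dual_space_def intro: frame_mem\<close>)
  show "\<alpha> x = (\<Sum>i\<in>UNIV. \<alpha> (frame c i p) *\<^sub>R t i) x"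
    unfolding lin[OF a] lin[OF mem]
    by (simp add: sum_fun_eval scaleR_fun_def t(2) if_distrib cong: if_cong)
qed

lemma basis_duE:
  assumes c: "c \<in> A" "p \<in> fst c" and t: "\<And>i. t i \<in> dual_space (imT p)"
    "\<And>i j. t i (frame c j p) = (if i = j then 1 else 0)"
  shows "basis_of (dual_space (imT p)) UNIV t"
proof (rule basis_ofI[OF _ subspace_dual_space t(1)])
  fix x i assume "(\<Sum>i\<in>UNIV. x i *\<^sub>R t i) = 0"
  then have "(\<Sum>i\<in>UNIV. x i *\<^sub>R t i) (frame c i p) = 0" by simp
  then show "x i = 0"
    by (simp add: sum_fun_eval scaleR_fun_def t(2) if_distrib cong: if_cong)
next
  fix \<alpha> assume "\<alpha> \<in> dual_space (imT p)"
  from dual_frame_rep[OF c t this]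
  show "\<exists>x. \<alpha> = (\<Sum>i\<in>UNIV. x i *\<^sub>R t i)" by (intro exI[of _ "\<lambda>i. \<alpha> (frame c i p)"])
qed

lemma dual_frame_exists:
  assumes c: "c \<in> A"
  obtains \<tau> :: "'n \<Rightarrow> 'm \<Rightarrow> (real ^ 'k) \<Rightarrow>\<^sub>L real" where
    "\<And>i. smooth_map_on A (fst c) (\<tau> i)" "(fst c, \<lambda>i p. restr p (\<tau> i p)) \<in> frames duE"
    "\<And>i p. p \<in> fst c \<Longrightarrow> extend p (restr p (\<tau> i p)) = \<tau> i p"
    "\<And>i j p. p \<in> fst c \<Longrightarrow> restr p (\<tau> i p) (frame c j p) = (if i = j then 1 else 0)"
proof -
  obtain \<tau> :: "'n \<Rightarrow> 'm \<Rightarrow> (real ^ 'k) \<Rightarrow>\<^sub>L real" where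
    \<tau>: "\<And>i. smooth_map_on A (fst c) (\<tau> i)"
    "\<And>i j p. p \<in> fst c \<Longrightarrow> blinfun_apply (\<tau> i p) (frame c j p) = (if i = j then 1 else 0)"
    "\<And>i p. p \<in> fst c \<Longrightarrow> blinfun_apply (\<tau> i p) (\<xi> p) = 0"
    using adapted_dual_frame[OF c] by metis
  have dual: "restr p (\<tau> i p) (frame c j p) = (if i = j then 1 else 0)" if "p \<in> fst c" for i j p
    unfolding restrict_functional_def using \<tau>(2)[OF that] frame_mem[OF c that] by simp
  show ?thesis
  proof (rule that[OF \<tau>(1) _ _ dual])
    show "(fst c, \<lambda>i p. restr p (\<tau> i p)) \<in> frames duE"
      unfolding frames_duE
      by (intro bexI[OF _ c] conjI ballI allI refl restr_mem dual)
  qed (simp_all add: extend_restr \<tau>(3))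
qed

text \<open>Extending covectors by zero on \<open>\<xi>\<close> turns sections of the dual bundle into smooth maps to a
  fixed vector space, where they can be differentiated directly.\<close>

lemma section_on_duE_iff:
  assumes W: "open W"
  shows "section_on A duE W \<zeta> \<longleftrightarrow>
    (\<forall>p\<in>W. \<zeta> p \<in> dual_space (imT p)) \<and> smooth_map_on A W (\<lambda>p. extend p (\<zeta> p))"
proof (intro iffI conjI ballI)
  assume L: "section_on A duE W \<zeta>"
  show "\<zeta> p \<in> dual_space (imT p)" if "p \<in> W" for p
    using L that by (simp add: section_on_def fibre_duE)
  show "smooth_map_on A W (\<lambda>p. extend p (\<zeta> p))"
  proof (rule smooth_map_on_local)
    fix p assume p: "p \<in> W"
    obtain c where c: "c \<in> A" "p \<in> fst c" by (rule chart_at)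
    obtain \<tau> :: "'n \<Rightarrow> 'm \<Rightarrow> (real ^ 'k) \<Rightarrow>\<^sub>L real" where
      \<tau>: "\<And>i. smooth_map_on A (fst c) (\<tau> i)" "(fst c, \<lambda>i p. restr p (\<tau> i p)) \<in> frames duE"
      "\<And>i p. p \<in> fst c \<Longrightarrow> extend p (restr p (\<tau> i p)) = \<tau> i p"
      by (rule dual_frame_exists[OF c(1)]) (rule that)
    obtain k where k: "\<And>i. smooth_map_on A (fst c \<inter> W) (k i)"
      "\<And>p. p \<in> fst c \<inter> W \<Longrightarrow> \<zeta> p = (\<Sum>i\<in>UNIV. k i p *\<^sub>R restr p (\<tau> i p))"
      using section_on_frame[OF L \<tau>(2)] by blast
    have op: "open (fst c \<inter> W)" by (rule open_chart_Int[OF c(1) W])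
    have "smooth_map_on A (fst c \<inter> W) (\<lambda>p. \<Sum>i\<in>UNIV. k i p *\<^sub>R \<tau> i p)"
      by (intro smooth_map_on_sum smooth_map_on_bilinear[OF bounded_bilinear_scaleR] op k
          smooth_map_on_subset[OF \<tau>(1)]) auto
    then have "smooth_map_on A (fst c \<inter> W) (\<lambda>p. extend p (\<zeta> p))"
      by (rule smooth_map_on_cong[OF op, rotated]) (simp add: k(2) extend_sum restr_mem \<tau>(3))
    then show "\<exists>U. open U \<and> p \<in> U \<and> smooth_map_on A U (\<lambda>p. extend p (\<zeta> p))" using op c p by blast
  qed
next
  assume R: "(\<forall>p\<in>W. \<zeta> p \<in> dual_space (imT p)) \<and> smooth_map_on A W (\<lambda>p. extend p (\<zeta> p))"
  have "\<exists>k. (\<forall>i. smooth_map_on A (U \<inter> W) (k i)) \<and>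
      (\<forall>p\<in>U \<inter> W. \<zeta> p = (\<Sum>i\<in>UNIV. k i p *\<^sub>R t i p))" if "(U, t) \<in> frames duE" for U t
  proof -
    from that obtain c where c: "c \<in> A" and U: "U = fst c" and
      t: "\<And>p i. p \<in> fst c \<Longrightarrow> t i p \<in> dual_space (imT p)"
      "\<And>p i j. p \<in> fst c \<Longrightarrow> t i p (frame c j p) = (if i = j then 1 else 0)"
      unfolding frames_duE by blast
    have op: "open (fst c \<inter> W)" by (rule open_chart_Int[OF c W])
    have "smooth_map_on A (fst c \<inter> W) (\<lambda>p. blinfun_apply (extend p (\<zeta> p)) (frame c i p))" for i
      using R
      by (intro smooth_map_on_bilinear[OF bounded_bilinear_blinfun_apply op])
        (auto intro: smooth_map_on_subset smooth_map_on_subset[OF smooth_frame[OF c]])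
    then have "smooth_map_on A (fst c \<inter> W) (\<lambda>p. \<zeta> p (frame c i p))" for i
      by (rule smooth_map_on_cong[OF op, rotated]) (use R c in \<open>simp add: extend_tangent frame_mem\<close>)
    then show ?thesis
      unfolding U
    proof (intro exI[of _ "\<lambda>i p. \<zeta> p (frame c i p)"] conjI allI ballI)
      fix p assume p: "p \<in> fst c \<inter> W"
      show "\<zeta> p = (\<Sum>i\<in>UNIV. \<zeta> p (frame c i p) *\<^sub>R t i p)"
        by (rule dual_frame_rep[OF c _ t]) (use R p in auto)
    qed
  qed
  then show "section_on A duE W \<zeta>"
    using R unfolding section_on_def by (auto simp: fibre_duE)
qed

end

section \<open>The induced connections\<close>

context affine_immersed
begin

lemma sections_imE_iff: "\<eta> \<in> sections A imE \<longleftrightarrow> (\<forall>p. \<eta> p \<in> imT p) \<and> smooth_map_on A UNIV \<eta>"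
  by (simp add: sections_def section_on_imE_iff)

lemma sections_duE_iff:
  "\<zeta> \<in> sections A duE \<longleftrightarrow>
    (\<forall>p. \<zeta> p \<in> dual_space (imT p)) \<and> smooth_map_on A UNIV (\<lambda>p. extend p (\<zeta> p))"
  by (simp add: sections_def section_on_duE_iff)

lemma push_forward_section: "X \<in> vector_fields A \<Longrightarrow> (\<lambda>q. df q (X q)) \<in> sections A imE"
  unfolding sections_imE_iff
  by (auto intro: imT_I vector_fieldD smooth_map_on_differential smooth_f)

lemma differential_decompose:
  obtains w where "w \<in> T p" "df p w = proj p x" "x = df p w + blinfun_apply (\<nu> p) x *\<^sub>R \<xi> p"
  using proj_mem[of p x] by (auto simp: imT_def proj_def)

lemma decomposition_unique: "w \<in> T p \<Longrightarrow> x = df p w + r *\<^sub>R \<xi> p \<Longrightarrow> r = blinfun_apply (\<nu> p) x \<and> df p w = proj p x"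
  by (simp add: proj_def blinfun.add_right blinfun.scaleR_right conormal_tangent imT_I conormal_xi)

text \<open>The flat derivative projected along \<open>\<xi>\<close>; the form of \<open>\<nabla>\<^sup>+\<close> that needs no vector field to
  be recovered from the section.\<close>

lemma conn_plus_eq:
  assumes "\<And>q. \<eta> q \<in> imT q"
  shows "conn_plus A f \<xi> X \<eta> p = proj p (differential A \<eta> p (X p))"
proof -
  define Y where "Y = (\<lambda>q. THE v. v \<in> T q \<and> df q v = \<eta> q)"
  have "df q (Y q) = \<eta> q" for q
  proof -
    have "\<exists>!v. v \<in> T q \<and> df q v = \<eta> q"
      using assms[of q] inj_onD[OF inj_df[of q]] by (auto simp: imT_def)
    from theI'[OF this] show ?thesis by (simp add: Y_def)
  qed
  then have Y: "(\<lambda>q. df q (Y q)) = \<eta>" by auto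
  let ?x = "differential A \<eta> p (X p)"
  obtain w where w: "w \<in> T p" "df p w = proj p ?x" "?x = df p w + blinfun_apply (\<nu> p) ?x *\<^sub>R \<xi> p"
    by (rule differential_decompose)
  have "induced_connection A f \<xi> X Y p = w"
    unfolding induced_connection_def Y
  proof (rule the_equality)
    show "w \<in> T p \<and> (\<exists>c. ?x = df p w + c *\<^sub>R \<xi> p)" using w by blast
    fix w' assume w': "w' \<in> T p \<and> (\<exists>c. ?x = df p w' + c *\<^sub>R \<xi> p)"
    then have "df p w' = proj p ?x" using decomposition_unique by blast
    then show "w' = w" using w w' inj_onD[OF inj_df[of p]] by metis
  qed
  then show ?thesis by (simp add: conn_plus_def Y_def[symmetric] w(2))
qed

text \<open>The product rule for the evaluation of extended covectors, split into the two terms that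
  duality assigns to \<open>\<nabla>\<^sup>+\<close> and \<open>\<nabla>\<^sup>-\<close>.\<close>

lemma pairing_derivative:
  assumes \<eta>: "\<eta> \<in> sections A imE" and \<zeta>: "\<zeta> \<in> sections A duE"
  shows "differential A (\<lambda>q. \<zeta> q (\<eta> q)) p u
    = \<zeta> p (proj p (differential A \<eta> p u))
      + restr p (differential A (\<lambda>q. extend q (\<zeta> q)) p u) (\<eta> p)"
proof -
  have "(\<lambda>q. \<zeta> q (\<eta> q)) = (\<lambda>q. blinfun_apply (extend q (\<zeta> q)) (\<eta> q))"
    using \<eta> \<zeta> by (auto simp: sections_imE_iff sections_duE_iff extend_tangent)
  then have "differential A (\<lambda>q. \<zeta> q (\<eta> q)) p u
      = differential A (\<lambda>q. blinfun_apply (extend q (\<zeta> q)) (\<eta> q)) p u" by simp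
  also have "\<dots> = blinfun_apply (extend p (\<zeta> p)) (differential A \<eta> p u)
      + blinfun_apply (differential A (\<lambda>q. extend q (\<zeta> q)) p u) (\<eta> p)"
    by (rule differential_bilinear[OF bounded_bilinear_blinfun_apply])
      (use \<eta> \<zeta> in \<open>auto simp: sections_imE_iff sections_duE_iff\<close>)
  also have "blinfun_apply (extend p (\<zeta> p)) (differential A \<eta> p u) = \<zeta> p (proj p (differential A \<eta> p u))"
    using \<zeta> by (simp add: sections_duE_iff extend_apply)
  finally show ?thesis using \<eta> by (simp add: sections_imE_iff restrict_functional_def)
qed

lemma ind_theta_pair: "ind_theta q (a, 0) (0, \<alpha>) = 1 / 2 * \<alpha> a"
  by (simp add: ind_theta_def)

lemma differential_half: "smooth_map_on A UNIV g \<Longrightarrow>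
    differential A (\<lambda>q. 1 / 2 * g q) p u = 1 / 2 * differential A g p u" for g :: "'m \<Rightarrow> real"
  by (rule differential_linear[OF bounded_linear_mult_right]) auto

lemma smooth_pairing:
  assumes "\<eta> \<in> sections A imE" "\<zeta> \<in> sections A duE"
  shows "smooth_map_on A UNIV (\<lambda>q. \<zeta> q (\<eta> q))"
proof -
  have "(\<lambda>q. \<zeta> q (\<eta> q)) = (\<lambda>q. blinfun_apply (extend q (\<zeta> q)) (\<eta> q))"
    using assms by (auto simp: sections_imE_iff sections_duE_iff extend_tangent)
  then show ?thesis
    using assms by (auto simp: sections_imE_iff sections_duE_iff
        intro: smooth_map_on_bilinear[OF bounded_bilinear_blinfun_apply])
qed

text \<open>The dual connection is the flat derivative of the extended covector field, restricted back to
  the tangent spaces.  Uniqueness needs a global section through every tangent vector.\<close>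

lemma conn_minus_eq:
  assumes X: "X \<in> vector_fields A" and \<zeta>: "\<zeta> \<in> sections A duE"
  shows "conn_minus A f \<xi> X \<zeta> p = restr p (differential A (\<lambda>q. extend q (\<zeta> q)) p (X p))"
    (is "_ = ?r")
proof -
  have iff: "differential A (\<lambda>q. ind_theta q (\<eta> q, 0) (0, \<zeta> q)) p (X p)
      = ind_theta p (conn_plus A f \<xi> X \<eta> p, 0) (0, \<zeta> p) + ind_theta p (\<eta> p, 0) (0, \<alpha>)
    \<longleftrightarrow> \<alpha> (\<eta> p) = ?r (\<eta> p)" if \<eta>: "\<eta> \<in> sections A imE" for \<eta> \<alpha>
  proof -
    have "conn_plus A f \<xi> X \<eta> p = proj p (differential A \<eta> p (X p))"
      using \<eta> by (intro conn_plus_eq) (simp add: sections_imE_iff)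
    then show ?thesis
      unfolding ind_theta_pair
      by (subst differential_half[OF smooth_pairing[OF \<eta> \<zeta>]]) (auto simp: pairing_derivative[OF \<eta> \<zeta>])
  qed
  show ?thesis
    unfolding conn_minus_def fibre_duE
  proof (rule the_equality)
    show "?r \<in> dual_space (imT p) \<and> (\<forall>\<eta>\<in>sections A imE.
        differential A (\<lambda>q. ind_theta q (\<eta> q, 0) (0, \<zeta> q)) p (X p)
          = ind_theta p (conn_plus A f \<xi> X \<eta> p, 0) (0, \<zeta> p) + ind_theta p (\<eta> p, 0) (0, ?r))"
      by (simp add: restr_mem iff)
    fix \<alpha> assume \<alpha>: "\<alpha> \<in> dual_space (imT p) \<and> (\<forall>\<eta>\<in>sections A imE.
        differential A (\<lambda>q. ind_theta q (\<eta> q, 0) (0, \<zeta> q)) p (X p)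
          = ind_theta p (conn_plus A f \<xi> X \<eta> p, 0) (0, \<zeta> p) + ind_theta p (\<eta> p, 0) (0, \<alpha>))"
    show "\<alpha> = ?r"
    proof (rule dual_space_eqI[OF _ restr_mem])
      fix x assume "x \<in> imT p"
      then obtain u where u: "u \<in> T p" "x = df p u" by (auto simp: imT_def)
      obtain Y where Y: "Y \<in> vector_fields A" "Y p = u" by (rule vector_field_through[OF u(1)])
      have "\<alpha> (df p (Y p)) = ?r (df p (Y p))"
        using bspec[OF conjunct2[OF \<alpha>] push_forward_section[OF Y(1)]]
        unfolding iff[OF push_forward_section[OF Y(1)]] .
      then show "\<alpha> x = ?r x" by (simp add: u Y)
    qed (use \<alpha> in blast)
  qed
qed

lemma smooth_proj: "smooth_map_on A UNIV g \<Longrightarrow> smooth_map_on A UNIV (\<lambda>p. proj p (g p))"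
  unfolding proj_def
  by (intro smooth_map_on_diff smooth_map_on_bilinear[OF bounded_bilinear_scaleR] smooth_xi open_UNIV
      smooth_map_on_bilinear[OF bounded_bilinear_blinfun_apply] smooth_conormal)

lemma smooth_extend_restr:
  "smooth_map_on A UNIV g \<Longrightarrow> smooth_map_on A UNIV (\<lambda>p. extend p (restr p (g p)))"
  unfolding extend_restr
  by (intro smooth_map_on_diff smooth_map_on_bilinear[OF bounded_bilinear_scaleR] smooth_xi open_UNIV
      smooth_map_on_bilinear[OF bounded_bilinear_blinfun_apply] smooth_conormal)

lemma smooth_derivative_along: "X \<in> vector_fields A \<Longrightarrow> smooth_map_on A UNIV g \<Longrightarrow>
    smooth_map_on A UNIV (\<lambda>p. differential A g p (X p))"
  by (rule smooth_map_on_differential) (auto intro: vector_fieldD)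

lemma linear_differential_UNIV: "smooth_map_on A UNIV g \<Longrightarrow> linear (differential A g p)"
  by (rule linear_differential) auto

text \<open>Both induced connections have the form: flat derivative of an associated vector-valued map,
  followed by a pointwise linear retraction onto the fibre.  The connection axioms are verified once
  for this pattern.\<close>

lemma connection_by_retraction:
  fixes emb :: "'m \<Rightarrow> 'e::real_vector \<Rightarrow> 'b::real_normed_vector" and ret :: "'m \<Rightarrow> 'b \<Rightarrow> 'e"
  assumes closed: "\<And>X \<eta>. X \<in> vector_fields A \<Longrightarrow> \<eta> \<in> G \<Longrightarrow> N X \<eta> \<in> G"
    and N: "\<And>X \<eta> p. X \<in> vector_fields A \<Longrightarrow> \<eta> \<in> G \<Longrightarrow>
      N X \<eta> p = ret p (differential A (\<lambda>q. emb q (\<eta> q)) p (X p))"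
    and smooth: "\<And>\<eta>. \<eta> \<in> G \<Longrightarrow> smooth_map_on A UNIV (\<lambda>q. emb q (\<eta> q))"
    and lin_ret: "\<And>p. linear (ret p)"
    and ret_emb: "\<And>\<eta> p. \<eta> \<in> G \<Longrightarrow> ret p (emb p (\<eta> p)) = \<eta> p"
    and add: "\<And>\<eta> \<zeta>. \<eta> \<in> G \<Longrightarrow> \<zeta> \<in> G \<Longrightarrow> (\<lambda>q. \<eta> q + \<zeta> q) \<in> G"
    and emb_add: "\<And>\<eta> \<zeta> p. \<eta> \<in> G \<Longrightarrow> \<zeta> \<in> G \<Longrightarrow> emb p (\<eta> p + \<zeta> p) = emb p (\<eta> p) + emb p (\<zeta> p)"
    and scale: "\<And>g \<eta>. smooth_map_on A UNIV g \<Longrightarrow> \<eta> \<in> G \<Longrightarrow> (\<lambda>q. g q *\<^sub>R \<eta> q) \<in> G"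
    and emb_scale: "\<And>r \<eta> p. \<eta> \<in> G \<Longrightarrow> emb p (r *\<^sub>R \<eta> p) = r *\<^sub>R emb p (\<eta> p)"
    and vf_add: "\<And>X Y. X \<in> vector_fields A \<Longrightarrow> Y \<in> vector_fields A \<Longrightarrow> (\<lambda>q. X q + Y q) \<in> vector_fields A"
    and vf_scale: "\<And>g X. smooth_map_on A UNIV g \<Longrightarrow> X \<in> vector_fields A \<Longrightarrow> (\<lambda>q. g q *\<^sub>R X q) \<in> vector_fields A"
  shows "connection A G N"
  unfolding connection_def
proof (intro conjI ballI allI impI)
  fix X \<eta> assume X: "X \<in> vector_fields A" and \<eta>: "\<eta> \<in> G"
  show "N X \<eta> \<in> G" by (rule closed[OF X \<eta>])
  note lin = linear_differential_UNIV[OF smooth[OF \<eta>]]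
  fix p
  { fix Y assume Y: "Y \<in> vector_fields A"
    show "N (\<lambda>q. X q + Y q) \<eta> p = N X \<eta> p + N Y \<eta> p"
      by (simp add: N X Y \<eta> vf_add linear_add[OF lin] linear_add[OF lin_ret]) }
  { fix g :: "'m \<Rightarrow> real" assume g: "smooth_map_on A UNIV g"
    show "N (\<lambda>q. g q *\<^sub>R X q) \<eta> p = g p *\<^sub>R N X \<eta> p"
      by (simp add: N X \<eta> g vf_scale linear_scale[OF lin] linear_scale[OF lin_ret])
    have "differential A (\<lambda>q. g q *\<^sub>R emb q (\<eta> q)) p (X p)
        = g p *\<^sub>R differential A (\<lambda>q. emb q (\<eta> q)) p (X p) + differential A g p (X p) *\<^sub>R emb p (\<eta> p)"
      by (rule differential_bilinear[OF bounded_bilinear_scaleR g smooth[OF \<eta>]]) auto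
    then show "N X (\<lambda>q. g q *\<^sub>R \<eta> q) p = differential A g p (X p) *\<^sub>R \<eta> p + g p *\<^sub>R N X \<eta> p"
      by (simp add: N X \<eta> g scale emb_scale linear_add[OF lin_ret] linear_scale[OF lin_ret] ret_emb) }
  { fix \<zeta> assume \<zeta>: "\<zeta> \<in> G"
    have "differential A (\<lambda>q. emb q (\<eta> q) + emb q (\<zeta> q)) p (X p)
        = differential A (\<lambda>q. emb q (\<eta> q)) p (X p) + differential A (\<lambda>q. emb q (\<zeta> q)) p (X p)"
      by (rule differential_add[OF smooth[OF \<eta>] smooth[OF \<zeta>]]) auto
    then show "N X (\<lambda>q. \<eta> q + \<zeta> q) p = N X \<eta> p + N X \<zeta> p"
      by (simp add: N X \<eta> \<zeta> add emb_add linear_add[OF lin_ret]) }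
qed

lemma vector_fields_add:
  assumes "X \<in> vector_fields A" "Y \<in> vector_fields A"
  shows "(\<lambda>q. X q + Y q) \<in> vector_fields A"
  unfolding sections_def mem_Collect_eq section_on_tangent_iff[OF open_UNIV]
  using assms subspace_add[OF subspace_tangent_space] vector_fieldD(1,2)
  by (auto intro!: smooth_map_on_add open_chart)

lemma vector_fields_scale:
  assumes "smooth_map_on A UNIV g" "X \<in> vector_fields A"
  shows "(\<lambda>q. g q *\<^sub>R X q) \<in> vector_fields A"
  unfolding sections_def mem_Collect_eq section_on_tangent_iff[OF open_UNIV]
  using assms subspace_scale[OF subspace_tangent_space] vector_fieldD(1,2)
  by (auto simp: scaleR_fun_def intro!: smooth_map_on_bilinear[OF bounded_bilinear_scaleR] open_chart
      intro: smooth_map_on_subset)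

section \<open>The second fundamental form\<close>

text \<open>Differentiating \<open>\<langle>\<nu>, f\<^sub>* Y\<rangle> = 0\<close>.\<close>

lemma conormal_second_derivative:
  assumes "Y \<in> vector_fields A"
  shows "blinfun_apply (\<nu> p) (differential A (\<lambda>q. df q (Y q)) p u)
    = - blinfun_apply (differential A \<nu> p u) (df p (Y p))"
proof -
  have "(\<lambda>q. blinfun_apply (\<nu> q) (df q (Y q))) = (\<lambda>q. 0)"
    using assms by (auto intro: conormal_tangent imT_I vector_fieldD)
  then have "0 = differential A (\<lambda>q. blinfun_apply (\<nu> q) (df q (Y q))) p u"
    by (simp add: differential_const)
  also have "\<dots> = blinfun_apply (\<nu> p) (differential A (\<lambda>q. df q (Y q)) p u)
      + blinfun_apply (differential A \<nu> p u) (df p (Y p))"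
    by (rule differential_bilinear[OF bounded_bilinear_blinfun_apply smooth_conormal])
      (auto intro: smooth_derivative_along assms smooth_f)
  finally show ?thesis by simp
qed

text \<open>The value depends on \<open>u\<close> and \<open>v\<close> alone, and fields through \<open>u\<close> and \<open>v\<close> exist, so the defining
  description has a unique solution.\<close>

lemma second_fundamental_form_eq:
  assumes u: "u \<in> T p" and v: "v \<in> T p"
  shows "second_fundamental_form A f \<xi> p u v = - blinfun_apply (differential A \<nu> p u) (df p v)"
  unfolding second_fundamental_form_def
proof (rule the_equality)
  let ?c = "- blinfun_apply (differential A \<nu> p u) (df p v)"
  show "\<forall>X\<in>vector_fields A. \<forall>Y\<in>vector_fields A. X p = u \<and> Y p = v \<longrightarrow>
      (\<exists>w\<in>T p. differential A (\<lambda>q. df q (Y q)) p (X p) = df p w + ?c *\<^sub>R \<xi> p)"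
  proof (intro ballI impI)
    fix X Y assume XY: "X \<in> vector_fields A" "Y \<in> vector_fields A" "X p = u \<and> Y p = v"
    obtain w where "w \<in> T p" "differential A (\<lambda>q. df q (Y q)) p (X p)
        = df p w + blinfun_apply (\<nu> p) (differential A (\<lambda>q. df q (Y q)) p (X p)) *\<^sub>R \<xi> p"
      by (rule differential_decompose)
    then show "\<exists>w\<in>T p. differential A (\<lambda>q. df q (Y q)) p (X p) = df p w + ?c *\<^sub>R \<xi> p"
      unfolding conormal_second_derivative[OF XY(2)] using XY(3) by auto
  qed
  fix r assume r: "\<forall>X\<in>vector_fields A. \<forall>Y\<in>vector_fields A. X p = u \<and> Y p = v \<longrightarrow>
      (\<exists>w\<in>T p. differential A (\<lambda>q. df q (Y q)) p (X p) = df p w + r *\<^sub>R \<xi> p)"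
  obtain X where X: "X \<in> vector_fields A" "X p = u" by (rule vector_field_through[OF u])
  obtain Y where Y: "Y \<in> vector_fields A" "Y p = v" by (rule vector_field_through[OF v])
  obtain w where "w \<in> T p" "differential A (\<lambda>q. df q (Y q)) p (X p) = df p w + r *\<^sub>R \<xi> p"
    using r X Y by blast
  then have "r = blinfun_apply (\<nu> p) (differential A (\<lambda>q. df q (Y q)) p (X p))"
    using decomposition_unique by blast
  then show "r = ?c" by (simp add: conormal_second_derivative[OF Y(1)] X Y)
qed

text \<open>The conormal annihilates \<open>D\<^sub>X (f\<^sub>* Y) - D\<^sub>Y (f\<^sub>* X) = f\<^sub>* [X, Y]\<close>.\<close>

lemma conormal_derivative_symmetric:
  assumes u: "u \<in> T p" and v: "v \<in> T p"
  shows "blinfun_apply (differential A \<nu> p u) (df p v) = blinfun_apply (differential A \<nu> p v) (df p u)"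
proof -
  obtain X where X: "X \<in> vector_fields A" "X p = u" by (rule vector_field_through[OF u])
  obtain Y where Y: "Y \<in> vector_fields A" "Y p = v" by (rule vector_field_through[OF v])
  have "blinfun_apply (\<nu> p) (differential A (\<lambda>q. df q (Y q)) p (X p)
      - differential A (\<lambda>q. df q (X q)) p (Y p)) = 0"
    unfolding differential_commutator[OF smooth_f X(1) Y(1)]
    by (intro conormal_tangent imT_I lie_bracket_mem X Y)
  then show ?thesis
    by (simp add: blinfun.diff_right conormal_second_derivative X Y)
qed

end

section \<open>The para-Hermitian bundle of an affine immersion\<close>

context affine_immersed
begin

abbreviation E where "E \<equiv> ind_bundle A f"

lemma fibre_E: "fibre E p = imT p \<times> dual_space (imT p)"
  by (simp add: ind_bundle_def sum_bundle_def fibre_imE fibre_duE)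

lemma frames_E: "(Z, s) \<in> frames E \<longleftrightarrow> (\<exists>U a V b. (U, a) \<in> frames imE \<and> (V, b) \<in> frames duE \<and>
    Z = U \<inter> V \<and> s = case_sum (\<lambda>i p. (a i p, 0)) (\<lambda>j p. (0, b j p)))"
  by (auto simp: ind_bundle_def sum_bundle_def)

lemma case_sum_apply: "case_sum (\<lambda>i p. F i p) (\<lambda>j p. G j p) l p = case_sum (\<lambda>i. F i p) (\<lambda>j. G j p) l"
  by (cases l) auto

text \<open>Around each point one chart supplies a frame of both summands over the same open set, so the
  components of a section are smooth there.\<close>

lemma section_on_E_iff:
  assumes W: "open W"
  shows "section_on A E W \<eta> \<longleftrightarrow>
    section_on A imE W (\<lambda>p. fst (\<eta> p)) \<and> section_on A duE W (\<lambda>p. snd (\<eta> p))"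
proof
  assume L: "section_on A E W \<eta>"
  have fib: "fst (\<eta> p) \<in> imT p" "snd (\<eta> p) \<in> dual_space (imT p)" if "p \<in> W" for p
    using L that by (auto simp: section_on_def fibre_E mem_Times_iff)
  have "\<exists>U. open U \<and> p \<in> U \<and> smooth_map_on A U (\<lambda>p. fst (\<eta> p))
      \<and> smooth_map_on A U (\<lambda>p. extend p (snd (\<eta> p)))" if p: "p \<in> W" for p
  proof -
    obtain c where c: "c \<in> A" "p \<in> fst c" by (rule chart_at)
    obtain \<tau> :: "'n \<Rightarrow> 'm \<Rightarrow> (real ^ 'k) \<Rightarrow>\<^sub>L real" where
      \<tau>: "\<And>i. smooth_map_on A (fst c) (\<tau> i)" "(fst c, \<lambda>i p. restr p (\<tau> i p)) \<in> frames duE"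
      "\<And>i p. p \<in> fst c \<Longrightarrow> extend p (restr p (\<tau> i p)) = \<tau> i p"
      by (rule dual_frame_exists[OF c(1)]) (rule that)
    let ?s = "case_sum (\<lambda>i p. (frame c i p, 0)) (\<lambda>j p. (0, restr p (\<tau> j p)))"
    have "(fst c \<inter> fst c, ?s) \<in> frames E"
      unfolding frames_E using \<tau>(2) c frames_imE by blast
    then have "(fst c, ?s) \<in> frames E" by simp
    from section_on_frame[OF L this] obtain k where
      k: "\<And>l. smooth_map_on A (fst c \<inter> W) (k l)"
      "\<And>p. p \<in> fst c \<inter> W \<Longrightarrow> \<eta> p = (\<Sum>l\<in>UNIV. k l p *\<^sub>R ?s l p)" by blast
    have rep: "\<eta> p = (\<Sum>i\<in>UNIV. k (Inl i) p *\<^sub>R frame c i p, \<Sum>j\<in>UNIV. k (Inr j) p *\<^sub>R restr p (\<tau> j p))"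
      if "p \<in> fst c \<inter> W" for p
      unfolding k(2)[OF that] case_sum_apply by (rule sum_direct_sum)
    have op: "open (fst c \<inter> W)" by (rule open_chart_Int[OF c(1) W])
    have "smooth_map_on A (fst c \<inter> W) (\<lambda>p. \<Sum>i\<in>UNIV. k (Inl i) p *\<^sub>R frame c i p)"
      by (intro smooth_map_on_sum smooth_map_on_bilinear[OF bounded_bilinear_scaleR] op k
          smooth_map_on_subset[OF smooth_frame[OF c(1)]]) auto
    then have 1: "smooth_map_on A (fst c \<inter> W) (\<lambda>p. fst (\<eta> p))"
      by (rule smooth_map_on_cong[OF op, rotated]) (simp add: rep)
    have "smooth_map_on A (fst c \<inter> W) (\<lambda>p. \<Sum>j\<in>UNIV. k (Inr j) p *\<^sub>R \<tau> j p)"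
      by (intro smooth_map_on_sum smooth_map_on_bilinear[OF bounded_bilinear_scaleR] op k
          smooth_map_on_subset[OF \<tau>(1)]) auto
    then have 2: "smooth_map_on A (fst c \<inter> W) (\<lambda>p. extend p (snd (\<eta> p)))"
      by (rule smooth_map_on_cong[OF op, rotated]) (simp add: rep extend_sum restr_mem \<tau>(3))
    show ?thesis using op c p 1 2 by blast
  qed
  note local = this
  have "smooth_map_on A W (\<lambda>p. fst (\<eta> p))"
    by (rule smooth_map_on_local) (use local in blast)
  moreover have "smooth_map_on A W (\<lambda>p. extend p (snd (\<eta> p)))"
    by (rule smooth_map_on_local) (use local in blast)
  ultimately show "section_on A imE W (\<lambda>p. fst (\<eta> p)) \<and> section_on A duE W (\<lambda>p. snd (\<eta> p))"
    using fib by (simp add: section_on_imE_iff section_on_duE_iff W)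
next
  assume R: "section_on A imE W (\<lambda>p. fst (\<eta> p)) \<and> section_on A duE W (\<lambda>p. snd (\<eta> p))"
  have "\<exists>k. (\<forall>l. smooth_map_on A (Z \<inter> W) (k l)) \<and> (\<forall>p\<in>Z \<inter> W. \<eta> p = (\<Sum>l\<in>UNIV. k l p *\<^sub>R s l p))"
    if "(Z, s) \<in> frames E" for Z s
  proof -
    from that obtain U a V b where ab: "(U, a) \<in> frames imE" "(V, b) \<in> frames duE" and Z: "Z = U \<inter> V"
      and s: "s = case_sum (\<lambda>i p. (a i p, 0)) (\<lambda>j p. (0, b j p))"
      unfolding frames_E by blast
    obtain x where x: "\<And>i. smooth_map_on A (U \<inter> W) (x i)"
      "\<And>p. p \<in> U \<inter> W \<Longrightarrow> fst (\<eta> p) = (\<Sum>i\<in>UNIV. x i p *\<^sub>R a i p)"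
      using section_on_frame[OF conjunct1[OF R] ab(1)] by blast
    obtain y where y: "\<And>i. smooth_map_on A (V \<inter> W) (y i)"
      "\<And>p. p \<in> V \<inter> W \<Longrightarrow> snd (\<eta> p) = (\<Sum>i\<in>UNIV. y i p *\<^sub>R b i p)"
      using section_on_frame[OF conjunct2[OF R] ab(2)] by blast
    show ?thesis
    proof (intro exI[of _ "case_sum x y"] conjI allI ballI)
      show "smooth_map_on A (Z \<inter> W) (case_sum x y l)" for l
        by (cases l) (auto simp: Z intro: smooth_map_on_subset[OF x(1)] smooth_map_on_subset[OF y(1)])
      fix p assume p: "p \<in> Z \<inter> W"
      have "(\<Sum>l\<in>UNIV. case_sum x y l p *\<^sub>R s l p)
          = (\<Sum>l\<in>UNIV. case_sum (\<lambda>i. x i p) (\<lambda>j. y j p) l *\<^sub>R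
              case_sum (\<lambda>i. (a i p, 0)) (\<lambda>j. (0, b j p)) l)"
        unfolding s by (simp add: case_sum_apply)
      also have "\<dots> = (\<Sum>i\<in>UNIV. x i p *\<^sub>R a i p, \<Sum>j\<in>UNIV. y j p *\<^sub>R b j p)"
        unfolding sum_direct_sum by simp
      also have "\<dots> = \<eta> p" using p x(2) y(2) by (simp add: Z prod_eq_iff)
      finally show "\<eta> p = (\<Sum>l\<in>UNIV. case_sum x y l p *\<^sub>R s l p)" ..
    qed
  qed
  moreover have "\<eta> p \<in> fibre E p" if "p \<in> W" for p
    using R that by (auto simp: section_on_imE_iff section_on_duE_iff W fibre_E mem_Times_iff)
  ultimately show "section_on A E W \<eta>" unfolding section_on_def by auto
qed

lemma section_imE_0: "section_on A imE W (\<lambda>p. 0)"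
proof (rule section_on_subset[OF _ subset_UNIV])
  show "section_on A imE UNIV (\<lambda>p. 0)"
    by (simp add: section_on_imE_iff subspace_0[OF subspace_imT] smooth_map_on_const)
qed

lemma extend_0: "extend p 0 = 0"
  by (rule blinfun_eqI) (simp add: extend_apply subspace_0[OF subspace_dual_space])

lemma section_duE_0: "section_on A duE W (\<lambda>p. 0)"
proof (rule section_on_subset[OF _ subset_UNIV])
  show "section_on A duE UNIV (\<lambda>p. 0)"
    by (simp add: section_on_duE_iff extend_0 subspace_0[OF subspace_dual_space] smooth_map_on_const)
qed

lemma section_frame: "c \<in> A \<Longrightarrow> section_on A imE (fst c) (frame c i)"
  by (simp add: section_on_imE_iff open_chart frame_mem smooth_frame)

lemma section_dual_frame:
  assumes "(V, t) \<in> frames duE" shows "section_on A duE V (t i)"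
proof -
  obtain c where c: "c \<in> A" and V: "V = fst c" and
    t: "\<And>p i. p \<in> fst c \<Longrightarrow> t i p \<in> dual_space (imT p)"
    "\<And>p i j. p \<in> fst c \<Longrightarrow> t i p (frame c j p) = (if i = j then 1 else 0)"
    using assms unfolding frames_duE by blast
  obtain \<tau> :: "'n \<Rightarrow> 'm \<Rightarrow> (real ^ 'k) \<Rightarrow>\<^sub>L real" where
    \<tau>: "\<And>i. smooth_map_on A (fst c) (\<tau> i)" "(fst c, \<lambda>i p. restr p (\<tau> i p)) \<in> frames duE"
    "\<And>i p. p \<in> fst c \<Longrightarrow> extend p (restr p (\<tau> i p)) = \<tau> i p"
    "\<And>i j p. p \<in> fst c \<Longrightarrow> restr p (\<tau> i p) (frame c j p) = (if i = j then 1 else 0)"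
    by (rule dual_frame_exists[OF c]) (rule that)
  have "t i p = restr p (\<tau> i p)" if p: "p \<in> fst c" for p
  proof -
    have "t i p = (\<Sum>j\<in>UNIV. t i p (frame c j p) *\<^sub>R restr p (\<tau> j p))"
      by (rule dual_frame_rep[OF c p restr_mem \<tau>(4)[OF p] t(1)[OF p]])
    also have "\<dots> = (\<Sum>j\<in>UNIV. if j = i then restr p (\<tau> j p) else 0)"
      by (rule sum.cong) (auto simp: t(2)[OF p])
    finally show ?thesis by simp
  qed
  then have "smooth_map_on A (fst c) (\<lambda>p. extend p (t i p))"
    by (intro smooth_map_on_cong[OF open_chart[OF c] _ \<tau>(1)[of i]]) (simp add: \<tau>(3))
  then show ?thesis using t(1) c by (simp add: V section_on_duE_iff open_chart)
qed

lemma basis_frames_imE: "(U, a) \<in> frames imE \<Longrightarrow> p \<in> U \<Longrightarrow> basis_of (imT p) UNIV (\<lambda>i. a i p)"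
  by (auto simp: frames_imE basis_imT)

lemma basis_frames_duE:
  assumes "(V, t) \<in> frames duE" "p \<in> V"
  shows "basis_of (dual_space (imT p)) UNIV (\<lambda>i. t i p)"
proof -
  obtain c where "c \<in> A" "V = fst c" and
    "\<And>p i. p \<in> fst c \<Longrightarrow> t i p \<in> dual_space (imT p)"
    "\<And>p i j. p \<in> fst c \<Longrightarrow> t i p (frame c j p) = (if i = j then 1 else 0)"
    using assms(1) unfolding frames_duE by blast
  then show ?thesis using assms(2) by (intro basis_duE[of c p "\<lambda>i. t i p"]) auto
qed

lemma adapted_frames_at:
  obtains c t where "c \<in> A" "p \<in> fst c" "(fst c, frame c) \<in> frames imE" "(fst c, t) \<in> frames duE"
proof -
  obtain c where c: "c \<in> A" "p \<in> fst c" by (rule chart_at)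
  obtain t where "(fst c, t) \<in> frames duE"
    by (rule dual_frame_exists[OF c(1)]) (rule that)
  then show ?thesis using that c frames_imE by blast
qed

lemma open_frames: "(U, a) \<in> frames imE \<Longrightarrow> open U" "(V, b) \<in> frames duE \<Longrightarrow> open V"
  unfolding frames_imE frames_duE using open_chart by blast+

lemma section_frames_E:
  assumes "(Z, s) \<in> frames E"
  shows "open Z" "section_on A E Z (s l)"
    "p \<in> Z \<Longrightarrow> basis_of (fibre E p) UNIV (\<lambda>l. s l p)"
proof -
  obtain U a V b where ab: "(U, a) \<in> frames imE" "(V, b) \<in> frames duE" and Z: "Z = U \<inter> V"
    and s: "s = case_sum (\<lambda>i p. (a i p, 0)) (\<lambda>j p. (0, b j p))"
    using assms unfolding frames_E by blast
  obtain c where c: "c \<in> A" "U = fst c" "a = frame c" using ab(1) by (auto simp: frames_imE)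
  show op: "open Z" using open_frames ab by (auto simp: Z)
  have "section_on A imE Z (a i)" for i
    by (rule section_on_subset[of _ U]) (use c section_frame in \<open>auto simp: Z\<close>)
  moreover have "section_on A duE Z (b j)" for j
    by (rule section_on_subset[OF section_dual_frame[OF ab(2)]]) (simp add: Z)
  ultimately show "section_on A E Z (s l)"
    by (cases l) (simp_all add: section_on_E_iff[OF op] s section_imE_0 section_duE_0)
  show "basis_of (fibre E p) UNIV (\<lambda>l. s l p)" if "p \<in> Z"
    unfolding fibre_E s case_sum_apply
    by (rule basis_of_Times[OF basis_frames_imE[OF ab(1)] basis_frames_duE[OF ab(2)]])
      (use that in \<open>auto simp: Z\<close>)
qed

lemma subspace_fibre_E: "subspace (fibre E p)"
  unfolding fibre_E by (rule subspace_Times[OF subspace_imT subspace_dual_space])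

lemma frame_E_at: obtains Z s where "(Z, s) \<in> frames E" "p \<in> Z"
proof -
  obtain c t where "p \<in> fst c" "(fst c, frame c) \<in> frames imE" "(fst c, t) \<in> frames duE"
    by (rule adapted_frames_at)
  then show ?thesis
    by (intro that[of "fst c \<inter> fst c" "case_sum (\<lambda>i p. (frame c i p, 0)) (\<lambda>j p. (0, t j p))"])
      (auto simp only: frames_E)
qed

lemma vector_bundle_E: "vector_bundle A E"
  unfolding vector_bundle_def
proof (intro conjI allI)
  show "subspace (fibre E p)" for p by (rule subspace_fibre_E)
  show "(\<Union>(U, s)\<in>frames E. U) = UNIV"
  proof (intro UNIV_eq_I[symmetric])
    fix p
    obtain Z s where "(Z, s) \<in> frames E" "p \<in> Z" by (rule frame_E_at)
    then show "p \<in> (\<Union>(U, s)\<in>frames E. U)" by blast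
  qed
qed (use section_frames_E in blast)+

lemma dim_fibre_E: "dim (fibre E p) = 2 * CARD('n)"
proof -
  obtain Z s where "(Z, s) \<in> frames E" "p \<in> Z" by (rule frame_E_at)
  from dim_basis_of[OF section_frames_E(3)[OF this]] show ?thesis by simp
qed

lemma smooth_theta:
  assumes W: "open W" and \<eta>: "section_on A E W \<eta>" and \<zeta>: "section_on A E W \<zeta>"
  shows "smooth_map_on A W (\<lambda>p. ind_theta p (\<eta> p) (\<zeta> p))"
proof -
  have *: "smooth_map_on A W (\<lambda>p. snd (\<zeta> p) (fst (\<eta> p)))"
    if "section_on A E W \<eta>" "section_on A E W \<zeta>" for \<eta> \<zeta>
  proof (rule smooth_map_on_cong[OF W])
    show "smooth_map_on A W (\<lambda>p. blinfun_apply (extend p (snd (\<zeta> p))) (fst (\<eta> p)))"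
      using that by (intro smooth_map_on_bilinear[OF bounded_bilinear_blinfun_apply W])
        (auto simp: section_on_E_iff section_on_imE_iff section_on_duE_iff W)
    show "blinfun_apply (extend p (snd (\<zeta> p))) (fst (\<eta> p)) = snd (\<zeta> p) (fst (\<eta> p))" if "p \<in> W" for p
      using that \<open>section_on A E W \<eta>\<close> \<open>section_on A E W \<zeta>\<close>
      by (intro extend_tangent) (auto simp: section_on_E_iff section_on_imE_iff section_on_duE_iff W)
  qed
  show ?thesis
    unfolding ind_theta_def
    by (intro smooth_map_on_linear[OF bounded_linear_mult_right] smooth_map_on_add W * \<eta> \<zeta>)
qed

lemma eigen_plus_E: "eigen_plus E ind_I p = imT p \<times> {0}"
proof (rule set_eqI)
  fix \<eta> :: "(real ^ 'k) \<times> (real ^ 'k \<Rightarrow> real)"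
  have "ind_I p \<eta> = \<eta> \<longleftrightarrow> snd \<eta> = 0"
    by (simp add: ind_I_def prod_eq_iff fun_eq_iff)
  then show "\<eta> \<in> eigen_plus E ind_I p \<longleftrightarrow> \<eta> \<in> imT p \<times> {0}"
    using subspace_0[OF subspace_dual_space[of "imT p"]]
    unfolding eigen_plus_def fibre_E mem_Times_iff by auto
qed

lemma eigen_minus_E: "eigen_minus E ind_I p = {0} \<times> dual_space (imT p)"
proof (rule set_eqI)
  fix \<eta> :: "(real ^ 'k) \<times> (real ^ 'k \<Rightarrow> real)"
  have "ind_I p \<eta> = - \<eta> \<longleftrightarrow> fst \<eta> = 0"
    by (simp add: ind_I_def prod_eq_iff eq_neg_iff_add_eq_0 flip: scaleR_2)
  then show "\<eta> \<in> eigen_minus E ind_I p \<longleftrightarrow> \<eta> \<in> {0} \<times> dual_space (imT p)"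
    using subspace_0[OF subspace_imT[of p]]
    unfolding eigen_minus_def fibre_E mem_Times_iff by auto
qed

lemma component_plus_E:
  assumes "\<eta> \<in> fibre E p" shows "component_plus E ind_I p \<eta> = (fst \<eta>, 0)"
  unfolding component_plus_def eigen_plus_E eigen_minus_E
proof (rule the_equality)
  show "(fst \<eta>, 0) \<in> imT p \<times> {0} \<and> (\<exists>b\<in>{0} \<times> dual_space (imT p). \<eta> = (fst \<eta>, 0) + b)"
    using assms by (intro conjI bexI[of _ "(0, snd \<eta>)"]) (auto simp: fibre_E)
qed auto

lemma component_minus_E:
  assumes "\<eta> \<in> fibre E p" shows "component_minus E ind_I p \<eta> = (0, snd \<eta>)"
  unfolding component_minus_def eigen_plus_E eigen_minus_E
proof (rule the_equality)
  show "(0, snd \<eta>) \<in> {0} \<times> dual_space (imT p) \<and> (\<exists>a\<in>imT p \<times> {0}. \<eta> = a + (0, snd \<eta>))"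
    using assms by (intro conjI bexI[of _ "(fst \<eta>, 0)"]) (auto simp: fibre_E)
qed auto

lemma subbundle_plus: "subbundle A E (eigen_plus E ind_I) CARD('n)"
  unfolding subbundle_def
proof (intro conjI allI)
  show "eigen_plus E ind_I p \<subseteq> fibre E p" for p by (auto simp: eigen_plus_def)
  fix p
  obtain c where c: "c \<in> A" "p \<in> fst c" by (rule chart_at)
  obtain e :: "nat \<Rightarrow> 'n" where e: "bij_betw e {..<CARD('n)} UNIV"
    using ex_bij_betw_nat_finite[of "UNIV :: 'n set"] by (auto simp: atLeast0LessThan)
  have "basis_of (imT q \<times> {0 :: real ^ 'k \<Rightarrow> real}) {..<CARD('n)} (\<lambda>i. (frame c (e i) q, 0))" if q: "q \<in> fst c" for q
  proof -
    let ?L = "\<lambda>x. (x, 0) :: (real ^ 'k) \<times> (real ^ 'k \<Rightarrow> real)"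
    have "basis_of (?L ` imT q) UNIV (\<lambda>i. ?L (frame c i q))"
      by (rule basis_of_linear_image[OF basis_imT[OF c(1) q]])
        (auto intro!: linearI inj_onI)
    moreover have "?L ` imT q = imT q \<times> {0}" by auto
    ultimately show ?thesis using basis_of_reindex[OF _ e, of _ "\<lambda>i. ?L (frame c i q)"] by simp
  qed
  moreover have "section_on A E (fst c) (\<lambda>q. (frame c (e i) q, 0))" for i
    by (simp add: section_on_E_iff open_chart c section_frame section_duE_0)
  ultimately show "\<exists>U s. open U \<and> p \<in> U \<and> (\<forall>i<CARD('n). section_on A E U (s i)) \<and>
      (\<forall>q\<in>U. basis_of (eigen_plus E ind_I q) {..<CARD('n)} (\<lambda>i. s i q))"
    unfolding eigen_plus_E using open_chart[OF c(1)] c(2)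
    by (intro exI[of _ "fst c"] exI[of _ "\<lambda>i q. (frame c (e i) q, 0)"]) auto
qed

lemma subbundle_minus: "subbundle A E (eigen_minus E ind_I) CARD('n)"
  unfolding subbundle_def
proof (intro conjI allI)
  show "eigen_minus E ind_I p \<subseteq> fibre E p" for p by (auto simp: eigen_minus_def)
  fix p
  obtain c t where c: "c \<in> A" "p \<in> fst c" and t: "(fst c, t) \<in> frames duE"
    by (rule adapted_frames_at)
  obtain e :: "nat \<Rightarrow> 'n" where e: "bij_betw e {..<CARD('n)} UNIV"
    using ex_bij_betw_nat_finite[of "UNIV :: 'n set"] by (auto simp: atLeast0LessThan)
  have "basis_of ({0 :: real ^ 'k} \<times> dual_space (imT q)) {..<CARD('n)} (\<lambda>i. (0, t (e i) q))" if q: "q \<in> fst c" for q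
  proof -
    let ?L = "\<lambda>\<alpha>. (0, \<alpha>) :: (real ^ 'k) \<times> (real ^ 'k \<Rightarrow> real)"
    have "basis_of (?L ` dual_space (imT q)) UNIV (\<lambda>i. ?L (t i q))"
      by (rule basis_of_linear_image[OF basis_frames_duE[OF t q]])
        (auto intro!: linearI inj_onI)
    moreover have "?L ` dual_space (imT q) = {0} \<times> dual_space (imT q)" by auto
    ultimately show ?thesis using basis_of_reindex[OF _ e, of _ "\<lambda>i. ?L (t i q)"] by simp
  qed
  moreover have "section_on A E (fst c) (\<lambda>q. (0, t (e i) q))" for i
    using section_dual_frame[OF t] by (simp add: section_on_E_iff open_chart c section_imE_0)
  ultimately show "\<exists>U s. open U \<and> p \<in> U \<and> (\<forall>i<CARD('n). section_on A E U (s i)) \<and>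
      (\<forall>q\<in>U. basis_of (eigen_minus E ind_I q) {..<CARD('n)} (\<lambda>i. s i q))"
    unfolding eigen_minus_E using open_chart[OF c(1)] c(2)
    by (intro exI[of _ "fst c"] exI[of _ "\<lambda>i q. (0, t (e i) q)"]) auto
qed

lemma section_uminus_duE:
  assumes "section_on A duE W \<zeta>" "open W" shows "section_on A duE W (\<lambda>p. - \<zeta> p)"
proof -
  have eq: "- extend p (\<zeta> p) = extend p (- \<zeta> p)" if "p \<in> W" for p
    using extend_scaleR[of "\<zeta> p" p "-1"] assms that by (simp add: section_on_duE_iff)
  have "smooth_map_on A W (\<lambda>p. - extend p (\<zeta> p))"
    by (rule smooth_map_on_minus) (use assms in \<open>auto simp: section_on_duE_iff\<close>)
  from smooth_map_on_cong[OF assms(2) eq this]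
  have "smooth_map_on A W (\<lambda>p. extend p (- \<zeta> p))" .
  then show ?thesis
    using assms subspace_neg[OF subspace_dual_space] by (auto simp: section_on_duE_iff)
qed

lemma dual_space_neg: "\<alpha> \<in> dual_space V \<Longrightarrow> - \<alpha> \<in> dual_space V"
  by (rule subspace_neg[OF subspace_dual_space])

text \<open>Testing against \<open>(x, 0)\<close> kills the covector; testing against the inner product with the
  remaining vector kills the vector.\<close>

lemma theta_nondegenerate:
  assumes \<eta>: "\<eta> \<in> fibre E p" and 0: "\<And>\<zeta>. \<zeta> \<in> fibre E p \<Longrightarrow> ind_theta p \<eta> \<zeta> = 0"
  shows "\<eta> = 0"
proof -
  have mem: "fst \<eta> \<in> imT p" "snd \<eta> \<in> dual_space (imT p)" using \<eta> by (auto simp: fibre_E mem_Times_iff)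
  have "snd \<eta> x = 0" if "x \<in> imT p" for x
    using 0[of "(x, 0)"] that subspace_0[OF subspace_dual_space[of "imT p"]]
    by (simp add: fibre_E ind_theta_def)
  then have "snd \<eta> = 0"
    by (intro dual_space_eqI[OF mem(2)]) (auto intro: subspace_0[OF subspace_dual_space])
  moreover have "(0, restr p (blinfun_inner_left (fst \<eta>))) \<in> fibre E p"
    by (simp add: fibre_E restr_mem subspace_0[OF subspace_imT])
  from 0[OF this] have "fst \<eta> \<bullet> fst \<eta> = 0"
    using mem(1) \<open>snd \<eta> = 0\<close>
    by (simp add: ind_theta_def restrict_functional_def del: inner_eq_zero_iff)
  ultimately show ?thesis by (simp add: prod_eq_iff)
qed

lemma para_hermitian_E: "para_hermitian A E ind_theta ind_I"
proof -
  have lin: "lin_on (fibre E p) (ind_theta p \<eta>) \<and> lin_on (fibre E p) (\<lambda>\<zeta>. ind_theta p \<zeta> \<eta>)"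
    if "\<eta> \<in> fibre E p" for p \<eta>
  proof -
    have \<eta>: "fst \<eta> \<in> imT p" "snd \<eta> \<in> dual_space (imT p)" using that by (auto simp: fibre_E mem_Times_iff)
    have add: "snd \<eta> (x + y) = snd \<eta> x + snd \<eta> y" if "x \<in> imT p" "y \<in> imT p" for x y
      using that \<eta>(2) by (simp add: dual_space_def lin_on_def)
    have scale: "snd \<eta> (r *\<^sub>R x) = r * snd \<eta> x" if "x \<in> imT p" for r x
      using that \<eta>(2) by (simp add: dual_space_def lin_on_def)
    show ?thesis
      by (auto simp: fibre_E lin_on_def ind_theta_def add scale algebra_simps scaleR_fun_def
          add_divide_distrib)
  qed
  have I_mem: "ind_I p \<eta> \<in> fibre E p" if "\<eta> \<in> fibre E p" for p \<eta>
    using that by (auto simp: fibre_E ind_I_def dual_space_neg)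
  have I2: "ind_I p (ind_I p \<eta>) = \<eta>" for p :: 'm and \<eta> :: "(real ^ 'k) \<times> (real ^ 'k \<Rightarrow> real)"
    by (simp add: ind_I_def)
  have "bundle_map A E E ind_I"
    unfolding bundle_map_def
  proof (intro conjI allI)
    fix p
    show "lin_on (fibre E p) (ind_I p)" by (auto simp: lin_on_def ind_I_def scaleR_fun_def fun_eq_iff)
    show "ind_I p ` fibre E p \<subseteq> fibre E p" using I_mem by blast
  next
    have "section_on A E Z (\<lambda>p. ind_I p (s l p))" if "(Z, s) \<in> frames E" for Z s l
      using section_frames_E[OF that]
      by (auto simp: section_on_E_iff ind_I_def intro: section_uminus_duE)
    then show "\<forall>(U, s)\<in>frames E. \<forall>i. section_on A E U (\<lambda>p. ind_I p (s i p))" by auto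
  qed
  moreover have "bij_betw (ind_I p) (fibre E p) (fibre E p)" for p
    by (rule bij_betw_byWitness[where f' = "ind_I p"]) (use I_mem I2 in auto)
  moreover have "\<exists>\<eta>\<in>fibre E p. ind_I p \<eta> \<noteq> \<eta>" for p
  proof -
    obtain d t where "d \<in> A" and p: "p \<in> fst d" and "(fst d, frame d) \<in> frames imE"
      and t: "(fst d, t) \<in> frames duE"
      by (rule adapted_frames_at)
    fix i :: 'n
    obtain c where "t i p \<in> dual_space (imT p)" "t i p (frame c i p) = (if i = i then 1 else 0)"
      using t p unfolding frames_duE by blast
    then obtain x where x: "t i p x = 1" by simp
    have "- t i p \<noteq> t i p" by (rule notI, drule fun_cong[of _ _ x]) (simp add: x)
    then show ?thesis
      using \<open>t i p \<in> _\<close> subspace_0[OF subspace_imT]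
      by (intro bexI[of _ "(0, t i p)"]) (auto simp: ind_I_def fibre_E)
  qed
  moreover have "eigen_plus E ind_I p \<inter> eigen_minus E ind_I p = {0} \<and>
     (\<forall>\<eta>\<in>fibre E p. \<exists>a\<in>eigen_plus E ind_I p. \<exists>b\<in>eigen_minus E ind_I p. \<eta> = a + b)" for p
    unfolding eigen_plus_E eigen_minus_E fibre_E
    using subspace_0[OF subspace_dual_space[of "imT p"]] subspace_0[OF subspace_imT[of p]]
    by (auto simp: zero_prod_def)
  moreover have "\<forall>(U, s)\<in>frames E. \<forall>i j. smooth_map_on A U (\<lambda>p. ind_theta p (s i p) (s j p))"
    using section_frames_E smooth_theta by blast
  moreover have "ind_theta p (ind_I p \<eta>) \<zeta> + ind_theta p \<eta> (ind_I p \<zeta>) = 0" for p :: 'm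
    and \<eta> \<zeta> :: "(real ^ 'k) \<times> (real ^ 'k \<Rightarrow> real)"
    by (simp add: ind_theta_def ind_I_def diff_divide_distrib)
  ultimately show ?thesis
    unfolding para_hermitian_def
    using vector_bundle_E lin theta_nondegenerate I2 subbundle_plus subbundle_minus
    by (auto simp: ind_theta_def add.commute)
qed

end

section \<open>Equiaffine immersions\<close>

locale equiaffine_immersed = affine_immersed A f \<xi>
  for A :: "('m::t2_space, 'n::finite) chart set" and f \<xi> :: "'m \<Rightarrow> real ^ 'k::finite" +
  assumes equiaffine: "equiaffine_immersion A f \<xi>"
begin

abbreviation d\<nu> where "d\<nu> \<equiv> differential A \<nu>"
abbreviation \<Phi> where "\<Phi> \<equiv> ind_Phi A f \<xi>"

text \<open>Differentiating \<open>\<langle>\<nu>, \<xi>\<rangle> = 1\<close> yields \<open>- \<tau>(u)\<close>.\<close>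

lemma conormal_xi_derivative:
  assumes u: "u \<in> T p"
  shows "blinfun_apply (d\<nu> p u) (\<xi> p) = 0"
proof -
  let ?x = "differential A \<xi> p u"
  have "transversal_form A f \<xi> p u = blinfun_apply (\<nu> p) ?x"
    unfolding transversal_form_def
  proof (rule the_equality)
    obtain w where w: "w \<in> T p" "?x = df p w + blinfun_apply (\<nu> p) ?x *\<^sub>R \<xi> p"
      by (rule differential_decompose)
    have "- w \<in> T p" "df p w = - df p (- w)"
      using w(1) by (auto simp: subspace_neg[OF subspace_tangent_space] linear_neg[OF linear_df])
    then show "\<exists>w\<in>T p. ?x = - df p w + blinfun_apply (\<nu> p) ?x *\<^sub>R \<xi> p"
      using w(2) by metis
    fix t assume "\<exists>w\<in>T p. ?x = - df p w + t *\<^sub>R \<xi> p"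
    then obtain w where "w \<in> T p" "?x = df p (- w) + t *\<^sub>R \<xi> p"
      by (auto simp: linear_neg[OF linear_df])
    then show "t = blinfun_apply (\<nu> p) ?x"
      using decomposition_unique[of "- w" p ?x t] subspace_neg[OF subspace_tangent_space] by blast
  qed
  then have "blinfun_apply (\<nu> p) ?x = 0"
    using equiaffine u by (simp add: equiaffine_immersion_def)
  moreover have "differential A (\<lambda>q. blinfun_apply (\<nu> q) (\<xi> q)) p u
      = blinfun_apply (\<nu> p) ?x + blinfun_apply (d\<nu> p u) (\<xi> p)"
    by (rule differential_bilinear[OF bounded_bilinear_blinfun_apply smooth_conormal smooth_xi]) auto
  moreover have "differential A (\<lambda>q. blinfun_apply (\<nu> q) (\<xi> q)) p u = 0"
    by (simp add: conormal_xi differential_const)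
  ultimately show ?thesis by simp
qed

lemma Phi_eq: "\<Phi> p u = (df p u, - restr p (d\<nu> p u))"
  by (simp add: ind_Phi_def fibre_imE)

lemma Phi_minus_mem: "- restr p (d\<nu> p u) \<in> dual_space (imT p)"
  by (rule dual_space_neg[OF restr_mem])

text \<open>Since \<open>\<nu>\<^sub>* u\<close> annihilates \<open>\<xi>\<close>, restricting it to tangent vectors loses no information.\<close>

lemma extend_Phi_minus: "u \<in> T p \<Longrightarrow> extend p (- restr p (d\<nu> p u)) = - d\<nu> p u"
  unfolding restrict_functional_minus[symmetric] extend_restr
  by (simp add: blinfun.minus_left conormal_xi_derivative)

lemma linear_dnu: "linear (d\<nu> p)"
  by (rule linear_differential_UNIV[OF smooth_conormal])

lemma linear_Phi: "linear (\<Phi> p)"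
proof (rule linearI)
  show "\<Phi> p (u + v) = \<Phi> p u + \<Phi> p v" for u v
    by (simp add: Phi_eq linear_add[OF linear_df] linear_add[OF linear_dnu] restrict_functional_add)
  show "\<Phi> p (r *\<^sub>R u) = r *\<^sub>R \<Phi> p u" for r u
    by (simp add: Phi_eq linear_scale[OF linear_df] linear_scale[OF linear_dnu]
        restrict_functional_scaleR)
qed

lemma Phi_mem: "u \<in> T p \<Longrightarrow> \<Phi> p u \<in> fibre E p"
  by (simp add: Phi_eq fibre_E imT_I Phi_minus_mem)

lemma section_Phi_minus:
  assumes X: "section_on A (tangent_bundle A) W X" and W: "open W"
  shows "section_on A duE W (\<lambda>q. - restr q (d\<nu> q (X q)))"
proof -
  have XT: "X q \<in> T q" if "q \<in> W" for q
    using X that by (simp add: section_on_tangent_iff[OF W])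
  have "smooth_map_on A W (\<lambda>q. - d\<nu> q (X q))"
    by (intro smooth_map_on_minus smooth_map_on_differential[OF X] W
        smooth_map_on_subset[OF smooth_conormal]) auto
  then have "smooth_map_on A W (\<lambda>q. extend q (- restr q (d\<nu> q (X q))))"
    by (rule smooth_map_on_cong[OF W, rotated]) (simp add: extend_Phi_minus XT)
  then show ?thesis by (simp add: section_on_duE_iff[OF W] Phi_minus_mem)
qed

lemma bundle_map_Phi: "bundle_map A (tangent_bundle A) E \<Phi>"
  unfolding bundle_map_def
proof (intro conjI allI)
  fix p
  show "lin_on (fibre (tangent_bundle A) p) (\<Phi> p)" by (rule linear_imp_lin_on[OF linear_Phi])
  show "\<Phi> p ` fibre (tangent_bundle A) p \<subseteq> fibre E p"
    using Phi_mem by (auto simp: tangent_bundle_def)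
next
  have "section_on A E (fst c) (\<lambda>p. \<Phi> p (coord_vec A c i p))" if c: "c \<in> A" for c i
    unfolding section_on_E_iff[OF open_chart[OF c]]
    by (simp add: Phi_eq section_frame c section_Phi_minus[OF section_on_coord_vec[OF c] open_chart[OF c]])
  then show "\<forall>(U, s)\<in>frames (tangent_bundle A). \<forall>i. section_on A E U (\<lambda>p. \<Phi> p (s i p))"
    unfolding tangent_bundle_def vbundle.simps by blast
qed

text \<open>Already the first component \<open>f\<^sub>*\<close> is injective.\<close>

lemma dim_Phi_image: "dim (\<Phi> p ` T p) = CARD('n)"
proof -
  obtain c where c: "c \<in> A" "p \<in> fst c" by (rule chart_at)
  have "inj_on (\<Phi> p) (T p)"
    using inj_df[of p] by (auto simp: inj_on_def Phi_eq)
  moreover have "basis_of (T p) UNIV (\<lambda>i. coord_vec A c i p)"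
  proof (rule basis_ofI[OF _ subspace_tangent_space])
    fix x i assume "(\<Sum>i\<in>UNIV. x i *\<^sub>R coord_vec A c i p) = 0"
    then have "tangent_lift c p (\<chi> i. x i) c = 0" using c by (simp add: sum_coord_vec)
    then show "x i = 0" using c by (simp add: tangent_lift_self vec_eq_iff)
  next
    show "coord_vec A c i p \<in> T p" for i using c by (simp add: coord_vec_eq tangent_lift_mem)
    show "\<exists>x. u = (\<Sum>i\<in>UNIV. x i *\<^sub>R coord_vec A c i p)" if "u \<in> T p" for u
      by (intro exI[of _ "\<lambda>i. u c $ i"] tangent_coord_rep c that)
  qed
  ultimately have "basis_of (\<Phi> p ` T p) UNIV (\<lambda>i. \<Phi> p (coord_vec A c i p))"
    by (intro basis_of_linear_image[OF _ linear_Phi])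
  from dim_basis_of[OF this] show ?thesis by simp
qed

text \<open>On the image, \<open>\<omega>\<close> is the skew part of \<open>\<langle>\<nu>\<^sub>* u, f\<^sub>* v\<rangle>\<close>.\<close>

lemma lagrangian_Phi: "lagrangian (fibre E p) (\<lambda>\<eta> \<zeta>. ind_theta p \<eta> (ind_I p \<zeta>)) (\<Phi> p ` T p)"
  unfolding lagrangian_def
proof (intro conjI ballI)
  show "subspace (\<Phi> p ` T p)" by (rule linear_subspace_image[OF linear_Phi subspace_tangent_space])
  show "\<Phi> p ` T p \<subseteq> fibre E p" using Phi_mem by blast
  show "2 * dim (\<Phi> p ` T p) = dim (fibre E p)" by (simp add: dim_Phi_image dim_fibre_E)
  fix x y assume "x \<in> \<Phi> p ` T p" "y \<in> \<Phi> p ` T p"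
  then obtain u v where "u \<in> T p" "v \<in> T p" "x = \<Phi> p u" "y = \<Phi> p v" by blast
  then show "ind_theta p x (ind_I p y) = 0"
    using conormal_derivative_symmetric[of u p v]
    by (simp add: ind_theta_def ind_I_def Phi_eq restrict_functional_def imT_I)
qed

lemma metric_Phi:
  assumes "u \<in> T p" "v \<in> T p"
  shows "second_fundamental_form A f \<xi> p u v = ind_theta p (\<Phi> p u) (\<Phi> p v)"
  using conormal_derivative_symmetric[OF assms] assms
  by (simp add: second_fundamental_form_eq ind_theta_def Phi_eq restrict_functional_def imT_I)

abbreviation Gp where "Gp \<equiv> subbundle_sections A E (eigen_plus E ind_I)"
abbreviation Gm where "Gm \<equiv> subbundle_sections A E (eigen_minus E ind_I)"
abbreviation Np where "Np \<equiv> ind_nabla_plus A f \<xi>"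
abbreviation Nm where "Nm \<equiv> ind_nabla_minus A f \<xi>"

lemma Gp_iff: "\<eta> \<in> Gp \<longleftrightarrow> (\<lambda>q. fst (\<eta> q)) \<in> sections A imE \<and> (\<forall>q. snd (\<eta> q) = 0)"
  by (auto simp: subbundle_sections_def sections_def section_on_E_iff eigen_plus_E mem_Times_iff
      section_on_imE_iff section_duE_0)

lemma Gm_iff: "\<zeta> \<in> Gm \<longleftrightarrow> (\<lambda>q. snd (\<zeta> q)) \<in> sections A duE \<and> (\<forall>q. fst (\<zeta> q) = 0)"
  by (auto simp: subbundle_sections_def sections_def section_on_E_iff eigen_minus_E mem_Times_iff
      section_on_duE_iff section_imE_0)

lemma Np_eq: "\<eta> \<in> Gp \<Longrightarrow> Np X \<eta> p = (proj p (differential A (\<lambda>q. fst (\<eta> q)) p (X p)), 0)"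
  unfolding ind_nabla_plus_def by (subst conn_plus_eq) (auto simp: Gp_iff sections_imE_iff)

lemma Nm_eq: "X \<in> vector_fields A \<Longrightarrow> \<zeta> \<in> Gm \<Longrightarrow>
    Nm X \<zeta> p = (0, restr p (differential A (\<lambda>q. extend q (snd (\<zeta> q))) p (X p)))"
  unfolding ind_nabla_minus_def by (subst conn_minus_eq) (auto simp: Gm_iff)

lemma connection_Np: "connection A Gp Np"
proof (rule connection_by_retraction[where emb = "\<lambda>q. fst" and ret = "\<lambda>p x. (proj p x, 0)"])
  fix X \<eta> assume X: "X \<in> vector_fields A" and \<eta>: "\<eta> \<in> Gp"
  show "Np X \<eta> p = (proj p (differential A (\<lambda>q. fst (\<eta> q)) p (X p)), 0)" for p
    by (rule Np_eq[OF \<eta>])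
  have "(\<lambda>q. proj q (differential A (\<lambda>q. fst (\<eta> q)) q (X q))) \<in> sections A imE"
    unfolding sections_imE_iff
    by (intro conjI allI proj_mem smooth_proj smooth_derivative_along[OF X])
      (use \<eta> in \<open>simp add: Gp_iff sections_imE_iff\<close>)
  then show "Np X \<eta> \<in> Gp" unfolding Gp_iff by (simp add: Np_eq[OF \<eta>])
next
  show "linear (\<lambda>x. (proj p x, 0) :: (real ^ 'k) \<times> (real ^ 'k \<Rightarrow> real))" for p
    by (intro linearI) (simp_all add: linear_add[OF linear_proj] linear_scale[OF linear_proj])
next
  fix \<eta> assume \<eta>: "\<eta> \<in> Gp"
  then show "smooth_map_on A UNIV (\<lambda>q. fst (\<eta> q))" by (simp add: Gp_iff sections_imE_iff)
  show "(proj p (fst (\<eta> p)), 0) = \<eta> p" for p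
    using \<eta> by (simp add: Gp_iff sections_imE_iff proj_tangent prod_eq_iff)
  show "(\<lambda>q. \<eta> q + \<zeta> q) \<in> Gp" if "\<zeta> \<in> Gp" for \<zeta>
    using \<eta> that unfolding Gp_iff sections_imE_iff
    by (auto intro: subspace_add[OF subspace_imT] smooth_map_on_add)
  show "(\<lambda>q. g q *\<^sub>R \<eta> q) \<in> Gp" if "smooth_map_on A UNIV g" for g
    using \<eta> that unfolding Gp_iff sections_imE_iff
    by (auto intro: subspace_scale[OF subspace_imT] smooth_map_on_bilinear[OF bounded_bilinear_scaleR])
qed (auto intro: vector_fields_add vector_fields_scale)

lemma connection_Nm: "connection A Gm Nm"
proof (rule connection_by_retraction[where emb = "\<lambda>q \<eta>. extend q (snd \<eta>)"
      and ret = "\<lambda>p \<alpha>. (0, restr p \<alpha>)"])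
  fix X \<zeta> assume X: "X \<in> vector_fields A" and \<zeta>: "\<zeta> \<in> Gm"
  show "Nm X \<zeta> p = (0, restr p (differential A (\<lambda>q. extend q (snd (\<zeta> q))) p (X p)))" for p
    by (rule Nm_eq[OF X \<zeta>])
  have "(\<lambda>p. restr p (differential A (\<lambda>q. extend q (snd (\<zeta> q))) p (X p))) \<in> sections A duE"
    unfolding sections_duE_iff
    by (intro conjI allI restr_mem smooth_extend_restr smooth_derivative_along[OF X])
      (use \<zeta> in \<open>simp add: Gm_iff sections_duE_iff\<close>)
  then show "Nm X \<zeta> \<in> Gm" unfolding Gm_iff by (simp add: Nm_eq[OF X \<zeta>])
next
  show "linear (\<lambda>\<alpha>. (0, restr p \<alpha>) :: (real ^ 'k) \<times> (real ^ 'k \<Rightarrow> real))" for p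
    by (intro linearI) (simp_all add: restrict_functional_add restrict_functional_scaleR)
next
  fix \<eta> assume \<eta>: "\<eta> \<in> Gm"
  then have mem: "snd (\<eta> p) \<in> dual_space (imT p)" for p by (simp add: Gm_iff sections_duE_iff)
  show "smooth_map_on A UNIV (\<lambda>q. extend q (snd (\<eta> q)))" using \<eta> by (simp add: Gm_iff sections_duE_iff)
  show "(0, restr p (extend p (snd (\<eta> p)))) = \<eta> p" for p
    using \<eta> mem by (simp add: Gm_iff restr_extend prod_eq_iff)
  show scale: "extend p (snd (r *\<^sub>R \<eta> p)) = r *\<^sub>R extend p (snd (\<eta> p))" for r p
    by (simp add: extend_scaleR[OF mem])
  show "(\<lambda>q. g q *\<^sub>R \<eta> q) \<in> Gm" if "smooth_map_on A UNIV g" for g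
    using \<eta> that unfolding Gm_iff sections_duE_iff
    by (auto simp: extend_scaleR[OF mem] intro: subspace_scale[OF subspace_dual_space]
        smooth_map_on_bilinear[OF bounded_bilinear_scaleR])
  fix \<zeta> assume \<zeta>: "\<zeta> \<in> Gm"
  then have mem': "snd (\<zeta> p) \<in> dual_space (imT p)" for p by (simp add: Gm_iff sections_duE_iff)
  show "extend p (snd (\<eta> p + \<zeta> p)) = extend p (snd (\<eta> p)) + extend p (snd (\<zeta> p))" for p
    by (simp add: extend_add[OF mem mem'])
  show "(\<lambda>q. \<eta> q + \<zeta> q) \<in> Gm"
    using \<eta> \<zeta> unfolding Gm_iff sections_duE_iff
    by (auto simp: extend_add[OF mem mem'] intro: subspace_add[OF subspace_dual_space] smooth_map_on_add)
qed (auto intro: vector_fields_add vector_fields_scale)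

lemma duality:
  assumes X: "X \<in> vector_fields A" and \<eta>: "\<eta> \<in> Gp" and \<zeta>: "\<zeta> \<in> Gm"
  shows "differential A (\<lambda>q. ind_theta q (\<eta> q) (\<zeta> q)) p (X p)
    = ind_theta p (Np X \<eta> p) (\<zeta> p) + ind_theta p (\<eta> p) (Nm X \<zeta> p)"
proof -
  have s: "(\<lambda>q. fst (\<eta> q)) \<in> sections A imE" "(\<lambda>q. snd (\<zeta> q)) \<in> sections A duE"
    and 0: "\<And>q. snd (\<eta> q) = 0" "\<And>q. fst (\<zeta> q) = 0"
    using \<eta> \<zeta> by (auto simp: Gp_iff Gm_iff)
  have "(\<lambda>q. ind_theta q (\<eta> q) (\<zeta> q)) = (\<lambda>q. 1 / 2 * snd (\<zeta> q) (fst (\<eta> q)))"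
    by (simp add: ind_theta_def 0)
  then have "differential A (\<lambda>q. ind_theta q (\<eta> q) (\<zeta> q)) p (X p)
      = 1 / 2 * differential A (\<lambda>q. snd (\<zeta> q) (fst (\<eta> q))) p (X p)"
    using differential_half[OF smooth_pairing[OF s]] by simp
  also have "\<dots> = ind_theta p (Np X \<eta> p) (\<zeta> p) + ind_theta p (\<eta> p) (Nm X \<zeta> p)"
    unfolding pairing_derivative[OF s]
    by (simp add: Np_eq[OF \<eta>] Nm_eq[OF X \<zeta>] ind_theta_def 0)
  finally show ?thesis .
qed

text \<open>The bracket term is tangent, hence fixed by the projection.\<close>

lemma torsion_plus:
  assumes X: "X \<in> vector_fields A" and Y: "Y \<in> vector_fields A"
  shows "Np X (\<lambda>q. (df q (Y q), 0)) p - Np Y (\<lambda>q. (df q (X q), 0)) p = (df p (lie_bracket A X Y p), 0)"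
proof -
  have G: "(\<lambda>q. (df q (Z q), 0)) \<in> Gp" if "Z \<in> vector_fields A" for Z
    using push_forward_section[OF that] by (simp add: Gp_iff)
  have "proj p (differential A (\<lambda>q. df q (Y q)) p (X p)) - proj p (differential A (\<lambda>q. df q (X q)) p (Y p))
      = proj p (df p (lie_bracket A X Y p))"
    by (simp only: linear_diff[OF linear_proj, symmetric] differential_commutator[OF smooth_f X Y])
  also have "\<dots> = df p (lie_bracket A X Y p)"
    by (intro proj_tangent imT_I lie_bracket_mem X Y)
  finally show ?thesis by (simp add: Np_eq[OF G] X Y)
qed

text \<open>Extending the sections turns them into \<open>- \<nu>\<^sub>* X\<close> and \<open>- \<nu>\<^sub>* Y\<close>, to which the commutator identity
  for \<open>\<nu>\<close> applies directly.\<close>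

lemma torsion_minus:
  assumes X: "X \<in> vector_fields A" and Y: "Y \<in> vector_fields A"
  shows "Nm X (\<lambda>q. (0, - restr q (d\<nu> q (Y q)))) p - Nm Y (\<lambda>q. (0, - restr q (d\<nu> q (X q)))) p
    = (0, - restr p (d\<nu> p (lie_bracket A X Y p)))"
proof -
  have G: "(\<lambda>q. (0, - restr q (d\<nu> q (Z q)))) \<in> Gm" if "Z \<in> vector_fields A" for Z
    using section_Phi_minus[OF vector_fieldD(3)[OF that] open_UNIV] by (simp add: Gm_iff sections_def)
  have N: "Nm V (\<lambda>q. (0, - restr q (d\<nu> q (Z q)))) p
      = (0, - restr p (differential A (\<lambda>q. d\<nu> q (Z q)) p (V p)))"
    if Z: "Z \<in> vector_fields A" and V: "V \<in> vector_fields A" for Z V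
  proof -
    have "differential A (\<lambda>q. - d\<nu> q (Z q)) p (V p) = - differential A (\<lambda>q. d\<nu> q (Z q)) p (V p)"
      by (rule differential_linear[OF bounded_linear_minus[OF bounded_linear_ident]
            smooth_derivative_along[OF Z smooth_conormal]]) simp
    then show ?thesis
      by (simp add: Nm_eq[OF V G[OF Z]] extend_Phi_minus vector_fieldD(1)[OF Z] restrict_functional_minus)
  qed
  show ?thesis
    unfolding N[OF X Y] N[OF Y X] differential_commutator[OF smooth_conormal X Y, symmetric]
      linear_diff[OF linear_restrict_functional]
    by (simp add: N X Y)
qed

lemma quasi_codazzi_induced: "quasi_codazzi A (second_fundamental_form A f \<xi>) E ind_theta ind_I \<Phi> Np Nm"
proof -
  have plus: "component_plus E ind_I p (\<Phi> p u) = (df p u, 0)"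
    and minus: "component_minus E ind_I p (\<Phi> p u) = (0, - restr p (d\<nu> p u))" if "u \<in> T p" for p u
    using component_plus_E[OF Phi_mem[OF that]] component_minus_E[OF Phi_mem[OF that]]
    by (simp_all add: Phi_eq)
  have torsion: "Np X (\<lambda>q. component_plus E ind_I q (\<Phi> q (Y q))) p
        - Np Y (\<lambda>q. component_plus E ind_I q (\<Phi> q (X q))) p
        - component_plus E ind_I p (\<Phi> p (lie_bracket A X Y p)) = 0"
    "Nm X (\<lambda>q. component_minus E ind_I q (\<Phi> q (Y q))) p
        - Nm Y (\<lambda>q. component_minus E ind_I q (\<Phi> q (X q))) p
        - component_minus E ind_I p (\<Phi> p (lie_bracket A X Y p)) = 0"
    if X: "X \<in> vector_fields A" and Y: "Y \<in> vector_fields A" for X Y p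
    using torsion_plus[OF X Y] torsion_minus[OF X Y]
    by (simp_all add: plus minus vector_fieldD(1)[OF X] vector_fieldD(1)[OF Y] lie_bracket_mem[OF X Y])
  show ?thesis
    unfolding quasi_codazzi_def Let_def
    by (intro conjI allI ballI para_hermitian_E bundle_map_Phi dim_Phi_image lagrangian_Phi metric_Phi
        connection_Np connection_Nm duality torsion)
qed

end

theorem mainTheorem3:
  fixes A :: "('m::{t2_space, second_countable_topology}, 'n::finite) chart set"
    and f \<xi> :: "'m \<Rightarrow> real ^ 'k::finite"
  assumes "smooth_atlas A"
    and "CARD('k) = CARD('n) + 1"
    and "equiaffine_immersion A f \<xi>"
  shows "quasi_codazzi A (second_fundamental_form A f \<xi>)
    (ind_bundle A f) ind_theta ind_I (ind_Phi A f \<xi>)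
    (ind_nabla_plus A f \<xi>) (ind_nabla_minus A f \<xi>)"
proof -
  interpret equiaffine_immersed A f \<xi>
    using assms by unfold_locales (auto simp: equiaffine_immersion_def)
  show ?thesis by (rule quasi_codazzi_induced)
qed

end
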